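(* Assume A1 and A3, and let $\theta=(\theta_i)_{i\ge1}$ satisfy A2. Let $(\hat\eta_n^{D},\hat\tau_n^{D})=\arg\min_{(\eta,\tau)\in(\Lambda_{n,1}\cap\hat M_n)\times\Lambda_{n,2}}\widehat{\mathrm{ARE}}^{D}_n(\eta,\tau)$. Then for any estimators $\hat\tau_n=\hat\tau_n(X)\ge0$ and $\hat\eta_n=\hat\eta_n(X)\in\hat M_n$: I. for any fixed $\epsilon>0$, $\displaystyle\lim_{n\to\infty}\mathbb{P}\Big\{L_n\big(\theta,\hat q(\hat\eta_n^{D},\hat\tau_n^{D})\big)\ge L_n\big(\theta,\hat q(\hat\eta_n,\hat\tau_n)\big)+\epsilon\Big\}=0$; II. $\displaystyle\lim_{n\to\infty}\Big(R_n\big(\theta,\hat q(\hat\eta_n^{D},\hat\tau_n^{D})\big)-R_n\big(\theta,\hat q(\hat\eta_n,\hat\tau_n)\big)\Big)\le0$.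
   Context: Setting. $(\theta_i)_{i\ge1}$ are real numbers and $(\nu_{p,i}),(\nu_{f,i}),(b_i),(h_i)$ are known sequences of positive numbers. $N(\mu,\nu)$ is the normal law with mean $\mu$ and variance $\nu$; $\phi,\Phi$ are the standard normal density and CDF. For each $n$ (large enough that $\log\log n>0$), $X=(X_1,\dots,X_n)$ has independent coordinates $X_i\sim N(\theta_i,\nu_{p,i})$. Put $\tilde b_i=b_i/(b_i+h_i)$ and $G(w,\beta)=\phi(w)+w\Phi(w)-\beta w$. The loss of a prediction $q\in\mathbb{R}^n$ is $L_n(\theta,q)=\frac1n\sum_{i=1}^n l_i(\theta_i,q_i)$ with $l_i(\theta_i,q_i)=\sqrt{\nu_{f,i}}\,(b_i+h_i)\,G\big((q_i-\theta_i)/\sqrt{\nu_{f,i}},\tilde b_i\big)$, which equals $\mathbb{E}_{Y\sim N(\theta_i,\nu_{f,i})}[b_i(Y-q_i)^++h_i(q_i-Y)^+]$. The risk of a data-dependent predictor $\hat q=\hat q(X)$ (including one with data-dependent tuning parameters) is $R_n(\theta,\hat q)=\mathbb{E}[L_n(\theta,\hat q(X))]$. Predictors. For $\eta\in\mathbb{R}$, $\tau\in[0,\infty]$: $\alpha_i(\tau)=\tau/(\tau+\nu_{p,i})$ ($\alpha_i(\infty)=1$), $\hat q_i(\eta,\tau)=\alpha_i(\tau)X_i+(1-\alpha_i(\tau))\eta+\sqrt{\nu_{f,i}+\alpha_i(\tau)\nu_{p,i}}\;\Phi^{-1}(\tilde b_i)$, $\hat q(\eta,\tau)=(\hat q_1(\eta,\tau),\dots,\hat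 q_n(\eta,\tau))$. Assumptions. A1: $0<\inf_i\tilde b_i\le\sup_i\tilde b_i<1$ and $\sup_i(b_i+h_i)<\infty$. A2: $\limsup_{n\to\infty}\frac1n\sum_{i=1}^n|\theta_i|<\infty$. A3: $\sup_i\nu_{p,i}/\nu_{f,i}<1/(4e)$, $\sup_i\nu_{f,i}<\infty$, $\inf_i\nu_{p,i}>0$. Risk estimate. For $\tau\in[0,\infty)$ (the grid $\Lambda_{n,2}$ below has only finite points) let $$c_i(\tau)=\sqrt{\frac{\nu_{f,i}+\alpha_i(\tau)\nu_{p,i}}{\nu_{f,i}+\alpha_i(\tau)^2\nu_{p,i}}}\;\Phi^{-1}(\tilde b_i),\qquad d_i(\tau)=-\frac{1-\alpha_i(\tau)}{\sqrt{\nu_{f,i}+\alpha_i(\tau)^2\nu_{p,i}}},\qquad s_i(\tau)=\sqrt{2\nu_{p,i}}\,|d_i(\tau)|.$$ Fix for each $i$ any number $\gamma(i)$ with $0<\gamma(i)<1/\sqrt{4e}-\sqrt{\nu_{p,i}/\nu_{f,i}}$, and set $\lambda_n(i)=\gamma(i)\sqrt{2\log n}$ and $K_n(i)=1+\big\lceil e^2\big(\gamma(i)+\sqrt{2\nu_{p,i}/\nu_{f,i}}\big)^2(2\log n)\big\rceil$. With $H_k$ the probabilists' Hermite polynomials and $G'$ the derivative of $G$ in its first argument, put $$S_{i,\tau}(u)=G(0,\tilde b_i)+G'(0,\tilde b_i)\,u+\phi(0)\sum_{k=0}^{K_n(i)-2}\frac{(-1)^kH_k(0)}{(k+2)!}\,s_i(\tau)^{k+2}H_{k+2}\big(u/s_i(\tau)\big)$$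 and $\tilde S_{i,\tau}(u)=\mathrm{sign}(S_{i,\tau}(u))\min\{|S_{i,\tau}(u)|,n\}$. For $x,z\in\mathbb{R}$ let $U=c_i(\tau)+d_i(\tau)(x+\sqrt{\nu_{p,i}}z)$, $V=c_i(\tau)+d_i(\tau)(x-\sqrt{\nu_{p,i}}z)$, and define $\hat T_i(x,z,\tau)=-\tilde b_iU$ if $V<-\lambda_n(i)$; $=\tilde S_{i,\tau}(U)$ if $|V|\le\lambda_n(i)$; $=(1-\tilde b_i)U$ if $V>\lambda_n(i)$. Let $\hat T_i(x,\tau)=\mathbb{E}_{Z\sim N(0,1)}[\hat T_i(x,Z,\tau)]$ and $$\widehat{\mathrm{ARE}}^{D}_n(\eta,\tau)=\frac1n\sum_{i=1}^n(b_i+h_i)\sqrt{\nu_{f,i}+\nu_{p,i}\alpha_i(\tau)^2}\;\hat T_i(X_i-\eta,\tau).$$ Location range and grids. $\hat M_n=[\hat m_n(\underline\beta_n),\hat m_n(\overline\beta_n)]$, where $\hat m_n(\beta)$ is the empirical $\beta$-quantile of $X_1,\dots,X_n$, $\underline\beta_n=\inf_{i\le n}\tilde b_i$, $\overline\beta_n=\sup_{i\le n}\tilde b_i$. Let $a_n=\log\log n$. $C_1,\dots,C_4$ are constants, independent of $n$, such that for all large $n$: $\sup_{i\le n}(b_i+h_i)\le C_1$; $\max\{\sup_{i\le n}\nu_{p,i},\sup_{i\le n}\nu_{p,i}^{-1}\}\le C_2$; $\big(\sup_{i\le n}\nu_{p,i}/\nu_{f,i}\big)\big(\sup_{i\le n}|\Phi^{-1}(\tilde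 b_i)|\big)\le C_3$; $\sup_{\theta\in\Theta_n}\frac1n\sum_{i=1}^n|\theta_i|\le C_4\sqrt{a_n}$, where $\Theta_n\subseteq\mathbb{R}^n$ is the parameter set containing all $\theta$ obeying A2. $\Lambda_{n,1}$ is an equispaced grid in $[-a_n,a_n]$ with spacing $\delta_{n,1}=(2C_1a_n)^{-1}$. With $\delta_{n,2}=\{2C_1C_2(2\phi(0)+C_3+\sqrt{a_n}\,C_4+a_n+a_n^2)\}^{-1}$, $\Lambda_{n,2}=\{\tau\ge0:\tau/(\tau+1)=(j-1)\delta_{n,2}\text{ for some }j\in\{1,\dots,\lceil1/\delta_{n,2}\rceil\}\}$. Neither grid depends on $X$.
   Formalization: The numbers γ(i) are assumed bounded away from 0 (inf γ(i) > 0), without which the claim fails; when Λ_{n,1} ∩ M̂_n is empty, so the arg min is undefined, it is taken over the points of Λ_{n,1} nearest to M̂_n; Θ_n contains each θ obeying A2 only for all large n. *)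

theory Defs
  imports "HOL-Probability.Probability"
begin

(* The sequences are indexed by i >= 1; their values at index 0 are never used. Points of R^n are
   functions on nat, of which only the coordinates in {1..n} matter. *)

record model =
  nu_p :: "nat \<Rightarrow> real"
  nu_f :: "nat \<Rightarrow> real"
  bcost :: "nat \<Rightarrow> real"
  hcost :: "nat \<Rightarrow> real"

definition btilde :: "model \<Rightarrow> nat \<Rightarrow> real" where
  "btilde P i = bcost P i / (bcost P i + hcost P i)"

definition Phi :: "real \<Rightarrow> real" where
  "Phi w = cdf std_normal_distribution w"

definition G :: "real \<Rightarrow> real \<Rightarrow> real" where
  "G w \<beta> = std_normal_density w + w * Phi w - \<beta> * w"

definition coord_loss :: "model \<Rightarrow> nat \<Rightarrow> real \<Rightarrow> real \<Rightarrow> real" where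
  "coord_loss P i t q =
     sqrt (nu_f P i) * (bcost P i + hcost P i) * G ((q - t) / sqrt (nu_f P i)) (btilde P i)"

definition loss :: "model \<Rightarrow> nat \<Rightarrow> (nat \<Rightarrow> real) \<Rightarrow> (nat \<Rightarrow> real) \<Rightarrow> real" where
  "loss P n \<theta> q = (\<Sum>i=1..n. coord_loss P i (\<theta> i) (q i)) / real n"

definition X_law :: "model \<Rightarrow> nat \<Rightarrow> (nat \<Rightarrow> real) \<Rightarrow> (nat \<Rightarrow> real) measure" where
  "X_law P n \<theta> = PiM {1..n} (\<lambda>i. density lborel (normal_density (\<theta> i) (sqrt (nu_p P i))))"

abbreviation sample_space :: "nat \<Rightarrow> (nat \<Rightarrow> real) measure" where
  "sample_space n \<equiv> PiM {1..n} (\<lambda>_. borel)"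

definition risk ::
  "model \<Rightarrow> nat \<Rightarrow> (nat \<Rightarrow> real) \<Rightarrow> ((nat \<Rightarrow> real) \<Rightarrow> (nat \<Rightarrow> real)) \<Rightarrow> real" where
  "risk P n \<theta> q = (\<integral>x. loss P n \<theta> (q x) \<partial>X_law P n \<theta>)"

definition alpha :: "model \<Rightarrow> nat \<Rightarrow> ennreal \<Rightarrow> real" where
  "alpha P i \<tau> = (if \<tau> = \<infinity> then 1 else enn2real \<tau> / (enn2real \<tau> + nu_p P i))"

definition predictor ::
  "model \<Rightarrow> real \<Rightarrow> ennreal \<Rightarrow> (nat \<Rightarrow> real) \<Rightarrow> (nat \<Rightarrow> real)" where
  "predictor P \<eta> \<tau> x = (\<lambda>i. alpha P i \<tau> * x i + (1 - alpha P i \<tau>) * \<eta>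
       + sqrt (nu_f P i + alpha P i \<tau> * nu_p P i) * inv Phi (btilde P i))"

(* Hermite polynomials in the probabilists' normalisation *)
fun hermite :: "nat \<Rightarrow> real \<Rightarrow> real" where
  "hermite 0 x = 1"
| "hermite (Suc 0) x = x"
| "hermite (Suc (Suc k)) x = x * hermite (Suc k) x - real (Suc k) * hermite k x"

definition c_coef :: "model \<Rightarrow> nat \<Rightarrow> real \<Rightarrow> real" where
  "c_coef P i \<tau> = (let \<alpha> = alpha P i (ennreal \<tau>) in
     sqrt ((nu_f P i + \<alpha> * nu_p P i) / (nu_f P i + \<alpha>\<^sup>2 * nu_p P i)) * inv Phi (btilde P i))"

definition d_coef :: "model \<Rightarrow> nat \<Rightarrow> real \<Rightarrow> real" where
  "d_coef P i \<tau> = (let \<alpha> = alpha P i (ennreal \<tau>) in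
     - ((1 - \<alpha>) / sqrt (nu_f P i + \<alpha>\<^sup>2 * nu_p P i)))"

definition s_coef :: "model \<Rightarrow> nat \<Rightarrow> real \<Rightarrow> real" where
  "s_coef P i \<tau> = sqrt (2 * nu_p P i) * \<bar>d_coef P i \<tau>\<bar>"

definition threshold :: "(nat \<Rightarrow> real) \<Rightarrow> nat \<Rightarrow> nat \<Rightarrow> real" where
  "threshold \<gamma> n i = \<gamma> i * sqrt (2 * ln (real n))"

definition K_trunc :: "model \<Rightarrow> (nat \<Rightarrow> real) \<Rightarrow> nat \<Rightarrow> nat \<Rightarrow> nat" where
  "K_trunc P \<gamma> n i = 1 + nat \<lceil>(exp 1)\<^sup>2 * (\<gamma> i + sqrt (2 * nu_p P i / nu_f P i))\<^sup>2 * (2 * ln (real n))\<rceil>"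

(* k < K - 1 is the range 0..K-2, also for K = 1, where it is empty *)
definition S_series ::
  "model \<Rightarrow> (nat \<Rightarrow> real) \<Rightarrow> nat \<Rightarrow> nat \<Rightarrow> real \<Rightarrow> real \<Rightarrow> real" where
  "S_series P \<gamma> n i \<tau> u =
     G 0 (btilde P i) + deriv (\<lambda>w. G w (btilde P i)) 0 * u
     + std_normal_density 0 * (\<Sum>k<K_trunc P \<gamma> n i - 1.
         (-1) ^ k * hermite k 0 / fact (k + 2) * s_coef P i \<tau> ^ (k + 2)
           * hermite (k + 2) (u / s_coef P i \<tau>))"

definition S_clipped ::
  "model \<Rightarrow> (nat \<Rightarrow> real) \<Rightarrow> nat \<Rightarrow> nat \<Rightarrow> real \<Rightarrow> real \<Rightarrow> real" where
  "S_clipped P \<gamma> n i \<tau> u =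
     sgn (S_series P \<gamma> n i \<tau> u) * min \<bar>S_series P \<gamma> n i \<tau> u\<bar> (real n)"

definition T_rand ::
  "model \<Rightarrow> (nat \<Rightarrow> real) \<Rightarrow> nat \<Rightarrow> nat \<Rightarrow> real \<Rightarrow> real \<Rightarrow> real \<Rightarrow> real" where
  "T_rand P \<gamma> n i x z \<tau> = (let
      U = c_coef P i \<tau> + d_coef P i \<tau> * (x + sqrt (nu_p P i) * z);
      V = c_coef P i \<tau> + d_coef P i \<tau> * (x - sqrt (nu_p P i) * z)
    in if V < - threshold \<gamma> n i then - btilde P i * U
       else if \<bar>V\<bar> \<le> threshold \<gamma> n i then S_clipped P \<gamma> n i \<tau> U
       else (1 - btilde P i) * U)"

definition T_hat ::
  "model \<Rightarrow> (nat \<Rightarrow> real) \<Rightarrow> nat \<Rightarrow> nat \<Rightarrow> real \<Rightarrow> real \<Rightarrow> real" where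
  "T_hat P \<gamma> n i x \<tau> = (\<integral>z. T_rand P \<gamma> n i x z \<tau> \<partial>std_normal_distribution)"

definition ARE_D ::
  "model \<Rightarrow> (nat \<Rightarrow> real) \<Rightarrow> nat \<Rightarrow> (nat \<Rightarrow> real) \<Rightarrow> real \<Rightarrow> real \<Rightarrow> real" where
  "ARE_D P \<gamma> n x \<eta> \<tau> =
     (\<Sum>i=1..n. (bcost P i + hcost P i)
        * sqrt (nu_f P i + nu_p P i * (alpha P i (ennreal \<tau>))\<^sup>2)
        * T_hat P \<gamma> n i (x i - \<eta>) \<tau>) / real n"

(* left-continuous inverse of the empirical distribution function *)
definition emp_quantile :: "nat \<Rightarrow> (nat \<Rightarrow> real) \<Rightarrow> real \<Rightarrow> real" where
  "emp_quantile n x \<beta> = Inf {t. real (card {i\<in>{1..n}. x i \<le> t}) / real n \<ge> \<beta>}"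

definition M_hat :: "model \<Rightarrow> nat \<Rightarrow> (nat \<Rightarrow> real) \<Rightarrow> real set" where
  "M_hat P n x = {emp_quantile n x (MIN i\<in>{1..n}. btilde P i) ..
                  emp_quantile n x (MAX i\<in>{1..n}. btilde P i)}"

definition a_seq :: "nat \<Rightarrow> real" where
  "a_seq n = ln (ln (real n))"

(* all points of the lattice s + delta Z in [-a_n, a_n]; the offset s of the equispaced grid is
   arbitrary, s = -a_n being the grid that starts at the left end point *)
definition grid1 :: "real \<Rightarrow> real \<Rightarrow> nat \<Rightarrow> real set" where
  "grid1 C1 s n = {s + of_int k / (2 * C1 * a_seq n) | k :: int. True} \<inter> {- a_seq n .. a_seq n}"

definition delta2 :: "real \<Rightarrow> real \<Rightarrow> real \<Rightarrow> real \<Rightarrow> nat \<Rightarrow> real" where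
  "delta2 C1 C2 C3 C4 n =
     1 / (2 * C1 * C2 * (2 * std_normal_density 0 + C3 + sqrt (a_seq n) * C4
            + a_seq n + (a_seq n)\<^sup>2))"

definition grid2 :: "real \<Rightarrow> real \<Rightarrow> real \<Rightarrow> real \<Rightarrow> nat \<Rightarrow> real set" where
  "grid2 C1 C2 C3 C4 n = {\<tau>. \<tau> \<ge> 0 \<and>
     (\<exists>j\<in>{1..nat \<lceil>1 / delta2 C1 C2 C3 C4 n\<rceil>}. \<tau> / (\<tau> + 1) = (real j - 1) * delta2 C1 C2 C3 C4 n)}"

(* The minimisation over eta is over L \<inter> M. This set may be empty (for constant btilde the
   interval M_hat is a single point, almost surely off the grid; also M_hat may lie outside
   [-a_n, a_n]), and then the arg min is taken over the grid points nearest to M. *)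
definition eta_candidates :: "real set \<Rightarrow> real set \<Rightarrow> real set" where
  "eta_candidates L M =
     (if L \<inter> M \<noteq> {} then L \<inter> M
      else {\<eta>\<in>L. \<forall>\<eta>'\<in>L. infdist \<eta> M \<le> infdist \<eta>' M})"

definition positive_model :: "model \<Rightarrow> bool" where
  "positive_model P \<longleftrightarrow> (\<forall>i\<ge>1. nu_p P i > 0 \<and> nu_f P i > 0 \<and> bcost P i > 0 \<and> hcost P i > 0)"

(* infima and suprema in ereal, so that unbounded families get the right value *)
definition A1 :: "model \<Rightarrow> bool" where
  "A1 P \<longleftrightarrow> 0 < (INF i\<in>{1..}. ereal (btilde P i)) \<and> (SUP i\<in>{1..}. ereal (btilde P i)) < 1
     \<and> (SUP i\<in>{1..}. ereal (bcost P i + hcost P i)) < \<infinity>"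

definition A2 :: "(nat \<Rightarrow> real) \<Rightarrow> bool" where
  "A2 \<theta> \<longleftrightarrow> limsup (\<lambda>n. ereal ((\<Sum>i=1..n. \<bar>\<theta> i\<bar>) / real n)) < \<infinity>"

definition A3 :: "model \<Rightarrow> bool" where
  "A3 P \<longleftrightarrow> (SUP i\<in>{1..}. ereal (nu_p P i / nu_f P i)) < ereal (1 / (4 * exp 1))
     \<and> (SUP i\<in>{1..}. ereal (nu_f P i)) < \<infinity>
     \<and> 0 < (INF i\<in>{1..}. ereal (nu_p P i))"

(* The constants gamma(i) must stay away from 0: if gamma(i) tends to 0 quickly then so do the
   thresholds lambda_n(i), the bias of T_hat does not vanish, and the result fails. *)
definition admissible_gamma :: "model \<Rightarrow> (nat \<Rightarrow> real) \<Rightarrow> bool" where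
  "admissible_gamma P \<gamma> \<longleftrightarrow>
     (\<forall>i\<ge>1. 0 < \<gamma> i \<and> \<gamma> i < 1 / sqrt (4 * exp 1) - sqrt (nu_p P i / nu_f P i))
     \<and> 0 < (INF i\<in>{1..}. ereal (\<gamma> i))"

(* Theta n is the parameter set in R^n. Literally every vector of R^n extends to a sequence
   satisfying A2, so "contains all theta obeying A2" is asymptotic: each such sequence has its
   first n coordinates in Theta n for all large n. *)
definition parameter_sets :: "(nat \<Rightarrow> (nat \<Rightarrow> real) set) \<Rightarrow> bool" where
  "parameter_sets \<Theta> \<longleftrightarrow> (\<forall>n. \<Theta> n \<subseteq> PiE {1..n} (\<lambda>_. UNIV)) \<and>
     (\<forall>\<theta>. A2 \<theta> \<longrightarrow> (\<forall>\<^sub>F n in sequentially. restrict \<theta> {1..n} \<in> \<Theta> n))"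

definition constants_ok ::
  "model \<Rightarrow> (nat \<Rightarrow> (nat \<Rightarrow> real) set) \<Rightarrow> real \<Rightarrow> real \<Rightarrow> real \<Rightarrow> real \<Rightarrow> bool" where
  "constants_ok P \<Theta> C1 C2 C3 C4 \<longleftrightarrow> (\<forall>\<^sub>F n in sequentially.
     (MAX i\<in>{1..n}. bcost P i + hcost P i) \<le> C1
     \<and> max (MAX i\<in>{1..n}. nu_p P i) (MAX i\<in>{1..n}. inverse (nu_p P i)) \<le> C2
     \<and> (MAX i\<in>{1..n}. nu_p P i / nu_f P i) * (MAX i\<in>{1..n}. \<bar>inv Phi (btilde P i)\<bar>) \<le> C3
     \<and> (\<forall>\<theta>\<in>\<Theta> n. (\<Sum>i=1..n. \<bar>\<theta> i\<bar>) / real n \<le> C4 * sqrt (a_seq n)))"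

end

theory Submission
  imports Defs "HOL-Real_Asymp.Real_Asymp"
begin

text \<open>
  For a fixed pair \<open>(\<eta>, \<tau>)\<close> the loss and its estimate are averages of independent terms, so their
  distance is small in mean once each summand of the estimate has small bias and mean square
  \<open>o(n)\<close> around a deterministic centre, uniformly in the mean \<open>\<omega>\<close> of the pair \<open>(U, V)\<close>.
  By rotation invariance \<open>U\<close> and \<open>V\<close> are independent. Where \<open>\<bar>\<omega>\<bar>\<close> is large, \<open>V\<close> selects one of the
  two asymptotes of \<open>G\<close>; where it is at most of order \<open>sqrt (ln n)\<close>, the truncated series is an
  unbiased estimate of a Taylor polynomial of \<open>G\<close>, because \<open>s ^ k * hermite k (U / s)\<close> has mean
  \<open>\<omega> ^ k\<close>. Its second moment is at most \<open>fact k * exp (\<omega>\<^sup>2 / (1 - s\<^sup>2))\<close>, and the numerical constant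
  in A3 makes this a power of \<open>n\<close> below 1. All errors are thus negative powers of \<open>n\<close>, while the
  grid has only a power of \<open>ln (ln n)\<close> many points, so summing over it costs nothing.

  Every point of \<open>M_hat\<close> is bounded by a multiple of the average of the \<open>\<bar>X i\<bar>\<close>, and the loss is
  Lipschitz in \<open>\<eta>\<close> and in \<open>\<tau> / (\<tau> + 1)\<close>. This bounds the regret, for every sample, by twice the error
  summed over the grid plus a multiple of \<open>(1 + average)\<^sup>2 / a_seq n\<close>. The mean of this bound tends to
  0, which gives both claims.
\<close>

section \<open>The Gaussian law and the loss function\<close>

text \<open>The delicate point is the truncation degree. To keep the bias small up to
  \<open>Lam\<close>, the series needs a degree of order ln n, but its second moment grows like exp
  (w^2 / (1 - s^2)), and averaging n summands removes it only if it is o(n). With \<rho> = sqrt (2 *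
  nu_p / nu_f), which bounds s for every \<tau>, the admissible range of \<gamma> gives (\<gamma> +
  \<rho>)^2 \<le> 1 / (2 * e), because \<gamma> + \<rho> is at most sqrt 2 times \<gamma> + sqrt
  (nu_p / nu_f). Then \<open>Lam\<close> squared is at most exp (-1/2) * ln n < (2/3) * ln n, and
  s^2 \<le> 1/5, so the second moment is n powered to (2/3) / (4/5) = 5/6, up to powers of ln n. The
  spare factor n powered to -1/6 is used twice: for the variance of the average, and for the bias
  from clipping at n, which is at most the second moment divided by n. The other part of the bias
  decays with an exponent proportional to the square of the lower bound of the \<gamma> i, which is
  why these must stay away from 0.\<close>

abbreviation "\<N> \<equiv> std_normal_distribution"
abbreviation "\<phi> \<equiv> std_normal_density"

interpretation std_normal: prob_space \<N>
  by (rule prob_space_normal_density) simp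

interpretation std_normal2: pair_prob_space \<N> \<N> ..

abbreviation std_normal2 :: "(real \<times> real) measure" where
  "std_normal2 \<equiv> \<N> \<Otimes>\<^sub>M \<N>"

lemma power2_sum_le: "(x + y)\<^sup>2 \<le> 2 * x\<^sup>2 + 2 * y\<^sup>2" for x y :: real
  using zero_le_power2[of "x - y"] by (simp add: power2_eq_square algebra_simps)

lemma power2_diff_le: "(x - y)\<^sup>2 \<le> 2 * x\<^sup>2 + 2 * y\<^sup>2" for x y :: real
  using power2_sum_le[of x "- y"] by simp

lemma sets_std_normal2 [measurable_cong]: "sets std_normal2 = sets (borel \<Otimes>\<^sub>M borel)"
  by (intro sets_pair_measure_cong) simp_all

lemma space_std_normal2 [simp]: "space std_normal2 = UNIV"
  by (simp add: space_pair_measure)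

lemma distr_std_normal_affine:
  assumes "\<sigma> \<noteq> 0"
  shows "distr \<N> borel (\<lambda>z. \<mu> + \<sigma> * z)
       = density lborel (normal_density \<mu> \<bar>\<sigma>\<bar>)"
proof -
  have "distributed \<N> lborel (\<lambda>x. x) \<phi>"
    by (simp add: distributed_def distr_id2)
  from std_normal.normal_density_affine[OF this _ assms, of \<mu>]
  have "distr \<N> lborel (\<lambda>x. \<mu> + \<sigma> * x)
      = density lborel (normal_density \<mu> \<bar>\<sigma>\<bar>)"
    by (simp add: distributed_def)
  then show ?thesis
    by (metis distr_cong sets_lborel)
qed

section \<open>Rotation invariance of a pair of independent standard normal variables\<close>

lemma nn_integral_std_normal2:
  assumes [measurable]: "f \<in> borel_measurable (borel \<Otimes>\<^sub>M borel)"
  shows "(\<integral>\<^sup>+p. f p \<partial>std_normal2)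
       = (\<integral>\<^sup>+x. \<integral>\<^sup>+z. f (x, z) * ennreal (\<phi> x * \<phi> z) \<partial>lborel \<partial>lborel)"
proof -
  have "(\<integral>\<^sup>+p. f p \<partial>std_normal2)
      = (\<integral>\<^sup>+x. \<integral>\<^sup>+z. f (x, z) \<partial>\<N> \<partial>\<N>)"
    by (subst std_normal.nn_integral_fst[symmetric]) simp_all
  also have "\<dots> = (\<integral>\<^sup>+x. \<integral>\<^sup>+z. ennreal (\<phi> x) * (ennreal (\<phi> z) * f (x, z))
      \<partial>lborel \<partial>lborel)"
    by (subst nn_integral_density, simp, simp, intro nn_integral_cong)
       (subst nn_integral_density, simp, simp, subst nn_integral_cmult, simp_all)
  finally show ?thesis
    by (simp add: ennreal_mult' mult_ac)
qed

lemma std_normal_density_rotation: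
  assumes "a\<^sup>2 + b\<^sup>2 = 1"
  shows "\<phi> (a * y + b * v) * \<phi> (b * y - a * v)
       = \<phi> y * \<phi> v"
proof -
  have "(a * y + b * v)\<^sup>2 + (b * y - a * v)\<^sup>2 = (a\<^sup>2 + b\<^sup>2) * (y\<^sup>2 + v\<^sup>2)"
    by (simp add: power2_eq_square algebra_simps)
  then have "(a * y + b * v)\<^sup>2 + (b * y - a * v)\<^sup>2 = y\<^sup>2 + v\<^sup>2"
    using assms by simp
  then show ?thesis
    by (simp add: std_normal_density_def mult_exp_exp add_divide_distrib[symmetric] minus_add_distrib[symmetric]
             del: minus_add_distrib)
qed

text \<open>The linear map is orthogonal. It is split into two affine substitutions in one variable,
  with an exchange of the integrals in between: y = a * x + b * z for fixed z, then z = b * y - a *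
  v for fixed y. The Jacobians 1 / \<bar>a\<bar> and \<bar>a\<bar> cancel; the division by a is the
  reason for \<open>a \<noteq> 0\<close>.\<close>

lemma nn_integral_std_normal2_rotation:
  assumes f [measurable]: "f \<in> borel_measurable (borel \<Otimes>\<^sub>M borel)"
    and ab: "a\<^sup>2 + b\<^sup>2 = 1" and a: "a \<noteq> 0"
  shows "(\<integral>\<^sup>+p. f (a * fst p + b * snd p, b * fst p - a * snd p) \<partial>std_normal2)
       = (\<integral>\<^sup>+p. f p \<partial>std_normal2)"
proof -
  let ?w = "\<lambda>x z. ennreal (\<phi> x * \<phi> z)"
  have "(\<integral>\<^sup>+p. f (a * fst p + b * snd p, b * fst p - a * snd p) \<partial>std_normal2)
      = (\<integral>\<^sup>+x. \<integral>\<^sup>+z. f (a * x + b * z, b * x - a * z) * ?w x z \<partial>lborel \<partial>lborel)"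
    by (subst nn_integral_std_normal2) simp_all
  also have "\<dots> = (\<integral>\<^sup>+z. \<integral>\<^sup>+x. f (a * x + b * z, b * x - a * z) * ?w x z \<partial>lborel \<partial>lborel)"
    by (rule lborel_pair.Fubini') simp
  also have "\<dots> = (\<integral>\<^sup>+z. \<integral>\<^sup>+y. \<bar>1/a\<bar> * (f (y, (b * y - z) / a) * ?w ((y - b * z) / a) z) \<partial>lborel \<partial>lborel)"
  proof (rule nn_integral_cong)
    fix z
    have eq: "b * (- (b * z / a) + 1 / a * y) - a * z = (b * y - z) / a" for y
    proof -
      have "b * (- (b * z / a) + 1 / a * y) - a * z = (b * y - (a\<^sup>2 + b\<^sup>2) * z) / a"
        using a by (simp add: field_simps power2_eq_square)
      then show ?thesis using ab by simp
    qed
    have "(\<integral>\<^sup>+x. f (a * x + b * z, b * x - a * z) * ?w x z \<partial>lborel)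
       = ennreal \<bar>1/a\<bar> * (\<integral>\<^sup>+y. f (a * (- (b * z / a) + 1 / a * y) + b * z,
            b * (- (b * z / a) + 1 / a * y) - a * z) * ?w (- (b * z / a) + 1 / a * y) z \<partial>lborel)"
      by (rule nn_integral_real_affine) (use a in auto)
    also have "\<dots> = (\<integral>\<^sup>+y. \<bar>1/a\<bar> * (f (y, (b * y - z) / a) * ?w ((y - b * z) / a) z) \<partial>lborel)"
      unfolding eq using a
      by (subst nn_integral_cmult) (simp_all add: field_simps)
    finally show "(\<integral>\<^sup>+x. f (a * x + b * z, b * x - a * z) * ?w x z \<partial>lborel)
       = (\<integral>\<^sup>+y. \<bar>1/a\<bar> * (f (y, (b * y - z) / a) * ?w ((y - b * z) / a) z) \<partial>lborel)" .
  qed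
  also have "\<dots> = (\<integral>\<^sup>+y. \<integral>\<^sup>+z. \<bar>1/a\<bar> * (f (y, (b * y - z) / a) * ?w ((y - b * z) / a) z) \<partial>lborel \<partial>lborel)"
    by (rule lborel_pair.Fubini') simp
  also have "\<dots> = (\<integral>\<^sup>+y. \<integral>\<^sup>+v. f (y, v) * ?w y v \<partial>lborel \<partial>lborel)"
  proof (rule nn_integral_cong)
    fix y
    have eq: "(y - b * (b * y + - a * v)) / a = a * y + b * v" for v
    proof -
      have "(y - b * (b * y + - a * v)) / a = ((1 - b\<^sup>2) * y + a * b * v) / a"
        by (simp add: field_simps power2_eq_square)
      also have "1 - b\<^sup>2 = a\<^sup>2" using ab by simp
      finally show ?thesis using a by (simp add: field_simps power2_eq_square)
    qed
    have "(\<integral>\<^sup>+z. \<bar>1/a\<bar> * (f (y, (b * y - z) / a) * ?w ((y - b * z) / a) z) \<partial>lborel)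
      = ennreal \<bar>- a\<bar> * (\<integral>\<^sup>+v. \<bar>1/a\<bar> * (f (y, (b * y - (b * y + - a * v)) / a)
           * ?w ((y - b * (b * y + - a * v)) / a) (b * y + - a * v)) \<partial>lborel)"
      by (rule nn_integral_real_affine) (use a in auto)
    also have "\<dots> = (\<integral>\<^sup>+v. ennreal \<bar>- a\<bar> * (\<bar>1/a\<bar> * (f (y, v) * ?w (a * y + b * v) (b * y - a * v))) \<partial>lborel)"
      unfolding eq using a by (subst nn_integral_cmult) simp_all
    also have "\<dots> = (\<integral>\<^sup>+v. f (y, v) * ?w y v \<partial>lborel)"
      using a by (intro nn_integral_cong)
        (simp add: std_normal_density_rotation[OF ab] mult.assoc[symmetric] ennreal_mult'[symmetric])
    finally show "(\<integral>\<^sup>+z. \<bar>1/a\<bar> * (f (y, (b * y - z) / a) * ?w ((y - b * z) / a) z) \<partial>lborel)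
      = (\<integral>\<^sup>+v. f (y, v) * ?w y v \<partial>lborel)" .
  qed
  also have "\<dots> = (\<integral>\<^sup>+p. f p \<partial>std_normal2)"
    by (subst nn_integral_std_normal2) simp_all
  finally show ?thesis .
qed

lemma distr_std_normal2_rotation:
  assumes ab: "a\<^sup>2 + b\<^sup>2 = 1" and a: "a \<noteq> 0"
  shows "distr std_normal2 (borel \<Otimes>\<^sub>M borel)
           (\<lambda>p. (a * fst p + b * snd p, b * fst p - a * snd p)) = std_normal2"
    (is "distr _ _ ?r = _")
proof (rule measure_eqI)
  show "sets (distr std_normal2 (borel \<Otimes>\<^sub>M borel) ?r) = sets std_normal2"
    by (simp add: sets_std_normal2)
next
  fix A assume "A \<in> sets (distr std_normal2 (borel \<Otimes>\<^sub>M borel) ?r)"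
  then have A [measurable]: "A \<in> sets (borel \<Otimes>\<^sub>M borel)" by simp
  then have A': "A \<in> sets std_normal2" by (simp add: sets_std_normal2)
  have "emeasure (distr std_normal2 (borel \<Otimes>\<^sub>M borel) ?r) A
      = (\<integral>\<^sup>+p. indicator A p \<partial>distr std_normal2 (borel \<Otimes>\<^sub>M borel) ?r)"
    by simp
  also have "\<dots> = (\<integral>\<^sup>+p. indicator A (?r p) \<partial>std_normal2)"
    by (subst nn_integral_distr) simp_all
  also have "\<dots> = (\<integral>\<^sup>+p. indicator A p \<partial>std_normal2)"
    by (rule nn_integral_std_normal2_rotation[OF _ ab a]) simp
  also have "\<dots> = emeasure std_normal2 A"
    using A' by simp
  finally show "emeasure (distr std_normal2 (borel \<Otimes>\<^sub>M borel) ?r) A = emeasure std_normal2 A" .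
qed

section \<open>Moments, tails and distribution function of the standard normal law\<close>

lemma integrable_std_normal_poly [simp]: "integrable \<N> (\<lambda>z. z ^ k)"
  by (rule integrable_std_normal_distribution_moment)

lemma integrable_std_normal_id [simp]: "integrable \<N> (\<lambda>z. z)"
  using integrable_std_normal_poly[of 1] by simp

lemma integral_std_normal_id [simp]: "(\<integral>z. z \<partial>\<N>) = 0"
  using integral_std_normal_distribution_moment_odd[of 1] by simp

lemma integral_std_normal_sq [simp]: "(\<integral>z. z\<^sup>2 \<partial>\<N>) = 1"
  using std_normal_distribution_even_moments(1)[of 1] by simp

lemma std_normal_exp_moment:
  "has_bochner_integral \<N> (\<lambda>z. exp (t * z)) (exp (t\<^sup>2 / 2))"
proof -
  have "has_bochner_integral lborel (\<lambda>z. exp (t\<^sup>2 / 2) * normal_density t 1 z) (exp (t\<^sup>2 / 2) * 1)"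
    by (rule has_bochner_integral_mult_right) (auto simp: has_bochner_integral_iff)
  also have "(\<lambda>z. exp (t\<^sup>2 / 2) * normal_density t 1 z) = (\<lambda>z. \<phi> z *\<^sub>R exp (t * z))"
    by (auto simp: normal_density_def fun_eq_iff mult_exp_exp field_simps power2_eq_square)
  finally show ?thesis
    by (intro has_bochner_integral_density) auto
qed

text \<open>Chernoff's bound with the exponential tilt equal to the threshold t, which is the
  optimal choice.\<close>

lemma std_normal_tail:
  assumes "t \<ge> 0"
  shows "measure \<N> {z. t \<le> z} \<le> exp (- t\<^sup>2 / 2)"
proof -
  have int: "integrable \<N> (\<lambda>z. exp (- t\<^sup>2) * exp (t * z))"
    using std_normal_exp_moment[of t] by (auto simp: has_bochner_integral_iff)
  have "measure \<N> {z. t \<le> z}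
      = (\<integral>z. indicator {z. t \<le> z} z \<partial>\<N>)"
    by simp
  also have "\<dots> \<le> (\<integral>z. exp (- t\<^sup>2) * exp (t * z) \<partial>\<N>)"
  proof (rule integral_mono[OF _ int])
    fix z
    show "indicator {z. t \<le> z} z \<le> exp (- t\<^sup>2) * exp (t * z)"
      using mult_left_mono[of t z t] assms
      by (auto simp: indicator_def mult_exp_exp power2_eq_square)
  qed (auto intro!: integrable_real_indicator simp: std_normal.emeasure_eq_measure)
  also have "\<dots> = exp (- t\<^sup>2) * exp (t\<^sup>2 / 2)"
    using std_normal_exp_moment[of t] by (subst integral_mult_right_zero) (simp add: has_bochner_integral_iff)
  also have "\<dots> = exp (- t\<^sup>2 / 2)"
    by (simp add: mult_exp_exp)
  finally show ?thesis .
qed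

lemma distr_std_normal_uminus: "distr \<N> borel uminus = \<N>"
  using distr_std_normal_affine[of "-1" 0] by (simp add: minus_mult_left[symmetric] cong: distr_cong)

lemma std_normal_prob_uminus:
  assumes [measurable]: "A \<in> sets borel"
  shows "measure \<N> {z. - z \<in> A} = measure \<N> A"
proof -
  have "measure (distr \<N> borel uminus) A
      = measure \<N> (uminus -` A \<inter> space \<N>)"
    by (rule measure_distr) simp_all
  then show ?thesis
    by (simp add: distr_std_normal_uminus vimage_def)
qed

lemma std_normal_atomless: "measure \<N> {w} = 0"
proof -
  have "emeasure \<N> {w} = 0"
    by (subst emeasure_density) (auto simp: nn_integral_0_iff_AE intro!: AE_I[of _ _ "{w}"] split: split_indicator)
  then show ?thesis by (simp add: measure_def)
qed

lemma Phi_eq: "Phi w = measure \<N> {..w}"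
  by (simp add: Phi_def cdf_def)

lemma Phi_eq_lessThan: "Phi w = measure \<N> {..<w}"
proof -
  have "measure \<N> ({..<w} \<union> {w})
      = measure \<N> {..<w} + measure \<N> {w}"
    by (rule std_normal.finite_measure_Union) auto
  moreover have "{..<w} \<union> {w} = {..w}" by auto
  ultimately show ?thesis by (simp add: Phi_eq std_normal_atomless)
qed

lemma Phi_uminus: "Phi (- w) = 1 - Phi w"
proof -
  have "Phi (- w) = measure \<N> {z. - z \<in> {w<..}}"
    by (auto simp: Phi_eq_lessThan intro!: arg_cong[where f="measure _"])
  also have "\<dots> = measure \<N> (space \<N> - {..w})"
    by (subst std_normal_prob_uminus) (auto intro!: arg_cong[where f="measure _"])
  also have "\<dots> = 1 - Phi w"
    by (subst std_normal.prob_compl) (simp_all add: Phi_eq)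
  finally show ?thesis .
qed

lemma Phi_nonneg: "Phi w \<ge> 0" and Phi_le_1: "Phi w \<le> 1"
  by (simp_all add: Phi_eq)

lemma std_normal_density_uminus: "\<phi> (- w) = \<phi> w"
  by (simp add: std_normal_density_def)

lemma std_normal_density_le: "\<phi> w \<le> exp (- w\<^sup>2 / 2)"
proof -
  have "sqrt (2 * pi) \<ge> sqrt 1" using pi_ge_two by (intro real_sqrt_le_mono) linarith
  then show ?thesis by (simp add: std_normal_density_def field_simps)
qed

lemma std_normal_density_has_derivative:
  "(\<phi> has_real_derivative (- w * \<phi> w)) (at w)"
  unfolding std_normal_density_def
  by (auto intro!: derivative_eq_intros simp: field_simps)

lemma continuous_std_normal_density: "isCont \<phi> w"
  using std_normal_density_has_derivative DERIV_isCont by blast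

text \<open>Near w, \<open>Phi\<close> is a constant plus the integral of the continuous density
  from w - 1, so the fundamental theorem of calculus applies on a compact interval and no improper
  integral is needed.\<close>

lemma Phi_has_derivative: "(Phi has_real_derivative \<phi> w) (at w)"
proof -
  let ?F = "\<lambda>u. integral {w - 1..u} \<phi>"
  have cont: "continuous_on {w-1..w+1} \<phi>"
    by (simp add: continuous_at_imp_continuous_on continuous_std_normal_density)
  have "(?F has_real_derivative \<phi> w) (at w within {w - 1..w + 1})"
    by (rule integral_has_real_derivative[OF cont]) auto
  then have F: "(?F has_real_derivative \<phi> w) (at w)"
    by (subst (asm) at_within_Icc_at) auto
  have eq: "Phi u = Phi (w - 1) + ?F u" if "w - 1 < u" for u
  proof -
    have "measure \<N> ({..w-1} \<union> {w-1<..u})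
       = measure \<N> {..w-1} + measure \<N> {w-1<..u}"
      by (rule std_normal.finite_measure_Union) auto
    moreover have "{..w-1} \<union> {w-1<..u} = {..u}" using that by auto
    moreover have "measure \<N> {w-1<..u} = ?F u"
    proof -
      have "measure \<N> {w-1<..u} = (\<integral>z. indicator {w-1<..u} z \<partial>\<N>)"
        by simp
      also have "\<dots> = (\<integral>z. \<phi> z * indicator {w-1<..u} z \<partial>lborel)"
        by (subst integral_density) auto
      also have "\<dots> = (LINT z:{w-1<..u}|lborel. \<phi> z)"
        by (simp add: set_lebesgue_integral_def mult.commute)
      also have "\<dots> = (LINT z:{w-1..u}|lborel. \<phi> z)"
        by (rule set_integral_cong_set) (auto simp: set_borel_measurable_def intro!: AE_I[of _ _ "{w-1}"])
      also have "\<dots> = ?F u"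
        by (rule set_borel_integral_eq_integral)
           (auto simp: set_integrable_def mult.commute[of "indicator _ _"] intro!: integrable_real_mult_indicator)
      finally show ?thesis .
    qed
    ultimately show ?thesis by (simp add: Phi_eq)
  qed
  have "((\<lambda>u. Phi (w - 1) + ?F u) has_real_derivative \<phi> w) (at w)"
    using DERIV_add[OF DERIV_const F] by simp
  moreover have "\<forall>\<^sub>F u in nhds w. Phi u = Phi (w - 1) + ?F u"
    using eventually_nhds_in_open[of "{w-1<..}" w] by (auto elim!: eventually_mono intro: eq)
  ultimately show ?thesis
    by (subst DERIV_cong_ev[OF refl _ refl]) auto
qed

lemma distr_std_normal2_fst: "distr std_normal2 \<N> fst = \<N>"
  by (rule std_normal.distr_pair_fst)

lemma distr_std_normal2_snd: "distr std_normal2 \<N> snd = \<N>"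
proof (rule measure_eqI)
  fix A assume "A \<in> sets (distr std_normal2 \<N> snd)"
  then have A: "A \<in> sets \<N>" by simp
  have "snd -` A \<inter> space std_normal2 = space \<N> \<times> A" by auto
  then have "emeasure (distr std_normal2 \<N> snd) A
      = emeasure std_normal2 (space \<N> \<times> A)"
    using A by (subst emeasure_distr) simp_all
  also have "\<dots> = emeasure \<N> (space \<N>)
      * emeasure \<N> A"
    using A by (intro std_normal.emeasure_pair_measure_Times) auto
  finally show "emeasure (distr std_normal2 \<N> snd) A = emeasure \<N> A"
    by (simp add: std_normal.emeasure_space_1 del: space_density)
qed simp

section \<open>The expected positive part of a normal variable, and the function
  \<open>G\<close>\<close>

lemma filterlim_std_normal_density_at_top: "(\<phi> \<longlongrightarrow> 0) at_top"
proof (rule Lim_null_comparison)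
  show "\<forall>\<^sub>F w in at_top. norm (\<phi> w) \<le> exp (- w)"
    using eventually_ge_at_top[of 2]
  proof eventually_elim
    case (elim w)
    then have "- w\<^sup>2 / 2 \<le> - w" by (simp add: power2_eq_square)
    with std_normal_density_le[of w] show ?case by (smt (verit) exp_le_cancel_iff normal_density_nonneg real_norm_def)
  qed
  show "((\<lambda>w::real. exp (- w)) \<longlongrightarrow> 0) at_top"
    by (rule filterlim_compose[OF exp_at_bot filterlim_uminus_at_bot_at_top])
qed

text \<open>The integrand z * \<phi> z has the antiderivative - \<phi> z, which vanishes at
  infinity.\<close>

lemma std_normal_truncated_mean:
  "(\<integral>z. indicator {a<..} z * z \<partial>\<N>) = \<phi> a"
proof -
  have int: "integrable lborel (\<lambda>z. \<phi> z * z)"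
    using integrable_std_normal_moment[of 1] by simp
  have "(LBINT z=ereal a..\<infinity>. \<phi> z * z) = 0 - (- \<phi> a)"
  proof (rule interval_integral_FTC_integrable)
    fix x :: real
    show "((\<lambda>z. - \<phi> z) has_vector_derivative \<phi> x * x) (at x)"
      unfolding has_real_derivative_iff_has_vector_derivative[symmetric]
      using DERIV_minus[OF std_normal_density_has_derivative[of x]] by (simp add: mult.commute)
    show "isCont (\<lambda>z. \<phi> z * z) x"
      by (intro continuous_intros continuous_std_normal_density)
  next
    show "set_integrable lborel (einterval (ereal a) \<infinity>) (\<lambda>z. \<phi> z * z)"
      unfolding set_integrable_def by (rule integrable_mult_indicator[OF _ int]) simp
  next
    have "((\<lambda>z. - \<phi> z) \<longlongrightarrow> - \<phi> a) (at_right a)"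
      using continuous_std_normal_density[of a]
      by (intro tendsto_intros) (simp add: isCont_def filterlim_at_split)
    then show "(((\<lambda>z. - \<phi> z) \<circ> real_of_ereal) \<longlongrightarrow> - \<phi> a) (at_right (ereal a))"
      unfolding ereal_tendsto_simps .
    have "((\<lambda>z. - \<phi> z) \<longlongrightarrow> 0) at_top"
      using tendsto_minus[OF filterlim_std_normal_density_at_top] by simp
    then show "(((\<lambda>z. - \<phi> z) \<circ> real_of_ereal) \<longlongrightarrow> 0) (at_left \<infinity>)"
      unfolding ereal_tendsto_simps .
  qed simp
  also have "(LBINT z=ereal a..\<infinity>. \<phi> z * z)
      = (\<integral>z. indicator {a<..} z * z \<partial>\<N>)"
    by (subst integral_density)
       (auto simp: interval_lebesgue_integral_def set_lebesgue_integral_def mult_ac intro!: Bochner_Integration.integral_cong)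
  finally show ?thesis by simp
qed

text \<open>This is the expectation of max 0 (w + Z) for a standard normal Z (see
  \<open>gplus_eq\<close>), and \<open>G\<close> is obtained by subtracting a linear function.
  Working with it separates the dependence on \<open>\<beta>\<close> and gives the distances of
  \<open>G\<close> from its two asymptotes: \<open>gplus w\<close> from - \<beta> * w and
  \<open>gplus (- w)\<close> from (1 - \<beta>) * w.\<close>

definition gplus :: "real \<Rightarrow> real" where
  "gplus w = \<phi> w + w * Phi w"

lemma G_gplus: "G w \<beta> = gplus w - \<beta> * w"
  by (simp add: G_def gplus_def)

lemma gplus_eq: "gplus w = (\<integral>z. max 0 (w + z) \<partial>\<N>)"
proof -
  have int: "integrable \<N> (\<lambda>z. indicator {- w<..} z * z)"
    using integrable_real_mult_indicator[OF _ integrable_std_normal_id, of "{- w<..}"]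
    by (simp add: mult.commute)
  have "(\<integral>z. max 0 (w + z) \<partial>\<N>)
      = (\<integral>z. w * indicator {- w<..} z + indicator {- w<..} z * z \<partial>\<N>)"
    by (intro Bochner_Integration.integral_cong) (auto split: split_indicator)
  also have "\<dots> = w * measure \<N> {- w<..} + \<phi> (- w)"
    by (subst Bochner_Integration.integral_add)
       (auto simp: std_normal_truncated_mean std_normal.emeasure_eq_measure int)
  also have "measure \<N> {- w<..}
      = measure \<N> (space \<N> - {..- w})"
    by (auto intro!: arg_cong[where f="measure _"])
  also have "\<dots> = Phi w"
    using Phi_uminus[of w] by (subst std_normal.prob_compl) (simp_all add: Phi_eq)
  finally show ?thesis by (simp add: gplus_def std_normal_density_uminus)
qed

lemma gplus_nonneg: "gplus w \<ge> 0"
  unfolding gplus_eq by (rule Bochner_Integration.integral_nonneg) simp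

lemma gplus_uminus: "gplus (- w) = gplus w - w"
  by (simp add: gplus_def Phi_uminus std_normal_density_uminus algebra_simps)

lemma gplus_le_density: "w \<le> 0 \<Longrightarrow> gplus w \<le> \<phi> w"
  using Phi_nonneg[of w] by (simp add: gplus_def mult_nonpos_nonneg)

lemma gplus_ge: "gplus w \<ge> w"
  using gplus_nonneg[of "- w"] by (simp add: gplus_uminus)

lemma gplus_le: "gplus w \<le> 1 + max 0 w"
proof -
  have "w * Phi w \<le> max 0 w"
    using Phi_nonneg[of w] Phi_le_1[of w]
    by (cases "w \<ge> 0") (auto simp: mult_left_le mult_nonpos_nonneg)
  moreover have "\<phi> w \<le> 1"
    using std_normal_density_le[of w] by (rule order_trans) simp
  ultimately show ?thesis by (simp add: gplus_def)
qed

lemma gplus_has_derivative: "(gplus has_real_derivative Phi w) (at w)"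
  unfolding gplus_def
  by (auto intro!: derivative_eq_intros std_normal_density_has_derivative Phi_has_derivative simp: mult_ac)

lemma gplus_mono_lipschitz: "u \<le> v \<Longrightarrow> 0 \<le> gplus v - gplus u \<and> gplus v - gplus u \<le> v - u"
proof -
  assume uv: "u \<le> v"
  show ?thesis
  proof (cases "u = v")
    case False
    with uv have "u < v" by simp
    from MVT2[OF this gplus_has_derivative] obtain z where "gplus v - gplus u = (v - u) * Phi z" by blast
    then show ?thesis using uv Phi_nonneg[of z] Phi_le_1[of z] by (simp add: mult_left_le)
  qed simp
qed

lemma isCont_gplus: "isCont gplus w"
  using gplus_has_derivative by (rule DERIV_isCont)

lemma borel_measurable_gplus [measurable]: "gplus \<in> borel_measurable borel"
  by (intro borel_measurable_continuous_onI continuous_at_imp_continuous_on ballI isCont_gplus)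

lemma G_lipschitz: "0 \<le> \<beta> \<Longrightarrow> \<beta> \<le> 1 \<Longrightarrow> \<bar>G u \<beta> - G v \<beta>\<bar> \<le> \<bar>u - v\<bar>"
proof -
  assume \<beta>: "0 \<le> \<beta>" "\<beta> \<le> 1"
  have *: "\<bar>G u \<beta> - G v \<beta>\<bar> \<le> \<bar>u - v\<bar>" if "u \<le> v" for u v
  proof -
    have "\<beta> * (v - u) \<le> 1 * (v - u)" "0 \<le> \<beta> * (v - u)" using \<beta> that mult_right_mono[of \<beta> 1 "v - u"] by auto
    with gplus_mono_lipschitz[OF that] that show ?thesis
      unfolding G_gplus right_diff_distrib by linarith
  qed
  show ?thesis using *[of u v] *[of v u] by (cases "u \<le> v") (auto simp: abs_minus_commute)
qed

lemma G_nonneg: "0 \<le> \<beta> \<Longrightarrow> \<beta> \<le> 1 \<Longrightarrow> G w \<beta> \<ge> 0"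
  using gplus_nonneg[of w] gplus_ge[of w] mult_right_mono[of \<beta> 1 w] mult_nonneg_nonpos[of \<beta> w]
  unfolding G_gplus by (cases "w \<ge> 0") auto

lemma G_has_derivative: "((\<lambda>w. G w \<beta>) has_real_derivative Phi w - \<beta>) (at w)"
  unfolding G_gplus by (auto intro!: derivative_eq_intros gplus_has_derivative)

lemma integrable_gplus_affine: "integrable \<N> (\<lambda>z. gplus (w + s * z))"
proof (rule Bochner_Integration.integrable_bound[where f="\<lambda>z. 1 + \<bar>w\<bar> + \<bar>s * z\<bar>"])
  show "AE z in std_normal_distribution. norm (gplus (w + s * z)) \<le> norm (1 + \<bar>w\<bar> + \<bar>s * z\<bar>)"
    using gplus_nonneg gplus_le by (intro always_eventually allI) (smt (verit) real_norm_def)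
qed auto

text \<open>The scaled function \<open>sqrt \<nu> * gplus (v / sqrt \<nu>)\<close> is the expected
  positive part of v plus a normal variable of variance \<open>\<nu>\<close>. Averaging over a
  further independent normal shift only adds the variances; the rotation replaces the sum of the two
  normal variables by r times a single one.\<close>

lemma gplus_convolution:
  assumes "\<nu> > 0"
  shows "(\<integral>z. sqrt \<nu> * gplus ((w + s * z) / sqrt \<nu>) \<partial>\<N>)
       = sqrt (\<nu> + s\<^sup>2) * gplus (w / sqrt (\<nu> + s\<^sup>2))"
proof -
  define r where "r = sqrt (\<nu> + s\<^sup>2)"
  have r: "r > 0" "r\<^sup>2 = \<nu> + s\<^sup>2" using assms by (simp_all add: r_def add_pos_nonneg)
  have scale: "t * gplus (v / t) = (\<integral>z. max 0 (v + t * z) \<partial>\<N>)" if "t > 0" for t v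
  proof -
    have "max 0 (v + t * z) = t * max 0 (v / t + z)" for z
    proof -
      have "t * max 0 (v / t + z) = max (t * 0) (t * (v / t + z))"
        using that by (simp add: max_mult_distrib_left)
      then show ?thesis using that by (simp add: distrib_left)
    qed
    then show ?thesis by (simp add: gplus_eq)
  qed
  let ?f = "\<lambda>p::real \<times> real. max 0 (w + r * fst p)"
  let ?r = "\<lambda>p. (sqrt \<nu> / r * fst p + s / r * snd p, s / r * fst p - sqrt \<nu> / r * snd p)"
  have int: "integrable std_normal2 (\<lambda>p. max 0 (w + (sqrt \<nu> * fst p + s * snd p)))"
  proof (rule Bochner_Integration.integrable_bound)
    have "integrable std_normal2 (\<lambda>p. fst p)" "integrable std_normal2 (\<lambda>p. snd p)"
      by (rule integrable_distr[of _ std_normal2 \<N> "\<lambda>z. z"];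
          simp add: distr_std_normal2_fst distr_std_normal2_snd)+
    then show "integrable std_normal2 (\<lambda>p. \<bar>w\<bar> + (\<bar>sqrt \<nu> * fst p\<bar> + \<bar>s * snd p\<bar>))"
      by (intro Bochner_Integration.integrable_add integrable_abs integrable_mult_right) auto
    show "AE p in std_normal2. norm (max 0 (w + (sqrt \<nu> * fst p + s * snd p)))
        \<le> norm (\<bar>w\<bar> + (\<bar>sqrt \<nu> * fst p\<bar> + \<bar>s * snd p\<bar>))"
      unfolding real_norm_def by (intro always_eventually allI) linarith
  qed measurable
  have "(\<integral>z. sqrt \<nu> * gplus ((w + s * z) / sqrt \<nu>) \<partial>\<N>)
      = (\<integral>z. \<integral>x. max 0 (w + (sqrt \<nu> * x + s * z)) \<partial>\<N> \<partial>\<N>)"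
    using assms by (subst scale) (simp_all add: add_ac)
  also have "\<dots> = (\<integral>p. max 0 (w + (sqrt \<nu> * fst p + s * snd p)) \<partial>std_normal2)"
    using std_normal2.integral_snd[of "\<lambda>x z. max 0 (w + (sqrt \<nu> * x + s * z))"] int
    by (simp add: case_prod_beta')
  also have "\<dots> = (\<integral>p. ?f (?r p) \<partial>std_normal2)"
  proof (intro Bochner_Integration.integral_cong refl)
    fix p :: "real \<times> real"
    show "max 0 (w + (sqrt \<nu> * fst p + s * snd p)) = ?f (?r p)"
      using r by (simp add: distrib_left)
  qed
  also have "\<dots> = (\<integral>p. ?f p \<partial>distr std_normal2 (borel \<Otimes>\<^sub>M borel) ?r)"
    by (rule integral_distr[symmetric]) simp_all
  also have "\<dots> = (\<integral>p. ?f p \<partial>std_normal2)"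
  proof (subst distr_std_normal2_rotation)
    show "(sqrt \<nu> / r)\<^sup>2 + (s / r)\<^sup>2 = 1"
      using r assms by (simp add: power_divide add_divide_distrib[symmetric] flip: r(2))
  qed (use r assms in simp_all)
  also have "\<dots> = (\<integral>z. max 0 (w + r * z) \<partial>distr std_normal2 \<N> fst)"
    by (rule integral_distr[symmetric]) simp_all
  also have "\<dots> = r * gplus (w / r)"
    by (simp add: scale r distr_std_normal2_fst)
  finally show ?thesis by (simp add: r_def)
qed

section \<open>Hermite polynomials of a Gaussian variable\<close>

text \<open>The Hermite recursion is repeated at the level of polynomials so that formal derivatives
  and the integrability of arbitrary polynomials are at hand.\<close>

fun hpoly :: "nat \<Rightarrow> real poly" where
  "hpoly 0 = 1"
| "hpoly (Suc 0) = [:0, 1:]"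
| "hpoly (Suc (Suc k)) = [:0, 1:] * hpoly (Suc k) - smult (real (Suc k)) (hpoly k)"

lemma poly_hpoly: "poly (hpoly k) x = hermite k x"
  by (induction k rule: hpoly.induct) simp_all

lemma pderiv_hpoly: "pderiv (hpoly (Suc k)) = smult (real (Suc k)) (hpoly k)"
proof (induction k rule: less_induct)
  case (less k)
  show ?case
  proof (cases k rule: hpoly.cases)
    case (3 j)
    have IH: "pderiv (hpoly (Suc j)) = smult (real (Suc j)) (hpoly j)"
      "pderiv (hpoly (Suc (Suc j))) = smult (real (Suc (Suc j))) (hpoly (Suc j))"
      using less.IH[of j] less.IH[of "Suc j"] 3 by simp_all
    have "poly (pderiv (hpoly (Suc k))) x = poly (smult (real (Suc k)) (hpoly k)) x" for x
      unfolding 3 hpoly.simps(3)[of "Suc j"]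
      unfolding pderiv_diff pderiv_mult pderiv_smult IH
      by (simp add: pderiv_pCons algebra_simps)
    then show ?thesis by (simp add: poly_eq_poly_eq_iff[symmetric] fun_eq_iff)
  qed (auto simp: pderiv_pCons pderiv_mult pderiv_diff)
qed

text \<open>Stein's identity for the monomial of degree k + 1, read off from the closed form of the
  even moments instead of an integration by parts.\<close>

lemma std_normal_moment_step:
  "(\<integral>z. z ^ (k + 2) \<partial>\<N>) = real (k + 1) * (\<integral>z. z ^ k \<partial>\<N>)"
proof (cases "even k")
  case True
  then obtain j where k: "k = 2 * j" by (auto elim: evenE)
  have "(\<integral>z. z ^ (k + 2) \<partial>\<N>) = fact (2 * Suc j) / (2 ^ Suc j * fact (Suc j))"
    using std_normal_distribution_even_moments(1)[of "Suc j"] by (simp add: k)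
  also have "\<dots> = real (k + 1) * (fact (2 * j) / (2 ^ j * fact j))"
    by (simp add: k divide_simps)
  finally show ?thesis using std_normal_distribution_even_moments(1)[of j] by (simp add: k)
next
  case False
  then show ?thesis
    using integral_std_normal_distribution_moment_odd[of k] integral_std_normal_distribution_moment_odd[of "k + 2"]
    by simp
qed

lemma integrable_std_normal_real_poly [simp]: "integrable \<N> (poly p)"
  by (subst poly_altdef[abs_def]) (intro Bochner_Integration.integrable_sum integrable_mult_right, simp)

lemma poly_add_induct:
  fixes p :: "real poly"
  assumes "\<And>a k. P (monom a k)" and "\<And>p q. P p \<Longrightarrow> P q \<Longrightarrow> P (p + q)"
  shows "P p"
proof -
  have "P (\<Sum>i\<le>n. monom (f i) i)" for f and n :: nat
    by (induction n) (auto intro: assms)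
  then show ?thesis by (metis poly_as_sum_of_monoms)
qed

text \<open>Stein's identity. Both sides are linear in p, so monomials suffice.\<close>

lemma std_normal_stein:
  "(\<integral>z. z * poly p z \<partial>\<N>) = (\<integral>z. poly (pderiv p) z \<partial>\<N>)"
proof (induction p rule: poly_add_induct)
  case (1 a k)
  show ?case
  proof (cases k)
    case (Suc j)
    then show ?thesis
      using std_normal_moment_step[of j]
      by (simp add: poly_monom pderiv_monom mult.left_commute[of _ a] power_Suc[symmetric] del: power_Suc)
  qed (simp add: poly_monom pderiv_monom monom_0 mult.commute)
next
  case (2 p q)
  have "(\<lambda>z. z * poly p z) = poly ([:0, 1:] * p)" for p :: "real poly" by (simp add: fun_eq_iff)
  then have "integrable \<N> (\<lambda>z. z * poly p z)" for p
    by simp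
  then show ?case using 2 by (simp add: distrib_left pderiv_add)
qed

section \<open>Means of products of Hermite polynomials under a shifted normal law\<close>

definition Epoly :: "real \<Rightarrow> real poly \<Rightarrow> real" where
  "Epoly \<mu> p = (\<integral>z. poly p (\<mu> + z) \<partial>\<N>)"

lemma integrable_std_normal_poly_affine [simp]:
  "integrable \<N> (\<lambda>z. poly p (\<mu> + s * z))"
proof -
  have "(\<lambda>z. poly p (\<mu> + s * z)) = poly (pcompose p [:\<mu>, s:])"
    by (simp add: fun_eq_iff poly_pcompose mult.commute)
  then show ?thesis by simp
qed

lemma integrable_std_normal_poly_shift [simp]:
  "integrable \<N> (\<lambda>z. poly p (\<mu> + z))"
  using integrable_std_normal_poly_affine[of p \<mu> 1] by simp

lemma Epoly_diff: "Epoly \<mu> (p - q) = Epoly \<mu> p - Epoly \<mu> q"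
  and Epoly_add: "Epoly \<mu> (p + q) = Epoly \<mu> p + Epoly \<mu> q"
  and Epoly_smult: "Epoly \<mu> (smult a p) = a * Epoly \<mu> p"
  and Epoly_1 [simp]: "Epoly \<mu> 1 = 1"
  using std_normal.prob_space by (simp_all add: Epoly_def)

lemma Epoly_stein: "Epoly \<mu> ([:0, 1:] * p) = \<mu> * Epoly \<mu> p + Epoly \<mu> (pderiv p)"
proof -
  let ?q = "pcompose p [:\<mu>, 1:]"
  have "(\<lambda>z. z * poly p (\<mu> + z)) = poly ([:0, 1:] * ?q)"
    by (simp add: fun_eq_iff poly_pcompose)
  then have int: "integrable \<N> (\<lambda>z. z * poly p (\<mu> + z))"
    by simp
  have "Epoly \<mu> ([:0, 1:] * p) = (\<integral>z. \<mu> * poly p (\<mu> + z) + z * poly p (\<mu> + z) \<partial>\<N>)"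
    by (simp add: Epoly_def distrib_right)
  also have "\<dots> = \<mu> * Epoly \<mu> p + (\<integral>z. z * poly ?q z \<partial>\<N>)"
    using int by (simp add: Epoly_def poly_pcompose)
  also have "(\<integral>z. z * poly ?q z \<partial>\<N>) = Epoly \<mu> (pderiv p)"
    unfolding std_normal_stein
    by (simp add: Epoly_def pderiv_pcompose poly_pcompose[abs_def] pderiv_pCons)
  finally show ?thesis .
qed

text \<open>Stein's identity removes the factor x from the three-term recursion. The derivative of
  \<open>hpoly k\<close> produces exactly the term that the recursion subtracts, so only the
  derivative of \<open>hpoly l\<close> survives.\<close>

lemma Epoly_hpoly_Suc:
  "Epoly \<mu> (hpoly (Suc k) * hpoly l) = \<mu> * Epoly \<mu> (hpoly k * hpoly l) + real l * Epoly \<mu> (hpoly k * hpoly (l - 1))"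
proof -
  \<comment> \<open>For l = 0 the truncated difference l - 1 is harmless, since its coefficient
    \<open>real l\<close> vanishes.\<close>
  have dl: "pderiv (hpoly l) = smult (real l) (hpoly (l - 1))"
    by (cases l) (simp_all add: pderiv_hpoly)
  show ?thesis
  proof (cases k)
    case 0
    then show ?thesis
      using Epoly_stein[of \<mu> "hpoly l"] by (simp add: dl Epoly_smult)
  next
    case (Suc j)
    have "Epoly \<mu> (hpoly (Suc k) * hpoly l)
        = Epoly \<mu> ([:0, 1:] * (hpoly k * hpoly l)) - real k * Epoly \<mu> (hpoly j * hpoly l)"
      by (simp only: Suc hpoly.simps left_diff_distrib Epoly_diff mult_smult_left Epoly_smult mult.assoc)
    also have "pderiv (hpoly k * hpoly l)
       = smult (real l) (hpoly k * hpoly (l - 1)) + smult (real k) (hpoly j * hpoly l)"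
      by (simp add: pderiv_mult dl Suc pderiv_hpoly mult.commute[of "hpoly l"] del: hpoly.simps)
    then have "Epoly \<mu> ([:0, 1:] * (hpoly k * hpoly l)) = \<mu> * Epoly \<mu> (hpoly k * hpoly l)
        + (real l * Epoly \<mu> (hpoly k * hpoly (l - 1)) + real k * Epoly \<mu> (hpoly j * hpoly l))"
      by (simp only: Epoly_stein Epoly_add Epoly_smult)
    finally show ?thesis by simp
  qed
qed

lemma Epoly_hpoly: "Epoly \<mu> (hpoly k) = \<mu> ^ k"
proof (induction k)
  case (Suc k)
  then show ?case using Epoly_hpoly_Suc[of \<mu> k 0] by simp
qed simp

text \<open>Induction on k with l arbitrary, because the recursion lowers l as well. Pascal's rule
  splits the coefficient of index Suc i; one part matches the term with l - 1 by absorption, the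
  other the term with factor \<open>\<mu>\<close>.\<close>

lemma Epoly_hpoly_mult:
  "Epoly \<mu> (hpoly k * hpoly l)
     = (\<Sum>j\<le>k. real (k choose j) * real (l choose j) * fact j * \<mu> ^ ((k - j) + (l - j)))"
proof (induction k arbitrary: l)
  case 0
  then show ?case by (simp add: Epoly_hpoly)
next
  case (Suc k)
  let ?F = "\<lambda>k l j. real (k choose j) * real (l choose j) * fact j * \<mu> ^ ((k - j) + (l - j))"
  have "(\<Sum>j\<le>Suc k. ?F (Suc k) l j) = \<mu> ^ (Suc k + l) + (\<Sum>i\<le>k. ?F (Suc k) l (Suc i))"
    by (subst sum.atMost_Suc_shift) simp
  also have "(\<Sum>i\<le>k. ?F (Suc k) l (Suc i)) = (\<Sum>i\<le>k. real l * ?F k (l - 1) i + \<mu> * ?F k l (Suc i))"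
  proof (rule sum.cong[OF refl])
    fix i assume i: "i \<in> {..k}"
    have absorb: "real (l choose Suc i) * fact (Suc i) = real l * (real (l - 1 choose i) * fact i)"
    proof (cases l)
      case l: (Suc m)
      have "real (Suc i * (Suc m choose Suc i)) = real (Suc m * (m choose i))"
        by (simp only: Suc_times_binomial)
      then have "real (Suc i) * real (Suc m choose Suc i) * fact i = real (Suc m) * real (m choose i) * fact i"
        by (simp only: of_nat_mult)
      then show ?thesis unfolding l fact_Suc by (simp only: mult_ac diff_Suc_1)
    qed simp
    have "?F (Suc k) l (Suc i) = real (k choose i) * (real (l choose Suc i) * fact (Suc i)) * \<mu> ^ ((k - i) + (l - Suc i))
        + real (k choose Suc i) * (real (l choose Suc i) * fact (Suc i)) * \<mu> ^ ((k - i) + (l - Suc i))"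
      by (simp only: binomial_Suc_Suc of_nat_add diff_Suc_Suc) (simp only: algebra_simps)
    also have "real (k choose i) * (real (l choose Suc i) * fact (Suc i)) * \<mu> ^ ((k - i) + (l - Suc i))
        = real l * ?F k (l - 1) i"
      unfolding absorb by simp
    also have "real (k choose Suc i) * (real (l choose Suc i) * fact (Suc i)) * \<mu> ^ ((k - i) + (l - Suc i))
        = \<mu> * ?F k l (Suc i)"
    \<comment> \<open>For i = k the binomial coefficient \<open>k choose Suc i\<close> is zero on
      both sides; otherwise the exponent k - i supplies the extra factor
      \<open>\<mu>\<close>.\<close>
    proof (cases "i = k")
      case False
      with i have "k - i = Suc (k - Suc i)" by auto
      then show ?thesis by (simp only: add_Suc power_Suc mult_ac)
    qed simp
    finally show "?F (Suc k) l (Suc i) = real l * ?F k (l - 1) i + \<mu> * ?F k l (Suc i)" .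
  qed
  also have "\<dots> = real l * (\<Sum>i\<le>k. ?F k (l - 1) i) + \<mu> * (\<Sum>i\<le>k. ?F k l (Suc i))"
    by (simp only: sum.distrib sum_distrib_left)
  also have "(\<Sum>i\<le>k. ?F k l (Suc i)) = (\<Sum>j\<le>Suc k. ?F k l j) - \<mu> ^ (k + l)"
    unfolding sum.atMost_Suc_shift[of "?F k l"] by simp
  also have "(\<Sum>j\<le>Suc k. ?F k l j) = (\<Sum>j\<le>k. ?F k l j)"
    by simp
  finally have "(\<Sum>j\<le>Suc k. ?F (Suc k) l j)
      = \<mu> * (\<Sum>j\<le>k. ?F k l j) + real l * (\<Sum>j\<le>k. ?F k (l - 1) j)"
    by (simp add: algebra_simps)
  then show ?case by (simp only: Epoly_hpoly_Suc Suc.IH)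
qed

lemma power_div_fact_le_exp:
  assumes "(x::real) \<ge> 0"
  shows "x ^ n / fact n \<le> exp x"
proof -
  have sm: "summable (\<lambda>n. x ^ n / fact n)"
    using summable_exp_generic[of x] by (simp add: divide_inverse mult.commute)
  have "(\<Sum>k\<in>{n}. x ^ k / fact k) \<le> (\<Sum>k. x ^ k / fact k)"
    by (rule sum_le_suminf[OF sm]) (use assms in auto)
  then show ?thesis by (simp add: exp_def divide_inverse mult.commute)
qed

lemma hermite_scaled_mean:
  assumes "s \<noteq> 0"
  shows "(\<integral>z. s ^ k * hermite k ((w + s * z) / s) \<partial>\<N>) = w ^ k"
proof -
  have "(\<integral>z. s ^ k * hermite k ((w + s * z) / s) \<partial>\<N>) = s ^ k * Epoly (w / s) (hpoly k)"
    using assms by (simp add: Epoly_def poly_hpoly add_divide_distrib)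
  also have "\<dots> = w ^ k" using assms by (simp add: Epoly_hpoly power_divide)
  finally show ?thesis .
qed

text \<open>With \<open>\<delta> = 1 - s\<^sup>2\<close>, bounding \<open>(w\<^sup>2 / \<delta>) ^ m / fact m\<close> by \<open>exp (w\<^sup>2 / \<delta>)\<close> turns the exact sum into
  the binomial expansion of \<open>(s\<^sup>2 + \<delta>) ^ k = 1\<close>.\<close>

lemma hermite_scaled_square_mean:
  assumes s: "0 < s" "s < 1"
  shows "(\<integral>z. (s ^ k * hermite k ((w + s * z) / s))\<^sup>2 \<partial>\<N>)
       \<le> fact k * exp (w\<^sup>2 / (1 - s\<^sup>2))"
proof -
  define \<delta> where "\<delta> = 1 - s\<^sup>2"
  have \<delta>: "\<delta> > 0" using s by (simp add: \<delta>_def power_less_one_iff)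
  have "(\<integral>z. (s ^ k * hermite k ((w + s * z) / s))\<^sup>2 \<partial>\<N>)
      = (\<integral>z. s ^ (2 * k) * (hermite k (w / s + z) * hermite k (w / s + z)) \<partial>\<N>)"
  proof (intro Bochner_Integration.integral_cong refl)
    have "s ^ (2 * k) = s ^ k * s ^ k" by (simp add: mult_2 power_add)
    then show "(s ^ k * hermite k ((w + s * z) / s))\<^sup>2
        = s ^ (2 * k) * (hermite k (w / s + z) * hermite k (w / s + z))" for z
      using s by (simp only: power2_eq_square) (simp add: add_divide_distrib)
  qed
  also have "\<dots> = s ^ (2 * k) * Epoly (w / s) (hpoly k * hpoly k)"
    by (simp add: Epoly_def poly_hpoly)
  also have "\<dots> = (\<Sum>j\<le>k. s ^ (2 * k) * (real (k choose j) * real (k choose j) * fact j * (w / s) ^ ((k - j) + (k - j))))"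
    by (simp add: Epoly_hpoly_mult sum_distrib_left)
  also have "\<dots> \<le> (\<Sum>j\<le>k. fact k * exp (w\<^sup>2 / \<delta>) * (real (k choose j) * (s\<^sup>2) ^ j * \<delta> ^ (k - j)))"
  proof (rule sum_mono)
    fix j assume "j \<in> {..k}"
    then have j: "j \<le> k" by simp
    have "s ^ (2 * k) * (w / s) ^ ((k - j) + (k - j)) = (s\<^sup>2) ^ j * (w\<^sup>2) ^ (k - j)"
    proof -
      have "s ^ (2 * k) = s ^ (2 * j + 2 * (k - j))" using j by (intro arg_cong[where f="power s"]) simp
      then have "s ^ (2 * k) = (s\<^sup>2) ^ j * s ^ (2 * (k - j))"
        by (simp only: power_add power_mult)
      moreover have "(w / s) ^ ((k - j) + (k - j)) = (w\<^sup>2) ^ (k - j) / s ^ (2 * (k - j))"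
        by (simp add: power_divide mult_2[symmetric] power_mult)
      ultimately show ?thesis using s by simp
    qed
    \<comment> \<open>Of the two equal binomial coefficients, one absorbs \<open>fact j\<close> and
      leaves the quotient to be bounded by the exponential; the other is kept as the binomial
      weight.\<close>
    moreover have "real (k choose j) * fact j = fact k / fact (k - j)"
      using j by (simp add: binomial_fact)
    moreover have "s ^ (2 * k) * (real (k choose j) * real (k choose j) * fact j * (w / s) ^ ((k - j) + (k - j)))
      = real (k choose j) * (real (k choose j) * fact j) * (s ^ (2 * k) * (w / s) ^ ((k - j) + (k - j)))"
      by (simp only: mult_ac)
    ultimately have "s ^ (2 * k) * (real (k choose j) * real (k choose j) * fact j * (w / s) ^ ((k - j) + (k - j)))
      = real (k choose j) * (fact k / fact (k - j)) * ((s\<^sup>2) ^ j * (w\<^sup>2) ^ (k - j))"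
      by (simp only:)
    also have "(w\<^sup>2) ^ (k - j) = \<delta> ^ (k - j) * (w\<^sup>2 / \<delta>) ^ (k - j)"
      using \<delta> by (simp add: power_divide)
    also have "real (k choose j) * (fact k / fact (k - j)) * ((s\<^sup>2) ^ j * (\<delta> ^ (k - j) * (w\<^sup>2 / \<delta>) ^ (k - j)))
      = fact k * (real (k choose j) * (s\<^sup>2) ^ j * \<delta> ^ (k - j)) * ((w\<^sup>2 / \<delta>) ^ (k - j) / fact (k - j))"
      by simp
    also have "\<dots> \<le> fact k * (real (k choose j) * (s\<^sup>2) ^ j * \<delta> ^ (k - j)) * exp (w\<^sup>2 / \<delta>)"
      using \<delta> by (intro mult_left_mono power_div_fact_le_exp) auto
    finally show "s ^ (2 * k) * (real (k choose j) * real (k choose j) * fact j * (w / s) ^ ((k - j) + (k - j)))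
      \<le> fact k * exp (w\<^sup>2 / \<delta>) * (real (k choose j) * (s\<^sup>2) ^ j * \<delta> ^ (k - j))"
      by (simp only: mult_ac)
  qed
  also have "\<dots> = fact k * exp (w\<^sup>2 / \<delta>) * (s\<^sup>2 + \<delta>) ^ k"
    by (simp only: sum_distrib_left[symmetric] binomial_ring)
  also have "\<dots> = fact k * exp (w\<^sup>2 / (1 - s\<^sup>2))"
    by (simp add: \<delta>_def)
  finally show ?thesis .
qed

section \<open>The estimating series, its mean and its second moment\<close>

definition hermite_series :: "real \<Rightarrow> real \<Rightarrow> nat \<Rightarrow> real \<Rightarrow> real" where
  "hermite_series \<beta> s M u = G 0 \<beta> + (1/2 - \<beta>) * u
     + \<phi> 0 * (\<Sum>k<M. (-1) ^ k * hermite k 0 / fact (k + 2) * s ^ (k + 2) * hermite (k + 2) (u / s))"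

text \<open>The Taylor polynomial of \<open>G\<close> at 0 of degree at most M + 1: the first
  derivative there is Phi 0 - \<beta> = 1/2 - \<beta>, and the second derivative is \<phi>, whose
  derivative of order k at 0 is (-1)^k * hermite k 0 * \<phi> 0.\<close>

definition G_taylor :: "real \<Rightarrow> nat \<Rightarrow> real \<Rightarrow> real" where
  "G_taylor \<beta> M w = G 0 \<beta> + (1/2 - \<beta>) * w
     + \<phi> 0 * (\<Sum>k<M. (-1) ^ k * hermite k 0 / fact (k + 2) * w ^ (k + 2))"

lemma hermite_series_poly: "\<exists>p. hermite_series \<beta> s M = poly p"
proof
  let ?p = "[:G 0 \<beta>, 1/2 - \<beta>:] + smult (\<phi> 0)
     (\<Sum>k<M. smult ((-1) ^ k * hermite k 0 / fact (k + 2) * s ^ (k + 2)) (pcompose (hpoly (k + 2)) [:0, 1/s:]))"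
  show "hermite_series \<beta> s M = poly ?p"
    unfolding hermite_series_def
    by (simp add: fun_eq_iff poly_sum poly_pcompose poly_hpoly del: hpoly.simps hermite.simps)
qed

lemma borel_measurable_hermite_series [measurable]: "hermite_series \<beta> s M \<in> borel_measurable borel"
proof -
  obtain p where "hermite_series \<beta> s M = poly p" using hermite_series_poly by blast
  then show ?thesis by (simp add: borel_measurable_continuous_onI[OF continuous_on_poly[OF continuous_on_id]])
qed

lemma integrable_hermite_series:
  "integrable \<N> (\<lambda>z. hermite_series \<beta> s M (w + \<sigma> * z))"
  "integrable \<N> (\<lambda>z. (hermite_series \<beta> s M (w + \<sigma> * z))\<^sup>2)"
proof -
  obtain p where p: "hermite_series \<beta> s M = poly p" using hermite_series_poly by blast
  show "integrable \<N> (\<lambda>z. hermite_series \<beta> s M (w + \<sigma> * z))"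
    by (simp add: p)
  show "integrable \<N> (\<lambda>z. (hermite_series \<beta> s M (w + \<sigma> * z))\<^sup>2)"
    using integrable_std_normal_poly_affine[of "p^2" w \<sigma>] by (simp add: p)
qed

lemma integrable_hermite_affine:
  "integrable \<N> (\<lambda>z. hermite k ((w + s * z) / s))"
  "integrable \<N> (\<lambda>z. (hermite k ((w + s * z) / s))\<^sup>2)"
proof -
  have eq: "(w + s * z) / s = w / s + (s / s) * z" for z
    by (simp add: add_divide_distrib)
  show "integrable \<N> (\<lambda>z. hermite k ((w + s * z) / s))"
    unfolding eq poly_hpoly[symmetric] by (rule integrable_std_normal_poly_affine)
  show "integrable \<N> (\<lambda>z. (hermite k ((w + s * z) / s))\<^sup>2)"
    unfolding eq poly_hpoly[symmetric] poly_power[symmetric] by (rule integrable_std_normal_poly_affine)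
qed

lemma hermite_series_mean:
  assumes "s \<noteq> 0"
  shows "(\<integral>z. hermite_series \<beta> s M (w + s * z) \<partial>\<N>) = G_taylor \<beta> M w"
proof -
  define t where "t k z = (-1) ^ k * hermite k 0 / fact (k + 2) * (s ^ (k + 2) * hermite (k + 2) ((w + s * z) / s))"
    for k z
  have int: "integrable \<N> (t k)" for k
    unfolding t_def by (intro integrable_mult_right integrable_hermite_affine)
  have mean: "(\<integral>z. t k z \<partial>\<N>) = (-1) ^ k * hermite k 0 / fact (k + 2) * w ^ (k + 2)" for k
    using hermite_scaled_mean[OF assms, of "k + 2" w] by (simp only: t_def integral_mult_right_zero)
  have "(\<integral>z. hermite_series \<beta> s M (w + s * z) \<partial>\<N>)
      = (\<integral>z. G 0 \<beta> + (1/2 - \<beta>) * (w + s * z) + \<phi> 0 * (\<Sum>k<M. t k z) \<partial>\<N>)"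
    unfolding hermite_series_def t_def by (simp only: mult.assoc)
  also have "\<dots> = G 0 \<beta> + (1/2 - \<beta>) * w + \<phi> 0 * (\<Sum>k<M. \<integral>z. t k z \<partial>\<N>)"
    using int std_normal.prob_space by simp
  finally show ?thesis by (simp only: mean G_taylor_def)
qed

text \<open>Two steps of the recursion multiply the square by (k + 1)^2, while the factorial gains
  the larger factor (k + 1) * (k + 2).\<close>

lemma hermite_zero_square_le: "(hermite k 0)\<^sup>2 \<le> fact k"
proof (induction k rule: hpoly.induct)
  case (3 k)
  have "(hermite (Suc (Suc k)) 0)\<^sup>2 = (real (Suc k))\<^sup>2 * (hermite k 0)\<^sup>2"
    by (simp add: power_mult_distrib)
  also have "\<dots> \<le> (real (Suc k))\<^sup>2 * fact k"
    using 3 by (intro mult_left_mono) auto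
  also have "\<dots> = real (Suc k) * fact (Suc k)"
    by (simp add: power2_eq_square)
  also have "\<dots> \<le> real (Suc (Suc k)) * fact (Suc k)"
    by (intro mult_right_mono) auto
  also have "\<dots> = fact (Suc (Suc k))"
    by (simp add: fact_Suc)
  finally show ?case .
qed simp_all

lemma std_normal_density_0_le: "\<phi> 0 \<le> 1"
  using std_normal_density_le[of 0] by simp

text \<open>Each of the M + 2 summands has mean square at most exp (w^2 / (1 - s^2)), and
  Cauchy-Schwarz turns this into the factor (M + 2)^2. For a Hermite summand of degree j the squared
  coefficient is at most 1 / fact j, which cancels the factorial in
  \<open>hermite_scaled_square_mean\<close>.\<close>

lemma hermite_series_square_mean:
  assumes s: "0 < s" "s < 1" and \<beta>: "0 \<le> \<beta>" "\<beta> \<le> 1"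
  shows "(\<integral>z. (hermite_series \<beta> s M (w + s * z))\<^sup>2 \<partial>\<N>)
       \<le> (real M + 2)\<^sup>2 * exp (w\<^sup>2 / (1 - s\<^sup>2))"
proof -
  let ?E = "exp (w\<^sup>2 / (1 - s\<^sup>2))"
  have \<delta>: "0 < 1 - s\<^sup>2" "1 - s\<^sup>2 \<le> 1" using s by (simp_all add: power_less_one_iff)
  define c where "c k = \<phi> 0 * ((-1) ^ k * hermite k 0 / fact (k + 2))" for k
  define H where "H j z = s ^ j * hermite j ((w + s * z) / s)" for j z
  \<comment> \<open>The summands are indexed by their degree: the term of degree j \<ge> 2 carries
    the coefficient of index j - 2.\<close>
  define f where "f j z = (if j = 0 then G 0 \<beta> else if j = 1 then (1/2 - \<beta>) * (w + s * z)
      else c (j - 2) * H j z)" for j :: nat and z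
  have int: "integrable \<N> (\<lambda>z. (f j z)\<^sup>2)" for j
  proof -
    consider "j = 0" | "j = 1" | "j \<noteq> 0" "j \<noteq> 1" by blast
    then show ?thesis
    proof cases
      case 2
      then show ?thesis
        using integrable_std_normal_poly_affine[of "[:0, 1:]^2" w s] by (simp add: f_def power_mult_distrib)
    next
      case 3
      then have "(f j z)\<^sup>2 = (c (j - 2))\<^sup>2 * (H j z)\<^sup>2" for z
        by (simp only: f_def if_False power_mult_distrib)
      moreover have "integrable \<N> (\<lambda>z. (H j z)\<^sup>2)"
        unfolding H_def power_mult_distrib by (intro integrable_mult_right integrable_hermite_affine)
      ultimately show ?thesis by simp
    qed (simp add: f_def)
  qed
  have f2: "(\<integral>z. (f j z)\<^sup>2 \<partial>\<N>) \<le> ?E" for j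
  proof -
    have E1: "1 + w\<^sup>2 \<le> ?E"
    proof -
      have "w\<^sup>2 / 1 \<le> w\<^sup>2 / (1 - s\<^sup>2)" using \<delta> by (intro divide_left_mono) auto
      then show ?thesis using exp_ge_add_one_self[of "w\<^sup>2 / (1 - s\<^sup>2)"] by linarith
    qed
    consider "j = 0" | "j = 1" | k where "j = k + 2"
    proof (cases "j < 2")
      case False
      then have "j = (j - 2) + 2" by simp
      then show ?thesis by (rule that(3))
    qed (use that in \<open>auto simp: less_2_cases_iff\<close>)
    then show ?thesis
    proof cases
      case 1
      have "(\<phi> 0)\<^sup>2 \<le> 1"
        using std_normal_density_0_le by (simp add: power_le_one)
      also have "\<dots> \<le> ?E" using \<delta> by simp
      finally show ?thesis using 1 std_normal.prob_space by (simp add: f_def G_def)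
    next
      case 2
      have "\<bar>1/2 - \<beta>\<bar>\<^sup>2 \<le> 1\<^sup>2" using \<beta> by (intro power_mono) auto
      then have b: "(1/2 - \<beta>)\<^sup>2 \<le> 1" by simp
      have "(\<integral>z. (w + s * z)\<^sup>2 \<partial>\<N>)
          = (\<integral>z. w\<^sup>2 + 2 * w * s * z + s\<^sup>2 * z\<^sup>2 \<partial>\<N>)"
        by (intro Bochner_Integration.integral_cong) (auto simp: power2_eq_square algebra_simps)
      also have "\<dots> = w\<^sup>2 + s\<^sup>2"
        using std_normal.prob_space by simp
      also have "\<dots> \<le> 1 + w\<^sup>2" using \<delta> by simp
      finally have "(1/2 - \<beta>)\<^sup>2 * (\<integral>z. (w + s * z)\<^sup>2 \<partial>\<N>) \<le> 1 * (1 + w\<^sup>2)"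
        using b by (intro mult_mono) auto
      then show ?thesis using 2 E1 by (simp add: f_def power_mult_distrib)
    next
      case (3 k)
      have "(f j z)\<^sup>2 = (c k)\<^sup>2 * (H j z)\<^sup>2" for z
        by (simp add: 3 f_def power_mult_distrib)
      then have "(\<integral>z. (f j z)\<^sup>2 \<partial>\<N>)
          = (c k)\<^sup>2 * (\<integral>z. (H j z)\<^sup>2 \<partial>\<N>)"
        by (simp only: integral_mult_right_zero)
      also have "\<dots> \<le> (c k)\<^sup>2 * (fact j * ?E)"
        unfolding H_def by (intro mult_left_mono hermite_scaled_square_mean s zero_le_power2)
      also have "(c k)\<^sup>2 = (\<phi> 0)\<^sup>2 * ((hermite k 0)\<^sup>2 / (fact j)\<^sup>2)"
      proof -
        have "((-1::real) ^ k)\<^sup>2 = 1" by (simp add: power_mult[symmetric])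
        then show ?thesis by (simp only: c_def 3 power_mult_distrib power_divide mult_1)
      qed
      also have "\<dots> * (fact j * ?E) \<le> (1 * (fact j / (fact j)\<^sup>2)) * (fact j * ?E)"
      proof (intro mult_right_mono mult_mono divide_right_mono)
        show "(\<phi> 0)\<^sup>2 \<le> 1"
          using std_normal_density_0_le by (simp add: power_le_one)
        show "(hermite k 0)\<^sup>2 \<le> fact j"
          by (rule order_trans[OF hermite_zero_square_le[of k] fact_mono]) (simp add: 3)
      qed auto
      also have "\<dots> = ?E" by (simp add: power2_eq_square)
      finally show ?thesis .
    qed
  qed
  have eq: "hermite_series \<beta> s M (w + s * z) = (\<Sum>j<M + 2. f j z)" for z
  proof -
    have "(\<Sum>j<M + 2. f j z) = f 0 z + (f 1 z + (\<Sum>k<M. f (k + 2) z))"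
      by (simp add: sum.lessThan_Suc_shift del: sum.lessThan_Suc)
    moreover have "f (k + 2) z = \<phi> 0 *
        ((-1) ^ k * hermite k 0 / fact (k + 2) * s ^ (k + 2) * hermite (k + 2) ((w + s * z) / s))" for k
    proof -
      have "f (k + 2) z = c k * H (k + 2) z" by (simp add: f_def)
      then show ?thesis by (simp only: c_def H_def mult.assoc)
    qed
    moreover have "f 0 z = G 0 \<beta>" "f 1 z = (1/2 - \<beta>) * (w + s * z)" by (simp_all add: f_def)
    ultimately show ?thesis
      by (simp only: hermite_series_def sum_distrib_left add.assoc)
  qed
  have "(\<integral>z. (hermite_series \<beta> s M (w + s * z))\<^sup>2 \<partial>\<N>)
      \<le> (\<integral>z. (\<Sum>j<M + 2. (f j z)\<^sup>2) * (real M + 2) \<partial>\<N>)"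
  proof (rule integral_mono[OF integrable_hermite_series(2)])
    show "integrable \<N> (\<lambda>z. (\<Sum>j<M + 2. (f j z)\<^sup>2) * (real M + 2))"
      by (intro integrable_mult_left Bochner_Integration.integrable_sum int)
    show "(hermite_series \<beta> s M (w + s * z))\<^sup>2 \<le> (\<Sum>j<M + 2. (f j z)\<^sup>2) * (real M + 2)" for z
      unfolding eq using sum_squared_le_sum_of_squares[of "\<lambda>j. f j z" "{..<M + 2}"] by (simp add: add.commute)
  qed
  also have "\<dots> = (\<Sum>j<M + 2. \<integral>z. (f j z)\<^sup>2 \<partial>\<N>) * (real M + 2)"
    using int by (simp del: sum.lessThan_Suc)
  also have "\<dots> \<le> (\<Sum>j<M + 2. ?E) * (real M + 2)"
    by (intro mult_right_mono sum_mono f2) auto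
  also have "\<dots> = (real M + 2)\<^sup>2 * ?E"
    by (simp add: power2_eq_square algebra_simps)
  finally show ?thesis .
qed

section \<open>The Taylor remainder of \<open>G\<close> at 0\<close>

lemma hermite_zero_even: "hermite (2 * j) 0 = (-1) ^ j * fact (2 * j) / (2 ^ j * fact j)"
  and hermite_zero_odd: "hermite (2 * j + 1) 0 = 0"
proof -
  show "hermite (2 * j) 0 = (-1) ^ j * fact (2 * j) / (2 ^ j * fact j)"
    proof (induction j)
    case (Suc j)
    have h: "hermite (2 * Suc j) 0 = - (2 * real j + 1) * hermite (2 * j) 0" by (simp add: algebra_simps)
    have f: "fact (2 * Suc j) = (2 * real (Suc j)) * (2 * real j + 1) * fact (2 * j)" by simp
    have g: "2 ^ Suc j * fact (Suc j) = (2 * real (Suc j)) * (2 ^ j * fact j)" by simp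
    show ?case unfolding h f g Suc by (simp del: of_nat_Suc) (simp add: field_simps)
  qed simp
  show "hermite (2 * j + 1) 0 = 0"
    by (induction j) simp_all
qed

text \<open>Only even indices contribute, and they form a partial sum of the exponential series of -
  w^2 / 2. So the error of the series for \<phi> is an exponential remainder.\<close>

lemma hermite_zero_sum:
  "(\<Sum>k<M. (-1) ^ k * hermite k 0 / fact k * w ^ k) = (\<Sum>j<(M + 1) div 2. (- w\<^sup>2 / 2) ^ j / fact j)"
proof (induction M)
  case (Suc M)
  show ?case
  proof (cases "even M")
    case True
    then obtain j where j: "M = 2 * j" by (auto elim: evenE)
    have "(-1) ^ M * hermite M 0 / fact M * w ^ M = (- w\<^sup>2 / 2) ^ j / fact j"
    proof -
      have "(- w\<^sup>2 / 2) ^ j = (-1) ^ j * (w\<^sup>2) ^ j / 2 ^ j"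
        by (metis mult_minus1 power_divide power_mult_distrib)
      then show ?thesis
        unfolding j hermite_zero_even by (simp add: power_mult[symmetric])
    qed
    then show ?thesis using Suc by (simp add: j)
  next
    case False
    then obtain j where j: "M = 2 * j + 1" by (auto elim: oddE)
    then show ?thesis using Suc hermite_zero_odd[of j] by (simp del: hermite.simps)
  qed
qed simp

text \<open>Lagrange's remainder: the intermediate point is negative, so the exponential there is at
  most 1 and the bound does not grow like exp y.\<close>

lemma exp_minus_taylor_remainder:
  assumes "(y::real) \<ge> 0"
  shows "\<bar>exp (- y) - (\<Sum>j<m. (- y) ^ j / fact j)\<bar> \<le> y ^ m / fact m"
proof (cases "y = 0 \<or> m = 0")
  case True
  then show ?thesis using assms by (cases m) (auto simp: lessThan_Suc_eq_insert_0 sum.reindex)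
next
  case False
  then have "- y < 0" "m > 0" using assms by auto
  then have "\<exists>t. - y < t \<and> t < 0 \<and>
      exp (- y) = (\<Sum>j<m. exp 0 / fact j * (- y) ^ j) + exp t / fact m * (- y) ^ m"
    by (intro Maclaurin_minus) (auto intro!: derivative_eq_intros)
  then obtain t where t: "t < 0"
    "exp (- y) = (\<Sum>j<m. exp 0 / fact j * (- y) ^ j) + exp t / fact m * (- y) ^ m" by blast
  then have "\<bar>exp (- y) - (\<Sum>j<m. (- y) ^ j / fact j)\<bar> = exp t * (y ^ m / fact m)"
    using assms by (simp add: abs_mult power_abs)
  also have "\<dots> \<le> 1 * (y ^ m / fact m)"
    using t assms by (intro mult_right_mono) auto
  finally show ?thesis by simp
qed

lemma Phi_0: "Phi 0 = 1/2"
  using Phi_uminus[of 0] by simp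

lemma DERIV_divided_power_sum:
  fixes e :: "nat \<Rightarrow> real"
  shows "((\<lambda>t. \<Sum>k<M. e k / fact (k + Suc j) * t ^ (k + Suc j)) has_real_derivative
    (\<Sum>k<M. e k / fact (k + j) * t ^ (k + j))) (at t)"
proof (rule DERIV_sum)
  fix k
  have "((\<lambda>t. e k / fact (k + Suc j) * t ^ (k + Suc j)) has_real_derivative
      e k / fact (k + Suc j) * (real (k + Suc j) * t ^ (k + Suc j - 1))) (at t)"
    by (intro DERIV_cmult) (use DERIV_pow[of "k + Suc j" t] in simp)
  then show "((\<lambda>t. e k / fact (k + Suc j) * t ^ (k + Suc j)) has_real_derivative
      e k / fact (k + j) * t ^ (k + j)) (at t)"
    by (rule DERIV_cong) (simp del: of_nat_Suc of_nat_add)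
qed

text \<open>No higher derivative of \<open>G\<close> is estimated. The difference of
  \<open>G\<close> and its polynomial vanishes at 0 together with its first derivative, and its
  second derivative is \<open>\<phi> 0\<close> times a remainder of the series of exp (- t^2 / 2).
  An expansion of order two then costs only the additional factor w^2 / 2.\<close>

lemma G_taylor_remainder:
  "\<bar>G w \<beta> - G_taylor \<beta> M w\<bar> \<le> (w\<^sup>2 / 2) ^ ((M + 1) div 2) / fact ((M + 1) div 2) * (w\<^sup>2 / 2)"
proof -
  let ?m = "(M + 1) div 2"
  let ?e = "\<lambda>k. (-1) ^ k * hermite k 0"
  let ?p0 = "\<phi> 0"
  \<comment> \<open>The difference and its first two derivatives, as one family in the form that
    Maclaurin's theorem of order 2 expects.\<close>
  define df where "df n t = (if n = 0 then G t \<beta> - G_taylor \<beta> M t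
      else if n = 1 then Phi t - 1/2 - ?p0 * (\<Sum>k<M. ?e k / fact (k + 1) * t ^ (k + 1))
      else \<phi> t - ?p0 * (\<Sum>k<M. ?e k / fact k * t ^ k))" for n :: nat and t
  have D0: "(df 0 has_real_derivative df 1 t) (at t)" for t
  proof -
    have "((\<lambda>t. \<Sum>k<M. ?e k / fact (k + 2) * t ^ (k + 2)) has_real_derivative
        (\<Sum>k<M. ?e k / fact (k + 1) * t ^ (k + 1))) (at t)"
      using DERIV_divided_power_sum[of ?e 1 M t] by (simp only: numeral_2_eq_2 One_nat_def)
    then have "((\<lambda>t. G t \<beta> - (G 0 \<beta> + (1/2 - \<beta>) * t + ?p0 * (\<Sum>k<M. ?e k / fact (k + 2) * t ^ (k + 2))))
       has_real_derivative (Phi t - \<beta>) - (0 + (1/2 - \<beta>) * 1 + ?p0 * (\<Sum>k<M. ?e k / fact (k + 1) * t ^ (k + 1)))) (at t)"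
      by (intro DERIV_diff DERIV_add DERIV_const DERIV_cmult G_has_derivative DERIV_ident)
    then show ?thesis by (simp add: df_def[abs_def] G_taylor_def algebra_simps)
  qed
  have D1: "(df 1 has_real_derivative df 2 t) (at t)" for t
  proof -
    have "((\<lambda>t. \<Sum>k<M. ?e k / fact (k + 1) * t ^ (k + 1)) has_real_derivative
        (\<Sum>k<M. ?e k / fact k * t ^ k)) (at t)"
      using DERIV_divided_power_sum[of ?e 0 M t] by (simp only: One_nat_def add_0_right)
    then have "((\<lambda>t. Phi t - 1/2 - ?p0 * (\<Sum>k<M. ?e k / fact (k + 1) * t ^ (k + 1)))
       has_real_derivative \<phi> t - 0 - ?p0 * (\<Sum>k<M. ?e k / fact k * t ^ k)) (at t)"
      by (intro DERIV_diff DERIV_const DERIV_cmult Phi_has_derivative)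
    then show ?thesis by (simp add: df_def[abs_def])
  qed
  have "\<exists>t. \<bar>t\<bar> \<le> \<bar>w\<bar> \<and> df 0 w = (\<Sum>m<2. df m 0 / fact m * w ^ m) + df 2 t / fact 2 * w ^ 2"
    by (rule Maclaurin_bi_le) (use D0 D1 in \<open>auto simp: numeral_2_eq_2 less_Suc_eq\<close>)
  then obtain t where t: "\<bar>t\<bar> \<le> \<bar>w\<bar>" "df 0 w = df 2 t / 2 * w\<^sup>2"
    by (auto simp: numeral_2_eq_2 df_def G_taylor_def Phi_0)
  have "df 2 t = ?p0 * (exp (- (t\<^sup>2 / 2)) - (\<Sum>j<?m. (- (t\<^sup>2 / 2)) ^ j / fact j))"
    using hermite_zero_sum[of t M] by (simp add: df_def std_normal_density_def right_diff_distrib)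
  then have "\<bar>df 2 t\<bar> \<le> 1 * ((t\<^sup>2 / 2) ^ ?m / fact ?m)"
    using exp_minus_taylor_remainder[of "t\<^sup>2 / 2" ?m] std_normal_density_0_le
    by (simp only: abs_mult) (intro mult_mono, auto)
  also have "\<dots> \<le> (w\<^sup>2 / 2) ^ ?m / fact ?m"
    using t by (simp add: divide_right_mono power_mono abs_le_square_iff)
  finally have "\<bar>df 2 t\<bar> * (w\<^sup>2 / 2) \<le> (w\<^sup>2 / 2) ^ ?m / fact ?m * (w\<^sup>2 / 2)"
    by (rule mult_right_mono) simp
  moreover have "\<bar>df 0 w\<bar> = \<bar>df 2 t\<bar> * (w\<^sup>2 / 2)"
    unfolding t(2) by (simp add: abs_mult)
  moreover have "df 0 w = G w \<beta> - G_taylor \<beta> M w" by (simp add: df_def)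
  ultimately show ?thesis by simp
qed

section \<open>The clipped Hermite estimate of one summand\<close>

lemma std_normal2_product:
  fixes f g :: "real \<Rightarrow> real"
  assumes f: "integrable \<N> f" and g: "integrable \<N> g"
  shows "integrable std_normal2 (\<lambda>p. f (fst p) * g (snd p))"
    and "(\<integral>p. f (fst p) * g (snd p) \<partial>std_normal2)
       = (\<integral>z. f z \<partial>\<N>) * (\<integral>z. g z \<partial>\<N>)" (is ?g1)
proof -
  have [measurable]: "f \<in> borel_measurable borel" "g \<in> borel_measurable borel"
    using borel_measurable_integrable[OF f] borel_measurable_integrable[OF g] by simp_all
  show int: "integrable std_normal2 (\<lambda>p. f (fst p) * g (snd p))"
  proof (rule std_normal2.Fubini_integrable)
    show "integrable \<N>
        (\<lambda>x. \<integral>y. norm (f (fst (x, y)) * g (snd (x, y))) \<partial>\<N>)"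
      using f by (simp add: abs_mult)
    show "AE x in std_normal_distribution. integrable \<N> (\<lambda>y. f (fst (x, y)) * g (snd (x, y)))"
      using g by simp
  qed measurable
  have "(\<integral>p. f (fst p) * g (snd p) \<partial>std_normal2)
      = (\<integral>x. \<integral>y. f x * g y \<partial>\<N> \<partial>\<N>)"
    using std_normal2.integral_fst'[OF int] by simp
  then show ?g1
    by simp
qed

text \<open>The bound uses an upper bound \<open>\<rho>\<close> of s, since s varies with the grid
  point. Later \<open>\<rho>\<close> is 1 where a crude tail is enough, and the sharp value where
  the exponent matters.\<close>

lemma std_normal_scaled_tail:
  assumes "0 < s" "s \<le> \<rho>" "0 \<le> t"
  shows "measure \<N> {z. t \<le> s * z} \<le> exp (- (t / \<rho>)\<^sup>2 / 2)" (is ?g1)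
    and "measure \<N> {z. s * z \<le> - t} \<le> exp (- (t / \<rho>)\<^sup>2 / 2)" (is ?g2)
proof -
  have "measure \<N> {z. t \<le> s * z} = measure \<N> {z. t / s \<le> z}"
    using assms by (simp add: field_simps)
  also have "\<dots> \<le> exp (- (t / s)\<^sup>2 / 2)"
    using assms by (intro std_normal_tail) simp
  also have "\<dots> \<le> exp (- (t / \<rho>)\<^sup>2 / 2)"
  proof -
    have "t / \<rho> \<le> t / s" using assms by (intro divide_left_mono) auto
    then have "(t / \<rho>)\<^sup>2 \<le> (t / s)\<^sup>2" using assms by (intro power_mono) auto
    then show ?thesis by simp
  qed
  finally show *: ?g1 .
  have "measure \<N> {z. s * z \<le> - t}
      = measure \<N> {z. - z \<in> {z. t \<le> s * z}}"
    by (auto intro!: arg_cong[where f="measure _"])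
  also have "\<dots> = measure \<N> {z. t \<le> s * z}"
    by (rule std_normal_prob_uminus) simp
  finally show ?g2
    using * by simp
qed

lemma mult_exp_neg_square_le: "(y::real) * exp (- y\<^sup>2 / 2) \<le> 1" and square_exp_neg_square_le: "y\<^sup>2 * exp (- y\<^sup>2 / 2) \<le> 2"
proof -
  have 1: "1 + y\<^sup>2 / 2 \<le> exp (y\<^sup>2 / 2)" by (rule exp_ge_add_one_self)
  have 2: "y \<le> 1 + y\<^sup>2 / 2" using sum_squares_ge_zero[of "y - 1" 0] by (simp add: power2_eq_square algebra_simps)
  have e: "exp (- y\<^sup>2 / 2) = inverse (exp (y\<^sup>2 / 2))" by (simp add: exp_minus)
  show "y * exp (- y\<^sup>2 / 2) \<le> 1" using 1 2 unfolding e by (simp add: field_simps)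
  show "y\<^sup>2 * exp (- y\<^sup>2 / 2) \<le> 2" using 1 unfolding e by (simp add: field_simps)
qed

definition clip :: "real \<Rightarrow> real \<Rightarrow> real" where
  "clip c x = sgn x * min \<bar>x\<bar> c"

text \<open>The last bound is the important one: clipping changes x only where \<bar>x\<bar> > c,
  and there \<bar>x\<bar> \<le> x^2 / c. A second moment thus controls the bias caused by
  clipping.\<close>

lemma clip_bounds:
  assumes "c > 0"
  shows "\<bar>clip c x\<bar> \<le> c" "(clip c x)\<^sup>2 \<le> x\<^sup>2" "(clip c x)\<^sup>2 \<le> c\<^sup>2" "\<bar>clip c x - x\<bar> \<le> x\<^sup>2 / c" (is ?g1)
proof -
  show c: "\<bar>clip c x\<bar> \<le> c" using assms by (auto simp: clip_def abs_mult abs_sgn_eq)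
  show "(clip c x)\<^sup>2 \<le> x\<^sup>2" unfolding abs_le_square_iff[symmetric]
    using assms by (auto simp: clip_def abs_mult abs_sgn_eq)
  show "(clip c x)\<^sup>2 \<le> c\<^sup>2" unfolding abs_le_square_iff[symmetric] using c assms by simp
  show ?g1
  proof (cases "\<bar>x\<bar> \<le> c")
    case True
    then have "clip c x = x" by (simp add: clip_def min_def sgn_mult_abs)
    then show ?thesis using assms by simp
  next
    case False
    then have "\<bar>clip c x - x\<bar> \<le> \<bar>x\<bar>" using assms by (auto simp: clip_def sgn_if min_def)
    also have "\<bar>x\<bar> * c \<le> \<bar>x\<bar> * \<bar>x\<bar>" using False assms by (intro mult_left_mono) auto
    then have "\<bar>x\<bar> \<le> x\<^sup>2 / c" using assms by (simp add: field_simps power2_eq_square)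
    finally show ?thesis .
  qed
qed

lemma borel_measurable_clip [measurable]: "clip c \<in> borel_measurable borel"
proof -
  have "clip c = (\<lambda>x. if x > 0 then min \<bar>x\<bar> c else if x < 0 then - min \<bar>x\<bar> c else 0)"
    by (auto simp: clip_def fun_eq_iff sgn_if)
  then show ?thesis by simp
qed

text \<open>The randomised estimate \<open>T_rand\<close> as a function of its two linear forms U
  and V, which can then be replaced by independent normal variables.\<close>

definition T_fun :: "real \<Rightarrow> real \<Rightarrow> (real \<Rightarrow> real) \<Rightarrow> real \<Rightarrow> real \<Rightarrow> real" where
  "T_fun \<beta> l S u v = (if v < - l then - \<beta> * u else if \<bar>v\<bar> \<le> l then S u else (1 - \<beta>) * u)"

text \<open>In the first factor, 4 accounts for selecting the wrong asymptote on either side and L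
  for the Taylor error. In the second, the square accounts for the clipping and 3 for using the
  series at a mean beyond \<open>Lam\<close>.\<close>

definition bias_bound :: "real \<Rightarrow> real \<Rightarrow> real" where
  "bias_bound \<gamma>0 L = (4 + L) * exp (- (\<gamma>0\<^sup>2 * L / 4)) + (3 + (3 + 3 * L)\<^sup>2) * exp (- (L / 6))"

text \<open>The constant 10 collects the noise of U and the two wrong asymptotes. The other terms
  are twice the bound of \<open>p0_square\<close>, with exp (L / 2) enlarged to exp (5/6 *
  L).\<close>

definition msq_bound :: "real \<Rightarrow> real" where
  "msq_bound L = 10 + 2 * L + (2 * (3 + 3 * L)\<^sup>2 + 14) * exp (5/6 * L)"

text \<open>The argument \<open>L\<close> stands for \<open>ln n\<close>, so that \<open>exp L\<close> is the clipping level \<open>n\<close>.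
  The factor \<open>exp (1/4)\<close> in \<open>Lam\<close> leaves room on both sides: below \<open>Lam\<close> the Taylor polynomial
  of degree \<open>M + 1\<close> is still accurate, and above \<open>Lam\<close> the event \<open>\<bar>V\<bar> \<le> lam\<close> has probability
  \<open>o(1/n)\<close>, which beats the clipping level.\<close>

locale clipped_hermite =
  fixes \<beta> s \<rho> \<gamma> \<gamma>0 L :: real
  assumes \<beta>: "0 < \<beta>" "\<beta> < 1" and s: "0 < s" "s \<le> \<rho>" and \<gamma>: "0 < \<gamma>0" "\<gamma>0 \<le> \<gamma>"
    and q: "(\<gamma> + \<rho>)\<^sup>2 \<le> 1 / (2 * exp 1)" and L: "L \<ge> 1"
begin

definition lam where "lam = \<gamma> * sqrt (2 * L)"
definition M where "M = nat \<lceil>(exp 1)\<^sup>2 * (\<gamma> + \<rho>)\<^sup>2 * (2 * L)\<rceil>"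
definition S where "S u = clip (exp L) (hermite_series \<beta> s M u)"
definition Lam where "Lam = exp (1/4) * (\<gamma> + \<rho>) * sqrt (2 * L)"

section \<open>Numerical bounds, and the error of the clipped series below
  \<open>Lam\<close>\<close>

lemma exp_half: "exp (1/2) \<ge> (13/8 :: real)"
  using exp_lower_Taylor_quadratic[of "1/2"] by (simp add: power2_eq_square)

lemma exp1: "exp 1 \<ge> (5/2 :: real)"
  using exp_lower_Taylor_quadratic[of 1] by simp

lemma exp_half_square: "exp 1 = (exp (1/2) :: real) * exp (1/2)"
  by (simp add: mult_exp_exp)

lemma q': "(\<gamma> + \<rho>)\<^sup>2 \<le> 1/5"
proof -
  have "1 / (2 * exp 1) \<le> (1/5 :: real)" using exp1 by (simp add: field_simps)
  with q show ?thesis by linarith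
qed

lemma \<rho>_pos: "\<rho> > 0" using s by simp

lemma \<rho>_bounds: "\<rho>\<^sup>2 \<le> 1/5" "\<rho> \<le> 1"
proof -
  have "\<rho>\<^sup>2 \<le> (\<gamma> + \<rho>)\<^sup>2" using \<gamma> \<rho>_pos by (intro power_mono) auto
  then show *: "\<rho>\<^sup>2 \<le> 1/5" using q' by linarith
  then have "\<rho>\<^sup>2 \<le> 1\<^sup>2" by simp
  then show "\<rho> \<le> 1" by (rule power2_le_imp_le) simp
qed

lemma s_bounds: "s\<^sup>2 \<le> 1/5" "s < 1"
proof -
  have "s\<^sup>2 \<le> \<rho>\<^sup>2" using s by (intro power_mono) auto
  then show *: "s\<^sup>2 \<le> 1/5" using \<rho>_bounds by linarith
  then have "s\<^sup>2 < 1\<^sup>2" by simp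
  then show "s < 1" by (rule power2_less_imp_less) simp
qed

lemma Lam_square: "Lam\<^sup>2 = exp (1/2) * (\<gamma> + \<rho>)\<^sup>2 * (2 * L)"
  using L by (simp add: Lam_def power_mult_distrib exp_double[symmetric])

text \<open>The true coefficient is exp (-1/2), slightly below 2/3. After division by 1 - s^2 \<ge>
  4/5 it becomes the exponent 5/6 of the second moment in \<open>series_square_mean\<close>.\<close>

lemma Lam_square_le: "Lam\<^sup>2 \<le> 2/3 * L"
proof -
  have "exp (1/2) * (\<gamma> + \<rho>)\<^sup>2 \<le> exp (1/2) * (1 / (2 * exp 1))"
    using q by (intro mult_left_mono) auto
  also have "\<dots> = 1 / (2 * exp (1/2))" by (simp add: exp_half_square)
  also have "\<dots> \<le> 1/3" using exp_half by (simp add: field_simps)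
  finally have "exp (1/2) * (\<gamma> + \<rho>)\<^sup>2 * (2 * L) \<le> 1/3 * (2 * L)"
    using L by (intro mult_right_mono) auto
  then show ?thesis by (simp add: Lam_square)
qed

lemma Lam_nonneg: "Lam \<ge> 0" using \<gamma> \<rho>_pos L by (simp add: Lam_def)

lemma Lam_le: "Lam \<le> L"
proof -
  have "Lam\<^sup>2 \<le> L * 1" using Lam_square_le L by simp
  also have "\<dots> \<le> L\<^sup>2" using L unfolding power2_eq_square by (intro mult_left_mono) auto
  finally show ?thesis by (rule power2_le_imp_le) (use L in simp)
qed

lemma lam_nonneg: "lam \<ge> 0" using \<gamma> L by (simp add: lam_def)

lemma lam_square: "lam\<^sup>2 \<ge> 2 * \<gamma>0\<^sup>2 * L"
proof -
  have "\<gamma>0\<^sup>2 \<le> \<gamma>\<^sup>2" using \<gamma> by (intro power_mono) auto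
  then have "\<gamma>0\<^sup>2 * (2 * L) \<le> \<gamma>\<^sup>2 * (2 * L)" using L by (intro mult_right_mono) auto
  then show ?thesis using L by (simp add: lam_def power_mult_distrib)
qed

lemma M_lower: "exp 1 * exp 1 * (\<gamma> + \<rho>)\<^sup>2 * (2 * L) \<le> real M"
  unfolding M_def power2_eq_square by (rule of_nat_ceiling)

lemma M_upper: "real M + 2 \<le> 3 + 3 * L"
proof -
  have nn: "0 \<le> (exp 1)\<^sup>2 * (\<gamma> + \<rho>)\<^sup>2 * (2 * L)" using L by simp
  have "(exp 1)\<^sup>2 * (\<gamma> + \<rho>)\<^sup>2 \<le> (exp 1)\<^sup>2 * (1 / (2 * exp 1))"
    using q by (intro mult_left_mono) auto
  also have "\<dots> = exp 1 / 2" by (simp add: power2_eq_square)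
  finally have "(exp 1)\<^sup>2 * (\<gamma> + \<rho>)\<^sup>2 * (2 * L) \<le> exp 1 / 2 * (2 * L)"
    using L by (intro mult_right_mono) auto
  also have "\<dots> \<le> 3 * L" using exp_le L by (simp add: mult_right_mono)
  finally show ?thesis unfolding M_def using nn by linarith
qed

lemma S_measurable [measurable]: "S \<in> borel_measurable borel"
  unfolding S_def by measurable

lemma S_bound: "\<bar>S u\<bar> \<le> exp L"
  unfolding S_def by (rule clip_bounds) simp

lemma integrable_S:
  "integrable \<N> (\<lambda>z. S (w + s * z))"
  "integrable \<N> (\<lambda>z. (S (w + s * z))\<^sup>2)"
proof -
  show "integrable \<N> (\<lambda>z. S (w + s * z))"
    by (rule std_normal.integrable_const_bound[of _ "exp L"]) (auto simp: S_bound)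
  have "(S u)\<^sup>2 \<le> (exp L)\<^sup>2" for u using S_bound[of u] by (simp add: abs_le_square_iff[symmetric])
  then show "integrable \<N> (\<lambda>z. (S (w + s * z))\<^sup>2)"
    by (intro std_normal.integrable_const_bound[of _ "(exp L)\<^sup>2"]) auto
qed

lemma S_square_mean_le: "(\<integral>z. (S (w + s * z))\<^sup>2 \<partial>\<N>) \<le> (exp L)\<^sup>2"
proof -
  have "(\<integral>z. (S (w + s * z))\<^sup>2 \<partial>\<N>) \<le> (\<integral>z. (exp L)\<^sup>2 \<partial>\<N>)"
    using S_bound by (intro integral_mono integrable_S) (auto simp: abs_le_square_iff[symmetric])
  then show ?thesis using std_normal.prob_space by simp
qed

lemma series_square_mean:
  assumes "\<bar>w\<bar> \<le> Lam"
  shows "(\<integral>z. (hermite_series \<beta> s M (w + s * z))\<^sup>2 \<partial>\<N>) \<le> (3 + 3 * L)\<^sup>2 * exp (5/6 * L)"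
proof -
  have "w\<^sup>2 \<le> Lam\<^sup>2" using assms Lam_nonneg by (simp add: abs_le_square_iff[symmetric])
  then have w: "w\<^sup>2 \<le> 2/3 * L" using Lam_square_le by linarith
  have "w\<^sup>2 / (1 - s\<^sup>2) \<le> (2/3 * L) / (4/5)"
    using w s_bounds L by (intro frac_le) auto
  then have "w\<^sup>2 / (1 - s\<^sup>2) \<le> 5/6 * L" by simp
  moreover have "(real M + 2)\<^sup>2 \<le> (3 + 3 * L)\<^sup>2" using M_upper by (intro power_mono) auto
  ultimately have "(real M + 2)\<^sup>2 * exp (w\<^sup>2 / (1 - s\<^sup>2)) \<le> (3 + 3 * L)\<^sup>2 * exp (5/6 * L)"
    by (intro mult_mono) auto
  then show ?thesis
    using hermite_series_square_mean[OF s(1) s_bounds(2), of \<beta> M w] \<beta> by simp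
qed

text \<open>With x = w^2 / 2 and m about M / 2, the choice of M as exp 1 squared times (\<gamma> +
  \<rho>)^2 * 2 * L gives x \<le> exp (-3/2) * m. Since m^m / fact m \<le> exp m, the remainder x^m
  / fact m is at most exp (- m / 2), and m is at least \<open>\<gamma>0\<^sup>2 * L\<close>. The
  exponent is weakened to the one that \<open>pm_gplus\<close> provides.\<close>

lemma taylor_error:
  assumes "\<bar>w\<bar> \<le> Lam"
  shows "\<bar>G w \<beta> - G_taylor \<beta> M w\<bar> \<le> L * exp (- (\<gamma>0\<^sup>2 * L / 4))"
proof -
  define m where "m = (M + 1) div 2"
  define x where "x = w\<^sup>2 / 2"
  have m: "real m \<ge> real M / 2" unfolding m_def by linarith
  have w: "w\<^sup>2 \<le> Lam\<^sup>2" using assms Lam_nonneg by (simp add: abs_le_square_iff[symmetric])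
  have xL: "x \<le> L" using w Lam_square_le L by (simp add: x_def)
  have x0: "x \<ge> 0" by (simp add: x_def)
  let ?Q = "(\<gamma> + \<rho>)\<^sup>2 * L"
  have mQ: "exp 1 * exp 1 * ?Q \<le> real m" using M_lower m by linarith
  have "x \<le> exp (1/2) * ?Q" using w by (simp add: x_def Lam_square)
  also have "exp (1/2) * ?Q = exp (- (3/2)) * (exp 1 * exp 1 * ?Q)"
    by (simp add: mult.assoc[symmetric] mult_exp_exp)
  also have "\<dots> \<le> exp (- (3/2)) * real m"
    using mQ by (intro mult_left_mono) auto
  finally have xm: "x \<le> exp (- (3/2)) * real m" .
  have "x ^ m / fact m \<le> (exp (- (3/2)) * real m) ^ m / fact m"
    using xm x0 by (intro divide_right_mono power_mono) auto
  also have "\<dots> = exp (- (3/2)) ^ m * (real m ^ m / fact m)"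
    by (simp add: power_mult_distrib)
  also have "\<dots> \<le> exp (- (3/2)) ^ m * exp (real m)"
    by (intro mult_left_mono power_div_fact_le_exp) auto
  also have "\<dots> = exp (- (real m / 2))"
    by (simp add: exp_of_nat_mult[symmetric] mult_exp_exp)
  also have "\<dots> \<le> exp (- (\<gamma>0\<^sup>2 * L / 4))"
  proof -
    have "\<gamma>0\<^sup>2 * L \<le> ?Q" using \<gamma> \<rho>_pos L by (intro mult_right_mono power_mono) auto
    also have "1 * ?Q \<le> (exp 1 * exp 1) * ?Q"
    proof (intro mult_right_mono)
      show "1 \<le> exp 1 * (exp 1 :: real)" using exp1 by (simp add: mult_exp_exp)
    qed (use L in auto)
    finally have "\<gamma>0\<^sup>2 * L \<le> real m" using mQ by simp
    moreover have "0 \<le> \<gamma>0\<^sup>2 * L" using L by simp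
    ultimately show ?thesis unfolding exp_le_cancel_iff by linarith
  qed
  finally have "x ^ m / fact m * x \<le> exp (- (\<gamma>0\<^sup>2 * L / 4)) * L"
    using xL x0 by (intro mult_mono) auto
  then show ?thesis
    using G_taylor_remainder[of w \<beta> M] by (simp add: m_def x_def mult.commute)
qed

text \<open>The unclipped series has mean exactly \<open>G_taylor\<close>, so the error splits into
  the Taylor error and the clipping error. The latter is at most the second moment of the series
  over exp L, with exponent 5/6 - 1 = -1/6.\<close>

lemma S_mean_error:
  assumes "\<bar>w\<bar> \<le> Lam"
  shows "\<bar>(\<integral>z. S (w + s * z) \<partial>\<N>) - G w \<beta>\<bar>
       \<le> L * exp (- (\<gamma>0\<^sup>2 * L / 4)) + (3 + 3 * L)\<^sup>2 * exp (- (L / 6))"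
proof -
  let ?h = "\<lambda>z. hermite_series \<beta> s M (w + s * z)"
  have "\<bar>(\<integral>z. S (w + s * z) \<partial>\<N>) - (\<integral>z. ?h z \<partial>\<N>)\<bar>
      = \<bar>\<integral>z. S (w + s * z) - ?h z \<partial>\<N>\<bar>"
    by (simp add: integrable_S integrable_hermite_series)
  also have "\<dots> \<le> (\<integral>z. \<bar>S (w + s * z) - ?h z\<bar> \<partial>\<N>)"
    by (rule integral_abs_bound)
  also have "\<dots> \<le> (\<integral>z. (?h z)\<^sup>2 / exp L \<partial>\<N>)"
    by (intro integral_mono integrable_divide integrable_hermite_series(2) integrable_abs
          Bochner_Integration.integrable_diff integrable_S(1) integrable_hermite_series(1))
       (simp add: S_def clip_bounds)
  also have "\<dots> = (\<integral>z. (?h z)\<^sup>2 \<partial>\<N>) / exp L"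
    by simp
  also have "\<dots> \<le> ((3 + 3 * L)\<^sup>2 * exp (5/6 * L)) / exp L"
    by (intro divide_right_mono series_square_mean assms) simp
  also have "\<dots> = (3 + 3 * L)\<^sup>2 * exp (- (L / 6))"
    by (simp add: exp_minus[of L, unfolded inverse_eq_divide, symmetric] exp_diff[symmetric]
        times_divide_eq_right[symmetric] del: times_divide_eq_right)
  finally show ?thesis
    using taylor_error[OF assms] s by (simp add: hermite_series_mean abs_le_iff)
qed

section \<open>Selection of a branch by \<open>V\<close>, and the bias of the estimate\<close>

definition "pm w = measure \<N> {z. w + s * z < - lam}"
definition "p0 w = measure \<N> {z. \<bar>w + s * z\<bar> \<le> lam}"
definition "pp w = measure \<N> {z. lam < w + s * z}"

lemma p_nonneg: "pm w \<ge> 0" "p0 w \<ge> 0" "pp w \<ge> 0" and p_le_1: "pm w \<le> 1" "p0 w \<le> 1" "pp w \<le> 1"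
  by (simp_all add: pm_def p0_def pp_def)

lemma p_sum: "pm w + p0 w + pp w = 1"
proof -
  have "1 = measure \<N> (({z. w + s * z < - lam} \<union> {z. \<bar>w + s * z\<bar> \<le> lam}) \<union> {z. lam < w + s * z})"
  proof -
    have "({z. w + s * z < - lam} \<union> {z. \<bar>w + s * z\<bar> \<le> lam}) \<union> {z. lam < w + s * z} = UNIV"
      by auto
    then show ?thesis using std_normal.prob_space by simp
  qed
  also have "\<dots> = measure \<N> ({z. w + s * z < - lam} \<union> {z. \<bar>w + s * z\<bar> \<le> lam}) + pp w"
    unfolding pp_def using lam_nonneg by (intro std_normal.finite_measure_Union) auto
  also have "measure \<N> ({z. w + s * z < - lam} \<union> {z. \<bar>w + s * z\<bar> \<le> lam}) = pm w + p0 w"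
    unfolding pm_def p0_def using lam_nonneg by (intro std_normal.finite_measure_Union) auto
  finally show ?thesis by simp
qed

lemma pp_uminus: "pp w = pm (- w)"
proof -
  have "pp w = measure \<N> {z. - z \<in> {z. - w + s * z < - lam}}"
    unfolding pp_def by (auto intro!: arg_cong[where f="measure _"])
  also have "\<dots> = pm (- w)" unfolding pm_def by (rule std_normal_prob_uminus) simp
  finally show ?thesis .
qed

lemma pm_tail: "0 \<le> lam + w \<Longrightarrow> pm w \<le> exp (- (lam + w)\<^sup>2 / 2)"
proof -
  assume *: "0 \<le> lam + w"
  have "pm w \<le> measure \<N> {z. s * z \<le> - (lam + w)}"
    unfolding pm_def by (intro std_normal.finite_measure_mono) auto
  also have "\<dots> \<le> exp (- ((lam + w) / 1)\<^sup>2 / 2)"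
    using s s_bounds * by (intro std_normal_scaled_tail) auto
  finally show ?thesis by simp
qed

text \<open>The factor \<open>gplus w\<close> is the error of the left asymptote,
  \<open>pm w\<close> the probability of choosing it. For w \<le> - lam / 2 the first is small; for
  larger w the second is. For positive w its tail keeps a factor exp (- w^2 / 2), which absorbs the
  linear growth of \<open>gplus\<close>. Either way exp (- lam^2 / 8) remains, and lam^2 \<ge> 2 *
  \<gamma>0^2 * L.\<close>

lemma pm_gplus: "pm w * gplus w \<le> 2 * exp (- (\<gamma>0\<^sup>2 * L / 4))"
proof -
  have l8: "exp (- lam\<^sup>2 / 8) \<le> exp (- (\<gamma>0\<^sup>2 * L / 4))" using lam_square by (simp add: mult_ac)
  show ?thesis
  proof (cases "w \<le> - lam / 2")
    case True
    then have "w \<le> 0" using lam_nonneg by simp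
    have "pm w * gplus w \<le> 1 * gplus w"
      by (intro mult_right_mono p_le_1 gplus_nonneg)
    also have "1 * gplus w \<le> exp (- w\<^sup>2 / 2)"
      using gplus_le_density[OF \<open>w \<le> 0\<close>] std_normal_density_le[of w] by simp
    also have "\<dots> \<le> exp (- lam\<^sup>2 / 8)"
    proof -
      have "(lam / 2)\<^sup>2 \<le> (- w)\<^sup>2" using True lam_nonneg by (intro power_mono) auto
      then show ?thesis by (simp add: power_divide)
    qed
    finally show ?thesis using l8 exp_ge_zero[of "- (\<gamma>0\<^sup>2 * L / 4)"] by linarith
  next
    case False
    then have *: "0 \<le> lam + w" using lam_nonneg by simp
    have "pm w * gplus w \<le> exp (- (lam + w)\<^sup>2 / 2) * (1 + max 0 w)"
      by (intro mult_mono pm_tail * gplus_le gplus_nonneg) auto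
    also have "\<dots> \<le> exp (- lam\<^sup>2 / 8) * 2"
    proof (cases "w \<le> 0")
      case True
      have "(lam / 2)\<^sup>2 \<le> (lam + w)\<^sup>2" using False lam_nonneg by (intro power_mono) auto
      then have "exp (- (lam + w)\<^sup>2 / 2) \<le> exp (- lam\<^sup>2 / 8)" by (simp add: power_divide)
      then show ?thesis using True by (intro mult_mono) auto
    next
      case w: False
      have "(lam + w)\<^sup>2 = lam\<^sup>2 + 2 * lam * w + w\<^sup>2" by (simp add: power2_eq_square algebra_simps)
      moreover have "0 \<le> lam * w" using w lam_nonneg by simp
      moreover have "0 \<le> lam\<^sup>2" by simp
      ultimately have "- (lam + w)\<^sup>2 / 2 \<le> - lam\<^sup>2 / 8 + - w\<^sup>2 / 2" by linarith
      then have "exp (- (lam + w)\<^sup>2 / 2) \<le> exp (- lam\<^sup>2 / 8) * exp (- w\<^sup>2 / 2)"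
        by (simp add: mult_exp_exp)
      then have "exp (- (lam + w)\<^sup>2 / 2) * (1 + max 0 w) \<le> exp (- lam\<^sup>2 / 8) * exp (- w\<^sup>2 / 2) * (1 + w)"
        using w by (intro mult_mono) auto
      also have "\<dots> = exp (- lam\<^sup>2 / 8) * (exp (- w\<^sup>2 / 2) + w * exp (- w\<^sup>2 / 2))"
        by (simp add: algebra_simps)
      also have "\<dots> \<le> exp (- lam\<^sup>2 / 8) * (1 + 1)"
        by (intro mult_left_mono add_mono mult_exp_neg_square_le) auto
      finally show ?thesis by simp
    qed
    finally show ?thesis using l8 by linarith
  qed
qed

text \<open>Beyond \<open>Lam\<close> the mean exceeds the threshold \<open>lam\<close> by at least
  exp (1/4) * \<rho> * sqrt (2 * L). Measured in units of \<rho>, the square of this gap is exp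
  (1/2) * 2 * L \<ge> 3 * L, whence the exponent 3/2. This pays for the clipping level exp L in the
  bias and leaves only exp (L / 2) of its square in the second moment. The excess of \<bar>w\<bar>
  over \<open>Lam\<close> is kept as a separate Gaussian factor, which absorbs terms growing with
  w.\<close>

lemma p0_tail:
  assumes "\<bar>w\<bar> > Lam"
  shows "p0 w \<le> exp (- (3/2 * L)) * exp (- (\<bar>w\<bar> - Lam)\<^sup>2 / 2)"
proof -
  define t where "t = \<bar>w\<bar> - lam"
  define y where "y = \<bar>w\<bar> - Lam"
  have y: "y > 0" using assms by (simp add: y_def)
  have e4: "exp (1/4) \<ge> (1::real)" by simp
  have gap: "Lam - lam \<ge> exp (1/4) * \<rho> * sqrt (2 * L)"
  proof -
    have "1 * (\<gamma> * sqrt (2 * L)) \<le> exp (1/4) * (\<gamma> * sqrt (2 * L))"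
      using \<gamma> L by (intro mult_right_mono) auto
    then show ?thesis by (simp add: Lam_def lam_def algebra_simps)
  qed
  let ?g = "exp (1/4) * \<rho> * sqrt (2 * L)"
  have g0: "?g \<ge> 0" using \<rho>_pos L by simp
  have t: "t \<ge> y + ?g" using gap by (simp add: t_def y_def)
  then have t0: "t \<ge> 0" using y g0 by linarith
  have "(t / \<rho>)\<^sup>2 \<ge> (y / \<rho> + exp (1/4) * sqrt (2 * L))\<^sup>2"
  proof (rule power_mono)
    have "(y + ?g) / \<rho> \<le> t / \<rho>" using t \<rho>_pos by (intro divide_right_mono) auto
    then show "y / \<rho> + exp (1/4) * sqrt (2 * L) \<le> t / \<rho>" using \<rho>_pos by (simp add: add_divide_distrib)
  qed (use y \<rho>_pos L in auto)
  moreover have "(y / \<rho> + exp (1/4) * sqrt (2 * L))\<^sup>2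
      = (y / \<rho>)\<^sup>2 + 2 * (y / \<rho>) * (exp (1/4) * sqrt (2 * L)) + exp (1/2) * (2 * L)"
    using L by (simp add: power2_sum power_mult_distrib exp_double[symmetric])
  moreover have "0 \<le> 2 * (y / \<rho>) * (exp (1/4) * sqrt (2 * L))" using y \<rho>_pos L by simp
  moreover have "(y / \<rho>)\<^sup>2 \<ge> y\<^sup>2"
  proof (rule power_mono)
    show "y \<le> y / \<rho>" using y \<rho>_pos \<rho>_bounds by (simp add: field_simps mult_left_le)
  qed (use y in simp)
  moreover have "exp (1/2) * (2 * L) \<ge> 3/2 * (2 * L)" using exp_half L by (intro mult_right_mono) auto
  ultimately have tr: "(t / \<rho>)\<^sup>2 \<ge> y\<^sup>2 + 3 * L" by linarith
  have "p0 w \<le> exp (- (t / \<rho>)\<^sup>2 / 2)"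
  proof (cases "w \<ge> 0")
    case True
    have "p0 w \<le> measure \<N> {z. s * z \<le> - t}"
      unfolding p0_def t_def using True by (intro std_normal.finite_measure_mono) auto
    also have "\<dots> \<le> exp (- (t / \<rho>)\<^sup>2 / 2)" by (intro std_normal_scaled_tail s t0)
    finally show ?thesis .
  next
    case False
    have "p0 w \<le> measure \<N> {z. t \<le> s * z}"
      unfolding p0_def t_def using False by (intro std_normal.finite_measure_mono) auto
    also have "\<dots> \<le> exp (- (t / \<rho>)\<^sup>2 / 2)" by (intro std_normal_scaled_tail s t0)
    finally show ?thesis .
  qed
  also have "\<dots> \<le> exp (- (3/2 * L) + - y\<^sup>2 / 2)" using tr by simp
  finally show ?thesis by (simp only: y_def exp_add)
qed

text \<open>A sum of products of a function of u and an indicator in v, so that by independence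
  every mean factorises.\<close>

lemma T_fun_indicator:
  "T_fun \<beta> lam S u v = - \<beta> * u * indicator {v. v < - lam} v + S u * indicator {v. \<bar>v\<bar> \<le> lam} v
     + (1 - \<beta>) * u * indicator {v. lam < v} v"
  using lam_nonneg by (auto simp: T_fun_def indicator_def)

lemma integrable_indicator_affine:
  assumes [measurable]: "A \<in> sets borel"
  shows "integrable \<N> (\<lambda>z. indicator A (w + s * z) :: real)"
  by (rule std_normal.integrable_const_bound[of _ 1]) (auto simp: indicator_def)

lemma integral_indicator_affine:
  assumes [measurable]: "A \<in> sets borel"
  shows "(\<integral>z. indicator A (w + s * z) \<partial>\<N>) = measure \<N> {z. w + s * z \<in> A}"
proof -
  have "(\<lambda>z. indicator A (w + s * z) :: real) = indicator {z. w + s * z \<in> A}"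
    by (auto simp: indicator_def fun_eq_iff)
  then show ?thesis by simp
qed

lemma product_indicator:
  assumes f: "integrable \<N> (\<lambda>z. f (w + s * z))" and A: "A \<in> sets borel"
  shows "has_bochner_integral std_normal2 (\<lambda>p. f (w + s * fst p) * indicator A (w + s * snd p))
       ((\<integral>z. f (w + s * z) \<partial>\<N>) * measure \<N> {z. w + s * z \<in> A})"
  using std_normal2_product[OF f integrable_indicator_affine[OF A, of w]] integral_indicator_affine[OF A]
  by (simp add: has_bochner_integral_iff)

lemma integral_affine: "(\<integral>z. a * (w + s * z) \<partial>\<N>) = a * w"
  using std_normal.prob_space by simp

lemma T_mean:
  "has_bochner_integral std_normal2 (\<lambda>p. T_fun \<beta> lam S (w + s * fst p) (w + s * snd p))
     (- \<beta> * w * pm w + (\<integral>z. S (w + s * z) \<partial>\<N>) * p0 w + (1 - \<beta>) * w * pp w)"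
proof -
  have aff: "integrable \<N> (\<lambda>z. a * (w + s * z))" for a by simp
  have sets: "{v. v < - lam} \<in> sets borel" "{v. \<bar>v\<bar> \<le> lam} \<in> sets borel" "{v. lam < v} \<in> sets borel"
    by measurable
  show ?thesis
    using has_bochner_integral_add[OF has_bochner_integral_add[OF
        product_indicator[OF aff[of "- \<beta>"] sets(1)] product_indicator[OF integrable_S(1)[of w] sets(2)]]
        product_indicator[OF aff[of "1 - \<beta>"] sets(3)]]
    unfolding T_fun_indicator integral_affine mem_Collect_eq pm_def p0_def pp_def .
qed

lemma G_abs_le: "\<bar>G w \<beta>\<bar> \<le> 1 + \<bar>w\<bar>"
proof -
  have "\<beta> * \<bar>w\<bar> \<le> 1 * \<bar>w\<bar>" using \<beta> by (intro mult_right_mono) auto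
  moreover have "0 \<le> \<beta> * \<bar>w\<bar>" using \<beta> by simp
  ultimately show ?thesis
    using G_nonneg[of \<beta> w] gplus_le[of w] \<beta>
    unfolding G_gplus by (cases "w \<ge> 0"; simp only: abs_of_nonneg abs_of_neg max_def not_le; linarith)
qed

text \<open>Up to \<open>Lam\<close> the series is accurate. Beyond it, the crude bound 2 * exp L +
  y with y = \<bar>w\<bar> - Lam is beaten by the two factors of \<open>p0_tail\<close>.\<close>

lemma p0_error:
  "p0 w * \<bar>(\<integral>z. S (w + s * z) \<partial>\<N>) - G w \<beta>\<bar>
     \<le> L * exp (- (\<gamma>0\<^sup>2 * L / 4)) + (3 + (3 + 3 * L)\<^sup>2) * exp (- (L / 6))"
    (is "p0 w * \<bar>?S - _\<bar> \<le> ?R")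
proof (cases "\<bar>w\<bar> \<le> Lam")
  case True
  have "p0 w * \<bar>?S - G w \<beta>\<bar> \<le> 1 * (L * exp (- (\<gamma>0\<^sup>2 * L / 4)) + (3 + 3 * L)\<^sup>2 * exp (- (L / 6)))"
    by (intro mult_mono S_mean_error True p_le_1) auto
  also have "\<dots> \<le> ?R" by (simp add: algebra_simps)
  finally show ?thesis .
next
  case False
  define y where "y = \<bar>w\<bar> - Lam"
  have y: "y > 0" "\<bar>w\<bar> = Lam + y" using False by (auto simp: y_def)
  have "\<bar>?S\<bar> \<le> (\<integral>z. \<bar>S (w + s * z)\<bar> \<partial>\<N>)" by (rule integral_abs_bound)
  also have "\<dots> \<le> (\<integral>z. exp L \<partial>\<N>)"
    by (intro integral_mono integrable_abs integrable_S) (auto simp: S_bound)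
  finally have "\<bar>?S\<bar> \<le> exp L" using std_normal.prob_space by simp
  then have b: "\<bar>?S - G w \<beta>\<bar> \<le> 2 * exp L + y"
    using G_abs_le[of w] y Lam_le exp_ge_add_one_self[of L] by linarith
  have "p0 w * \<bar>?S - G w \<beta>\<bar> \<le> (exp (- (3/2 * L)) * exp (- y\<^sup>2 / 2)) * (2 * exp L + y)"
    using p0_tail[of w] False b unfolding y_def[symmetric] by (intro mult_mono) (auto simp: p_nonneg)
  also have "\<dots> = exp (- (3/2 * L)) * (exp (- y\<^sup>2 / 2) * (2 * exp L) + y * exp (- y\<^sup>2 / 2))"
    by (simp add: algebra_simps)
  also have "\<dots> \<le> exp (- (3/2 * L)) * (1 * (2 * exp L) + exp L)"
  proof (intro mult_left_mono add_mono mult_right_mono)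
    show "y * exp (- y\<^sup>2 / 2) \<le> exp L" using mult_exp_neg_square_le[of y] exp_ge_add_one_self[of L] L by linarith
  qed auto
  also have "\<dots> = 3 * exp (- (L / 2))" by (simp add: mult_exp_exp)
  also have "\<dots> \<le> 3 * exp (- (L / 6))" using L by simp
  also have "\<dots> \<le> ?R" using L by (simp add: algebra_simps)
  finally show ?thesis .
qed

lemma T_bias:
  "\<bar>(\<integral>p. T_fun \<beta> lam S (w + s * fst p) (w + s * snd p) \<partial>std_normal2) - G w \<beta>\<bar> \<le> bias_bound \<gamma>0 L"
proof -
  let ?S = "\<integral>z. S (w + s * z) \<partial>\<N>"
  \<comment> \<open>The three probabilities add up to 1, so \<open>G w \<beta>\<close> is
    distributed over the branches and each is compared with its own target. The right branch is the
    left one reflected at 0.\<close>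
  have eq: "(\<integral>p. T_fun \<beta> lam S (w + s * fst p) (w + s * snd p) \<partial>std_normal2) - G w \<beta>
      = p0 w * (?S - G w \<beta>) - pm w * gplus w - pp w * gplus (- w)"
  proof -
    have "G w \<beta> = pm w * G w \<beta> + p0 w * G w \<beta> + pp w * G w \<beta>"
      using p_sum[of w] by (metis distrib_right mult_1)
    then show ?thesis
      unfolding has_bochner_integral_integral_eq[OF T_mean] gplus_uminus by (simp add: G_gplus algebra_simps)
  qed
  have "\<bar>p0 w * (?S - G w \<beta>) - pm w * gplus w - pp w * gplus (- w)\<bar> \<le> p0 w * \<bar>?S - G w \<beta>\<bar> + pm w * gplus w + pm (- w) * gplus (- w)"
  proof -
    have "\<bar>p0 w * (?S - G w \<beta>)\<bar> = p0 w * \<bar>?S - G w \<beta>\<bar>" by (simp add: abs_mult p_nonneg)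
    moreover have "0 \<le> pm w * gplus w" "0 \<le> pm (- w) * gplus (- w)" by (simp_all add: p_nonneg gplus_nonneg)
    ultimately show ?thesis unfolding pp_uminus by linarith
  qed
  also have "\<dots> \<le> bias_bound \<gamma>0 L"
  proof -
    have "A + B + C \<le> (4 + L) * E + F" if "A \<le> L * E + F" "B \<le> 2 * E" "C \<le> 2 * E" for A B C E F :: real
      using that by (simp add: algebra_simps)
    from this[OF p0_error[of w] pm_gplus[of w] pm_gplus[of "- w"]]
    show ?thesis unfolding bias_bound_def by simp
  qed
  finally show ?thesis unfolding eq .
qed

section \<open>Mean square of the estimate\<close>

lemma pm_square: "w > 0 \<Longrightarrow> w\<^sup>2 * pm w \<le> 2"
proof -
  assume w: "w > 0"
  have "w\<^sup>2 \<le> (lam + w)\<^sup>2" using w lam_nonneg by (intro power_mono) auto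
  then have "pm w \<le> exp (- w\<^sup>2 / 2)" using pm_tail[of w] w lam_nonneg by (smt (verit) exp_le_cancel_iff divide_right_mono)
  then have "w\<^sup>2 * pm w \<le> w\<^sup>2 * exp (- w\<^sup>2 / 2)" by (intro mult_left_mono) auto
  then show ?thesis using square_exp_neg_square_le[of w] by linarith
qed

text \<open>The same case split as in \<open>p0_error\<close>. Beyond \<open>Lam\<close> the square
  of the clipping level, exp (2 * L), meets exp (- 3/2 * L) and leaves exp (L / 2).\<close>

lemma p0_square:
  "p0 w * ((\<integral>z. (S (w + s * z))\<^sup>2 \<partial>\<N>) + w\<^sup>2) \<le> (3 + 3 * L)\<^sup>2 * exp (5/6 * L) + L + 7 * exp (L / 2)"
    (is "p0 w * (?S + _) \<le> ?R")
proof (cases "\<bar>w\<bar> \<le> Lam")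
  case True
  have "?S \<le> (\<integral>z. (hermite_series \<beta> s M (w + s * z))\<^sup>2 \<partial>\<N>)"
    by (intro integral_mono integrable_S integrable_hermite_series) (simp add: S_def clip_bounds)
  also have "\<dots> \<le> (3 + 3 * L)\<^sup>2 * exp (5/6 * L)" by (rule series_square_mean[OF True])
  finally have S: "?S \<le> (3 + 3 * L)\<^sup>2 * exp (5/6 * L)" .
  have "w\<^sup>2 \<le> Lam\<^sup>2" using True Lam_nonneg by (simp add: abs_le_square_iff[symmetric])
  then have "?S + w\<^sup>2 \<le> (3 + 3 * L)\<^sup>2 * exp (5/6 * L) + L" using S Lam_square_le L by linarith
  moreover have "p0 w * (?S + w\<^sup>2) \<le> 1 * (?S + w\<^sup>2)" by (intro mult_right_mono p_le_1) auto
  ultimately show ?thesis by (simp add: add_increasing2)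
next
  case False
  define y where "y = \<bar>w\<bar> - Lam"
  have y: "y > 0" "\<bar>w\<bar> = Lam + y" using False by (auto simp: y_def)
  have "w\<^sup>2 = (Lam + y)\<^sup>2" using y(2) power2_abs[of w] by simp
  also have "\<dots> \<le> 2 * Lam\<^sup>2 + 2 * y\<^sup>2" by (rule power2_sum_le)
  also have "\<dots> \<le> 2 * (exp L)\<^sup>2 + 2 * y\<^sup>2"
  proof -
    have "Lam\<^sup>2 \<le> (exp L)\<^sup>2"
    proof (rule power_mono)
      show "Lam \<le> exp L" using Lam_le exp_ge_add_one_self[of L] by linarith
    qed (rule Lam_nonneg)
    then show ?thesis by simp
  qed
  finally have b: "?S + w\<^sup>2 \<le> 3 * (exp L)\<^sup>2 + 2 * y\<^sup>2" using S_square_mean_le[of w] by linarith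
  have "p0 w * (?S + w\<^sup>2) \<le> (exp (- (3/2 * L)) * exp (- y\<^sup>2 / 2)) * (3 * (exp L)\<^sup>2 + 2 * y\<^sup>2)"
    using p0_tail[of w] False b unfolding y_def[symmetric] by (intro mult_mono) (auto simp: p_nonneg)
  also have "\<dots> = exp (- (3/2 * L)) * (exp (- y\<^sup>2 / 2) * (3 * (exp L)\<^sup>2) + 2 * (y\<^sup>2 * exp (- y\<^sup>2 / 2)))"
    by (simp add: algebra_simps)
  also have "\<dots> \<le> exp (- (3/2 * L)) * (1 * (3 * (exp L)\<^sup>2) + 2 * 2)"
    by (intro mult_left_mono add_mono mult_right_mono square_exp_neg_square_le) auto
  also have "\<dots> \<le> exp (- (3/2 * L)) * (7 * (exp L)\<^sup>2)"
  proof -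
    have "1 \<le> (exp L)\<^sup>2" using L by (simp add: exp_double[symmetric])
    then show ?thesis by (intro mult_left_mono) auto
  qed
  also have "\<dots> = 7 * exp (L / 2)" by (simp add: exp_double[symmetric] mult_exp_exp)
  also have "\<dots> \<le> ?R" using L by simp
  finally show ?thesis .
qed

lemma T_measurable [measurable]: "(\<lambda>p. T_fun \<beta> lam S (f p) (g p)) \<in> borel_measurable N"
  if [measurable]: "f \<in> borel_measurable N" "g \<in> borel_measurable N"
  unfolding T_fun_def by measurable

text \<open>The centre \<open>m\<close> is the asymptote of \<open>G\<close> rather than the mean of the estimate: this keeps the bound
  free of \<open>w\<close>, which matters because A2 does not control second moments.\<close>

lemma T_mean_square:
  fixes w
  defines "m \<equiv> max (- \<beta> * w) ((1 - \<beta>) * w)"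
  shows "integrable std_normal2 (\<lambda>p. (T_fun \<beta> lam S (w + s * fst p) (w + s * snd p) - m)\<^sup>2)"
    and "(\<integral>p. (T_fun \<beta> lam S (w + s * fst p) (w + s * snd p) - m)\<^sup>2 \<partial>std_normal2) \<le> msq_bound L" (is ?g1)
proof -
  define a b where "a = max 0 w" and "b = max 0 (- w)"
  define R where "R u v = 2 * (u - w)\<^sup>2 * indicator UNIV v + 2 * a\<^sup>2 * indicator {v. v < - lam} v
     + 2 * b\<^sup>2 * indicator {v. lam < v} v + (2 * (S u)\<^sup>2 + 2 * w\<^sup>2) * indicator {v. \<bar>v\<bar> \<le> lam} v" for u v
  have sq': "(c * d)\<^sup>2 \<le> d\<^sup>2" if "0 \<le> c" "c \<le> 1" for c d :: real
    using that power_le_one[of c 2] mult_right_mono[of "c\<^sup>2" 1 "d\<^sup>2"] by (simp add: power_mult_distrib)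
  have m2: "m\<^sup>2 \<le> w\<^sup>2"
    using sq'[of \<beta> w] sq'[of "1 - \<beta>" w] \<beta> by (auto simp: m_def max_def)
  \<comment> \<open>The numbers \<open>a\<close> and \<open>b\<close> are the distances of the
    centre from the left and the right asymptote. Each is nonzero only for the sign of w at which
    its branch is improbable, so \<open>pm_square\<close> bounds the cost of a wrong choice by a
    constant.\<close>
  have m_eq: "m = - \<beta> * w + a" "m = (1 - \<beta>) * w + b"
    using \<beta> by (auto simp: m_def a_def b_def max_def algebra_simps mult_less_0_iff zero_le_mult_iff)
  have TR: "(T_fun \<beta> lam S u v - m)\<^sup>2 \<le> R u v" for u v
  proof -
    consider "v < - lam" | "\<bar>v\<bar> \<le> lam" | "lam < v" by linarith
    then show ?thesis
    proof cases
      case 1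
      have "(T_fun \<beta> lam S u v - m)\<^sup>2 = (\<beta> * (w - u) - a)\<^sup>2"
        using 1 by (simp add: T_fun_def m_eq(1) algebra_simps)
      also have "\<dots> \<le> 2 * (\<beta> * (w - u))\<^sup>2 + 2 * a\<^sup>2" by (rule power2_diff_le)
      also have "\<dots> \<le> 2 * (w - u)\<^sup>2 + 2 * a\<^sup>2" using \<beta> by (intro add_mono mult_left_mono sq') auto
      finally show ?thesis using 1 lam_nonneg by (simp add: R_def power2_commute[of u])
    next
      case 2
      have "(S u - m)\<^sup>2 \<le> 2 * (S u)\<^sup>2 + 2 * m\<^sup>2" by (rule power2_diff_le)
      then have "(T_fun \<beta> lam S u v - m)\<^sup>2 \<le> 2 * (S u)\<^sup>2 + 2 * w\<^sup>2"
        using 2 m2 by (auto simp: T_fun_def)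
      also have "\<dots> \<le> R u v" using 2 by (simp add: R_def)
      finally show ?thesis .
    next
      case 3
      have "(T_fun \<beta> lam S u v - m)\<^sup>2 = ((1 - \<beta>) * (u - w) - b)\<^sup>2"
        using 3 lam_nonneg by (simp add: T_fun_def m_eq(2) algebra_simps)
      also have "\<dots> \<le> 2 * ((1 - \<beta>) * (u - w))\<^sup>2 + 2 * b\<^sup>2" by (rule power2_diff_le)
      also have "\<dots> \<le> 2 * (u - w)\<^sup>2 + 2 * b\<^sup>2" using \<beta> by (intro add_mono mult_left_mono sq') auto
      finally show ?thesis using 3 lam_nonneg by (simp add: R_def)
    qed
  qed
  have i1: "integrable \<N> (\<lambda>z. 2 * ((w + s * z) - w)\<^sup>2)"
    by (simp add: power_mult_distrib)
  have i2: "integrable \<N> (\<lambda>z. 2 * a\<^sup>2)" "integrable \<N> (\<lambda>z. 2 * b\<^sup>2)"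
    by simp_all
  have i3: "integrable \<N> (\<lambda>z. 2 * (S (w + s * z))\<^sup>2 + 2 * w\<^sup>2)"
    using integrable_S(2)[of w] by simp
  have sets: "UNIV \<in> sets borel" "{v. v < - lam} \<in> sets borel" "{v. lam < v} \<in> sets borel" "{v. \<bar>v\<bar> \<le> lam} \<in> sets borel"
    by measurable
  have vals: "(\<integral>z. 2 * ((w + s * z) - w)\<^sup>2 \<partial>\<N>) = 2 * s\<^sup>2"
    "(\<integral>z. 2 * (S (w + s * z))\<^sup>2 + 2 * w\<^sup>2 \<partial>\<N>)
       = 2 * ((\<integral>z. (S (w + s * z))\<^sup>2 \<partial>\<N>) + w\<^sup>2)"
    "(\<integral>z. 2 * a\<^sup>2 \<partial>\<N>) = 2 * a\<^sup>2" "(\<integral>z. 2 * b\<^sup>2 \<partial>\<N>) = 2 * b\<^sup>2"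
    "measure \<N> {z. w + s * z \<in> UNIV} = 1"
    using std_normal.prob_space integrable_S(2)[of w] by (simp_all add: power_mult_distrib)
  have R: "has_bochner_integral std_normal2 (\<lambda>p. R (w + s * fst p) (w + s * snd p))
     (2 * s\<^sup>2 * 1 + 2 * a\<^sup>2 * pm w + 2 * b\<^sup>2 * pp w
      + 2 * ((\<integral>z. (S (w + s * z))\<^sup>2 \<partial>\<N>) + w\<^sup>2) * p0 w)"
    using has_bochner_integral_add[OF has_bochner_integral_add[OF has_bochner_integral_add[OF
        product_indicator[of "\<lambda>u. 2 * (u - w)\<^sup>2" w, OF i1 sets(1)]
        product_indicator[of "\<lambda>u. 2 * a\<^sup>2" w, OF i2(1) sets(2)]]
        product_indicator[of "\<lambda>u. 2 * b\<^sup>2" w, OF i2(2) sets(3)]]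
        product_indicator[of "\<lambda>u. 2 * (S u)\<^sup>2 + 2 * w\<^sup>2" w, OF i3 sets(4)]]
    unfolding vals unfolding R_def pm_def pp_def p0_def mem_Collect_eq .
  then have intR: "integrable std_normal2 (\<lambda>p. R (w + s * fst p) (w + s * snd p))"
    by (simp add: has_bochner_integral_iff)
  show int: "integrable std_normal2 (\<lambda>p. (T_fun \<beta> lam S (w + s * fst p) (w + s * snd p) - m)\<^sup>2)"
    by (rule Bochner_Integration.integrable_bound[OF intR])
       (auto intro!: always_eventually order_trans[OF TR])
  have "(\<integral>p. (T_fun \<beta> lam S (w + s * fst p) (w + s * snd p) - m)\<^sup>2 \<partial>std_normal2)
      \<le> (\<integral>p. R (w + s * fst p) (w + s * snd p) \<partial>std_normal2)"
    by (intro integral_mono int intR TR)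
  also have "\<dots> = 2 * s\<^sup>2 + 2 * a\<^sup>2 * pm w + 2 * b\<^sup>2 * pp w
      + 2 * (p0 w * ((\<integral>z. (S (w + s * z))\<^sup>2 \<partial>\<N>) + w\<^sup>2))"
    using R by (simp add: has_bochner_integral_iff mult_ac)
  also have "\<dots> \<le> 2 * 1 + 2 * 2 + 2 * 2 + 2 * ((3 + 3 * L)\<^sup>2 * exp (5/6 * L) + L + 7 * exp (L / 2))"
  proof -
    have "a\<^sup>2 * pm w \<le> 2" using pm_square[of w] by (cases "w > 0") (auto simp: a_def max_def)
    moreover have "b\<^sup>2 * pp w \<le> 2"
      unfolding pp_uminus using pm_square[of "- w"] by (cases "w < 0") (auto simp: b_def max_def)
    moreover have "s\<^sup>2 \<le> 1" using s_bounds by simp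
    ultimately show ?thesis unfolding mult.assoc by (intro add_mono mult_left_mono p0_square) auto
  qed
  also have "\<dots> \<le> msq_bound L"
  proof -
    have "exp (L / 2) \<le> exp (5/6 * L)" using L by simp
    moreover have "2 * 1 + 2 * 2 + 2 * 2 + 2 * (X * E + L + 7 * F) \<le> 10 + 2 * L + (2 * X + 14) * E"
      if "F \<le> E" for E F X :: real
      using that by (simp add: algebra_simps)
    ultimately show ?thesis unfolding msq_bound_def by blast
  qed
  finally show ?g1 .
qed

end

section \<open>Averages of independent variables\<close>

text \<open>The locale of product probability spaces wants a probability measure at every index, so
  a point mass is put at the indices outside I.\<close>

lemma PiM_prob_space_extend:
  assumes "\<And>i. i \<in> I \<Longrightarrow> prob_space (M i)"
  shows "\<exists>M'. product_prob_space M' \<and> PiM I M = PiM I M' \<and> (\<forall>i\<in>I. M' i = M i)"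
proof (intro exI conjI)
  let ?M' = "\<lambda>i. if i \<in> I then M i else return (count_space UNIV) undefined"
  show "product_prob_space ?M'"
    by (rule product_prob_spaceI) (auto intro!: assms prob_space_return)
  show "PiM I M = PiM I ?M'" by (rule PiM_cong) auto
qed auto

lemma PiM_component_integral:
  fixes f :: "_ \<Rightarrow> real"
  assumes "\<And>i. i \<in> I \<Longrightarrow> prob_space (M i)" "i \<in> I" and f: "integrable (M i) f"
  shows "integrable (PiM I M) (\<lambda>x. f (x i))" (is ?g1) "(\<integral>x. f (x i) \<partial>PiM I M) = (\<integral>x. f x \<partial>M i)" (is ?g2)
proof -
  have D: "distr (PiM I M) (M i) (\<lambda>x. x i) = M i" by (rule distr_PiM_component[OF assms(1,2)])
  have m: "(\<lambda>x. x i) \<in> measurable (PiM I M) (M i)" using assms(2) by measurable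
  show ?g1
    using integrable_distr[OF m, of f] f unfolding D by simp
  show ?g2
    using integral_distr[OF m borel_measurable_integrable[OF f]] unfolding D by simp
qed

lemma PiM_pair_integral:
  fixes f g :: "_ \<Rightarrow> real"
  assumes M: "\<And>i. i \<in> I \<Longrightarrow> prob_space (M i)" and I: "finite I" "i \<in> I" "j \<in> I" "i \<noteq> j"
    and f: "integrable (M i) f" and g: "integrable (M j) g"
  shows "integrable (PiM I M) (\<lambda>x. f (x i) * g (x j))" (is ?g1)
    "(\<integral>x. f (x i) * g (x j) \<partial>PiM I M) = (\<integral>x. f x \<partial>M i) * (\<integral>x. g x \<partial>M j)" (is ?g2)
proof -
  obtain M' where M': "product_prob_space M'" "PiM I M = PiM I M'" "\<And>i. i \<in> I \<Longrightarrow> M' i = M i"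
    using PiM_prob_space_extend[of I M, OF M] by auto
  interpret product_prob_space M' by fact
  let ?h = "\<lambda>k. if k = i then f else if k = j then g else (\<lambda>_. 1)"
  have int: "integrable (M' k) (?h k)" if "k \<in> I" for k
    using that f g I M'(3) prob_space.finite_measure[OF M[OF that]]
    by (auto intro: finite_measure.integrable_const)
  have eq: "(\<Prod>k\<in>I. F k) = F i * F j" if "\<And>k. k \<in> I \<Longrightarrow> k \<noteq> i \<Longrightarrow> k \<noteq> j \<Longrightarrow> F k = 1" for F :: "_ \<Rightarrow> real"
  proof -
    have "(\<Prod>k\<in>I. F k) = (\<Prod>k\<in>{i, j}. F k)"
      using I that by (intro prod.mono_neutral_right) auto
    then show ?thesis using I by simp
  qed
  have prod: "(\<Prod>k\<in>I. ?h k (x k)) = f (x i) * g (x j)" for x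
    using I by (subst eq) auto
  show ?g1
    using product_integrable_prod[OF I(1) int] by (simp add: prod M'(2))
  have "(\<integral>x. f (x i) * g (x j) \<partial>PiM I M) = (\<Prod>k\<in>I. integral\<^sup>L (M' k) (?h k))"
    using product_integral_prod[OF I(1) int] by (simp add: prod M'(2))
  also have "\<dots> = integral\<^sup>L (M' i) (?h i) * integral\<^sup>L (M' j) (?h j)"
    by (rule eq) (simp add: M.prob_space)
  finally show ?g2
    using I M'(3) by simp
qed

text \<open>The mean square around m is the variance plus (expectation f - m)^2, and both are
  nonnegative. The first claim is Jensen's inequality; the second lets any deterministic centre
  stand in for the mean.\<close>

lemma (in prob_space) integral_shift_square_le:
  fixes f :: "'a \<Rightarrow> real"
  assumes "integrable M f" "integrable M (\<lambda>x. (f x - m)\<^sup>2)"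
  shows "(expectation f - m)\<^sup>2 \<le> (\<integral>x. (f x - m)\<^sup>2 \<partial>M)"
    and "(\<integral>x. (f x - expectation f)\<^sup>2 \<partial>M) \<le> (\<integral>x. (f x - m)\<^sup>2 \<partial>M)"
    and "integrable M (\<lambda>x. (f x - expectation f)\<^sup>2)"
proof -
  let ?E = "expectation f"
  have eq: "(f x - ?E)\<^sup>2 = (f x - m)\<^sup>2 - 2 * (?E - m) * (f x - m) + (?E - m)\<^sup>2" for x
    by (simp add: power2_eq_square algebra_simps)
  show int: "integrable M (\<lambda>x. (f x - ?E)\<^sup>2)"
    unfolding eq using assms by simp
  have "(\<integral>x. (f x - ?E)\<^sup>2 \<partial>M) = (\<integral>x. (f x - m)\<^sup>2 \<partial>M) - 2 * (?E - m) * (?E - m) + (?E - m)\<^sup>2"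
    unfolding eq using assms by (simp add: prob_space)
  then have *: "(\<integral>x. (f x - ?E)\<^sup>2 \<partial>M) = (\<integral>x. (f x - m)\<^sup>2 \<partial>M) - (?E - m)\<^sup>2"
    by (simp add: power2_eq_square algebra_simps)
  moreover have "0 \<le> (\<integral>x. (f x - ?E)\<^sup>2 \<partial>M)" by (rule Bochner_Integration.integral_nonneg) simp
  moreover have "0 \<le> (?E - m)\<^sup>2" by simp
  ultimately show "(?E - m)\<^sup>2 \<le> (\<integral>x. (f x - m)\<^sup>2 \<partial>M)"
    and "(\<integral>x. (f x - ?E)\<^sup>2 \<partial>M) \<le> (\<integral>x. (f x - m)\<^sup>2 \<partial>M)" by linarith+
qed

text \<open>The means add up linearly, while the centred summands are orthogonal by independence, so
  that only their standard deviation counts. The centres m i are free, because the mean square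
  around any centre bounds the variance.\<close>

lemma PiM_abs_sum_le:
  fixes Y :: "'i \<Rightarrow> 'a \<Rightarrow> real"
  assumes M: "\<And>i. i \<in> I \<Longrightarrow> prob_space (M i)" and I: "finite I"
    and Y: "\<And>i. i \<in> I \<Longrightarrow> integrable (M i) (Y i)" "\<And>i. i \<in> I \<Longrightarrow> integrable (M i) (\<lambda>x. (Y i x - m i)\<^sup>2)"
    and b: "\<And>i. i \<in> I \<Longrightarrow> \<bar>\<integral>x. Y i x \<partial>M i\<bar> \<le> b"
    and v: "\<And>i. i \<in> I \<Longrightarrow> (\<integral>x. (Y i x - m i)\<^sup>2 \<partial>M i) \<le> v"
  shows "integrable (PiM I M) (\<lambda>x. \<Sum>i\<in>I. Y i (x i))"
    and "(\<integral>x. \<bar>\<Sum>i\<in>I. Y i (x i)\<bar> \<partial>PiM I M) \<le> real (card I) * b + sqrt (real (card I) * v)" (is ?g1)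
proof -
  interpret prob_space "PiM I M" by (rule prob_space_PiM) (fact M)
  define e where "e i = (\<integral>x. Y i x \<partial>M i)" for i
  define W where "W i x = Y i x - e i" for i x
  have Wint: "integrable (M i) (W i)" "(\<integral>x. W i x \<partial>M i) = 0" "integrable (M i) (\<lambda>x. (W i x)\<^sup>2)"
     "(\<integral>x. (W i x)\<^sup>2 \<partial>M i) \<le> v" if "i \<in> I" for i
  proof -
    interpret Mi: prob_space "M i" by (rule M[OF that])
    show "integrable (M i) (W i)" "(\<integral>x. W i x \<partial>M i) = 0"
      using Y(1)[OF that] by (simp_all add: W_def[abs_def] e_def Mi.prob_space)
    show "integrable (M i) (\<lambda>x. (W i x)\<^sup>2)" "(\<integral>x. (W i x)\<^sup>2 \<partial>M i) \<le> v"
      using Mi.integral_shift_square_le(2,3)[OF Y(1)[OF that] Y(2)[OF that]] v[OF that]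
      unfolding W_def e_def by auto
  qed
  show intY: "integrable (PiM I M) (\<lambda>x. \<Sum>i\<in>I. Y i (x i))"
    by (intro Bochner_Integration.integrable_sum PiM_component_integral(1) M Y(1))
  have intW: "integrable (PiM I M) (\<lambda>x. \<Sum>i\<in>I. W i (x i))"
    by (intro Bochner_Integration.integrable_sum PiM_component_integral(1) M Wint(1))
  have pair: "integrable (PiM I M) (\<lambda>x. W i (x i) * W j (x j))"
    "(\<integral>x. W i (x i) * W j (x j) \<partial>PiM I M) \<le> (if i = j then v else 0)" if "i \<in> I" "j \<in> I" for i j
  proof -
    have "integrable (PiM I M) (\<lambda>x. W i (x i) * W j (x j)) \<and>
      (\<integral>x. W i (x i) * W j (x j) \<partial>PiM I M) \<le> (if i = j then v else 0)"
    proof (cases "i = j")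
      case True
      then show ?thesis
        using PiM_component_integral[where I=I and M=M and i=i and f="\<lambda>x. (W i x)\<^sup>2", OF M that(1) Wint(3)[OF that(1)]]
          Wint(4)[OF that(1)]
        by (simp add: power2_eq_square)
    next
      case False
      then show ?thesis
        using PiM_pair_integral[OF M I that False Wint(1)[OF that(1)] Wint(1)[OF that(2)]] Wint(2) that
        by simp
    qed
    then show "integrable (PiM I M) (\<lambda>x. W i (x i) * W j (x j))"
      "(\<integral>x. W i (x i) * W j (x j) \<partial>PiM I M) \<le> (if i = j then v else 0)" by auto
  qed
  have sq: "(\<Sum>i\<in>I. W i (x i))\<^sup>2 = (\<Sum>i\<in>I. \<Sum>j\<in>I. W i (x i) * W j (x j))" for x
    by (simp add: power2_eq_square sum_product)
  have intW2: "integrable (PiM I M) (\<lambda>x. (\<Sum>i\<in>I. W i (x i))\<^sup>2)"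
    unfolding sq by (intro Bochner_Integration.integrable_sum pair)
  have "(\<integral>x. (\<Sum>i\<in>I. W i (x i))\<^sup>2 \<partial>PiM I M) = (\<Sum>i\<in>I. \<Sum>j\<in>I. \<integral>x. W i (x i) * W j (x j) \<partial>PiM I M)"
    unfolding sq by (subst Bochner_Integration.integral_sum; (intro Bochner_Integration.integrable_sum pair sum.cong refl
        Bochner_Integration.integral_sum | assumption)+)
  also have "\<dots> \<le> (\<Sum>i\<in>I. \<Sum>j\<in>I. if i = j then v else 0)"
    by (intro sum_mono pair)
  also have "\<dots> = real (card I) * v" using I by simp
  finally have W2: "(\<integral>x. (\<Sum>i\<in>I. W i (x i))\<^sup>2 \<partial>PiM I M) \<le> real (card I) * v" .
  have "(\<integral>x. \<bar>\<Sum>i\<in>I. W i (x i)\<bar> \<partial>PiM I M)\<^sup>2 \<le> (\<integral>x. (\<Sum>i\<in>I. W i (x i))\<^sup>2 \<partial>PiM I M)"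
    using integral_shift_square_le(1)[of "\<lambda>x. \<bar>\<Sum>i\<in>I. W i (x i)\<bar>" 0] intW intW2 by simp
  with W2 have "(\<integral>x. \<bar>\<Sum>i\<in>I. W i (x i)\<bar> \<partial>PiM I M)\<^sup>2 \<le> real (card I) * v" by linarith
  then have W1: "(\<integral>x. \<bar>\<Sum>i\<in>I. W i (x i)\<bar> \<partial>PiM I M) \<le> sqrt (real (card I) * v)"
    by (rule real_le_rsqrt)
  have "(\<integral>x. \<bar>\<Sum>i\<in>I. Y i (x i)\<bar> \<partial>PiM I M) \<le> (\<integral>x. real (card I) * b + \<bar>\<Sum>i\<in>I. W i (x i)\<bar> \<partial>PiM I M)"
  proof (rule integral_mono)
    show "\<bar>\<Sum>i\<in>I. Y i (x i)\<bar> \<le> real (card I) * b + \<bar>\<Sum>i\<in>I. W i (x i)\<bar>" for x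
    proof -
      have "(\<Sum>i\<in>I. Y i (x i)) = (\<Sum>i\<in>I. e i) + (\<Sum>i\<in>I. W i (x i))"
        by (simp add: W_def sum_subtractf)
      moreover have "\<bar>\<Sum>i\<in>I. e i\<bar> \<le> (\<Sum>i\<in>I. b)"
        using b by (intro order_trans[OF sum_abs] sum_mono) (simp add: e_def)
      ultimately show ?thesis by simp
    qed
  qed (use intY intW in auto)
  also have "\<dots> = real (card I) * b + (\<integral>x. \<bar>\<Sum>i\<in>I. W i (x i)\<bar> \<partial>PiM I M)"
    using intW by (simp add: prob_space)
  finally show ?g1
    using W1 by linarith
qed

lemma normal_law_integral:
  fixes f :: "real \<Rightarrow> real"
  assumes "\<sigma> > 0" and f: "f \<in> borel_measurable borel"
  shows "integrable (density lborel (normal_density \<mu> \<sigma>)) f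
       \<longleftrightarrow> integrable \<N> (\<lambda>z. f (\<mu> + \<sigma> * z))" (is ?g1)
    and "(\<integral>x. f x \<partial>density lborel (normal_density \<mu> \<sigma>)) = (\<integral>z. f (\<mu> + \<sigma> * z) \<partial>\<N>)" (is ?g2)
proof -
  have *: "density lborel (normal_density \<mu> \<sigma>) = distr \<N> borel (\<lambda>z. \<mu> + \<sigma> * z)"
    using distr_std_normal_affine[of \<sigma> \<mu>] assms by simp
  have m: "(\<lambda>z. \<mu> + \<sigma> * z) \<in> measurable \<N> borel" by simp
  show ?g1
    unfolding * by (rule integrable_distr_eq[OF m f])
  show ?g2
    unfolding * by (rule integral_distr[OF m f])
qed

section \<open>The risk estimate at a fixed point of the grid\<close>

text \<open>The assumptions with their suprema and infima replaced by explicit real bounds. The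
  sharp constant of A3 enters through \<open>\<gamma>_up\<close>; elsewhere the plain comparison
  \<open>ratio\<close> of the two variances is used.\<close>

locale regular_model =
  fixes P :: model and \<gamma> :: "nat \<Rightarrow> real" and blo bhi B v0 F \<gamma>0 Q :: real
  assumes pos: "i \<ge> 1 \<Longrightarrow> nu_p P i > 0" "i \<ge> 1 \<Longrightarrow> nu_f P i > 0" "i \<ge> 1 \<Longrightarrow> bcost P i > 0" "i \<ge> 1 \<Longrightarrow> hcost P i > 0"
    and blo: "0 < blo" "i \<ge> 1 \<Longrightarrow> blo \<le> btilde P i"
    and bhi: "bhi < 1" "i \<ge> 1 \<Longrightarrow> btilde P i \<le> bhi"
    and B: "i \<ge> 1 \<Longrightarrow> bcost P i + hcost P i \<le> B"
    and v0: "0 < v0" "i \<ge> 1 \<Longrightarrow> v0 \<le> nu_p P i"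
    and ratio: "i \<ge> 1 \<Longrightarrow> nu_p P i \<le> nu_f P i"
    and F: "i \<ge> 1 \<Longrightarrow> nu_f P i \<le> F"
    and \<gamma>0: "0 < \<gamma>0" "i \<ge> 1 \<Longrightarrow> \<gamma>0 \<le> \<gamma> i"
    and \<gamma>_up: "i \<ge> 1 \<Longrightarrow> \<gamma> i < 1 / sqrt (4 * exp 1) - sqrt (nu_p P i / nu_f P i)"
    and Q: "i \<ge> 1 \<Longrightarrow> \<bar>inv Phi (btilde P i)\<bar> \<le> Q"
begin

lemma B_pos: "B > 0" using B[of 1] pos(3,4)[of 1] by simp
lemma F_pos: "F > 0" using F[of 1] pos(2)[of 1] by simp
lemma Q_nonneg: "Q \<ge> 0" using Q[of 1] by (rule order_trans[rotated]) auto
lemma btilde_bounds: "i \<ge> 1 \<Longrightarrow> 0 < btilde P i" "i \<ge> 1 \<Longrightarrow> btilde P i < 1"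
  using blo bhi by (fastforce intro: less_le_trans le_less_trans)+

lemma alpha_bounds: "i \<ge> 1 \<Longrightarrow> 0 \<le> alpha P i \<tau>" "i \<ge> 1 \<Longrightarrow> alpha P i \<tau> \<le> 1"
  using pos(1)[of i] enn2real_nonneg[of \<tau>] by (auto simp: alpha_def divide_le_eq_1_pos add_nonneg_pos)

lemma alpha_ennreal: "i \<ge> 1 \<Longrightarrow> \<tau> \<ge> 0 \<Longrightarrow> alpha P i (ennreal \<tau>) = \<tau> / (\<tau> + nu_p P i)"
  by (simp add: alpha_def)

lemma alpha_ennreal_less: "i \<ge> 1 \<Longrightarrow> \<tau> \<ge> 0 \<Longrightarrow> alpha P i (ennreal \<tau>) < 1"
  using pos(1)[of i] by (simp add: alpha_ennreal divide_simps)

lemma coord_loss_lipschitz: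
  assumes "i \<ge> 1"
  shows "\<bar>coord_loss P i t q - coord_loss P i t q'\<bar> \<le> B * \<bar>q - q'\<bar>"
proof -
  let ?r = "sqrt (nu_f P i)" and ?c = "bcost P i + hcost P i"
  have r: "?r > 0" using pos assms by simp
  have c: "0 < ?c" "?c \<le> B" using pos[OF assms] B[OF assms] by auto
  have "coord_loss P i t q - coord_loss P i t q' = ?r * ?c * (G ((q - t) / ?r) (btilde P i) - G ((q' - t) / ?r) (btilde P i))"
    by (simp add: coord_loss_def algebra_simps)
  also have "\<bar>\<dots>\<bar> = ?r * ?c * \<bar>G ((q - t) / ?r) (btilde P i) - G ((q' - t) / ?r) (btilde P i)\<bar>"
    using r c by (simp add: abs_mult)
  also have "\<dots> \<le> ?r * ?c * \<bar>(q - t) / ?r - (q' - t) / ?r\<bar>"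
    using r c btilde_bounds[OF assms] by (intro mult_left_mono G_lipschitz) auto
  also have "(q - t) / ?r - (q' - t) / ?r = (q - q') / ?r"
    by (simp add: diff_divide_distrib)
  also have "?r * ?c * \<bar>(q - q') / ?r\<bar> = ?c * \<bar>q - q'\<bar>"
    using r by (simp add: abs_divide)
  also have "\<dots> \<le> B * \<bar>q - q'\<bar>" using c by (intro mult_right_mono) auto
  finally show ?thesis .
qed

lemma coord_loss_nonneg: "i \<ge> 1 \<Longrightarrow> coord_loss P i t q \<ge> 0"
  unfolding coord_loss_def
  using pos[of i] btilde_bounds[of i] by (intro mult_nonneg_nonneg G_nonneg) auto

lemma coord_loss_self:
  assumes "i \<ge> 1"
  shows "coord_loss P i t t \<le> B * sqrt F"
proof -
  have "coord_loss P i t t = sqrt (nu_f P i) * (bcost P i + hcost P i) * \<phi> 0"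
    by (simp add: coord_loss_def G_def)
  also have "\<dots> \<le> sqrt F * B * 1"
    using pos[OF assms] B[OF assms] F[OF assms] std_normal_density_0_le
    by (intro mult_mono) auto
  finally show ?thesis by (simp add: mult.commute)
qed

lemma borel_measurable_coord_loss [measurable]: "coord_loss P i t \<in> borel_measurable borel"
  unfolding coord_loss_def[abs_def] G_gplus by measurable

end

text \<open>The signs compensate for \<open>d_coef\<close> being negative, so that \<open>(U, V)\<close> is \<open>\<omega>\<close> plus the positive
  multiple \<open>s\<close> of the rotated pair.\<close>

definition rot :: "real \<times> real \<Rightarrow> real \<times> real" where
  "rot p = ((- 1 / sqrt 2) * fst p + (- 1 / sqrt 2) * snd p, (- 1 / sqrt 2) * fst p - (- 1 / sqrt 2) * snd p)"

lemma rot_measurable [measurable]: "rot \<in> measurable (borel \<Otimes>\<^sub>M borel) (borel \<Otimes>\<^sub>M borel)"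
  unfolding rot_def[abs_def] by measurable

lemma distr_rot: "distr std_normal2 (borel \<Otimes>\<^sub>M borel) rot = std_normal2"
  unfolding rot_def[abs_def] by (rule distr_std_normal2_rotation) (simp_all add: power_divide)

lemma rot_integral:
  fixes f :: "real \<times> real \<Rightarrow> real"
  assumes "integrable std_normal2 f"
  shows "integrable std_normal2 (\<lambda>p. f (rot p))" (is ?g1) "(\<integral>p. f (rot p) \<partial>std_normal2) = (\<integral>p. f p \<partial>std_normal2)" (is ?g2)
proof -
  have m: "rot \<in> measurable std_normal2 (borel \<Otimes>\<^sub>M borel)" by measurable
  have f: "f \<in> borel_measurable (borel \<Otimes>\<^sub>M borel)"
    using borel_measurable_integrable[OF assms] by (simp cong: measurable_cong_sets add: sets_std_normal2)
  show ?g1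
    using integrable_distr_eq[OF m f] assms by (simp add: distr_rot)
  show ?g2
    using integral_distr[OF m f] by (simp add: distr_rot)
qed

text \<open>One summand at one grid point, where t stands for the mean of the observation, that is
  for \<theta> i. The common mean of U and V is \<open>\<omega>\<close>, and \<open>\<rho>\<close>
  is a bound of s that does not depend on \<tau>.\<close>

locale coordinate = regular_model +
  fixes n i :: nat and \<eta> \<tau> t :: real
  assumes i: "i \<ge> 1" and \<tau>: "\<tau> \<ge> 0" and n: "n \<ge> 3"
begin

abbreviation "\<alpha> \<equiv> alpha P i (ennreal \<tau>)"
abbreviation "\<beta> \<equiv> btilde P i"
definition "r = sqrt (nu_f P i + \<alpha>\<^sup>2 * nu_p P i)"
abbreviation "\<sigma> \<equiv> sqrt (nu_p P i)"
definition "\<rho> = sqrt (2 * nu_p P i / nu_f P i)"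
definition "s = s_coef P i \<tau>"
definition "\<omega> = c_coef P i \<tau> + d_coef P i \<tau> * (t - \<eta>)"
abbreviation "L \<equiv> ln (real n)"
abbreviation "A \<equiv> (bcost P i + hcost P i) * r"

lemma r_pos: "r > 0" using pos[OF i] by (simp add: r_def add_pos_nonneg)
lemma \<alpha>: "0 \<le> \<alpha>" "\<alpha> < 1" using alpha_bounds(1)[OF i] alpha_ennreal_less[OF i \<tau>] by auto

lemma d_coef_eq: "d_coef P i \<tau> = - ((1 - \<alpha>) / r)" by (simp add: d_coef_def r_def Let_def)

lemma s_eq: "s = sqrt (2 * nu_p P i) * ((1 - \<alpha>) / r)"
  using \<alpha> r_pos by (simp add: s_def s_coef_def d_coef_eq)

lemma L_ge_1: "L \<ge> 1"
proof -
  have "exp 1 \<le> real n" using exp_le n by linarith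
  then show ?thesis by (metis exp_gt_zero ln_exp ln_le_cancel_iff order_less_le_trans)
qed

lemma exp_L: "exp L = real n" using n by simp

text \<open>The bound s \<le> \<rho> drops the shrinkage: 1 - \<alpha> \<le> 1 and r^2 \<ge> nu_f.
  The constant 1 / (2 * e) is the square of sqrt 2 / sqrt (4 * e); the factor sqrt 2 is due to the
  randomisation, which doubles the variance of U and V.\<close>

sublocale C: clipped_hermite \<beta> s \<rho> "\<gamma> i" \<gamma>0 L
proof
  show "0 < \<beta>" "\<beta> < 1" using btilde_bounds[OF i] .
  show "0 < s" using \<alpha> r_pos pos[OF i] by (simp add: s_eq)
  have "(1 - \<alpha>) / r \<le> 1 / sqrt (nu_f P i)"
    using \<alpha> pos[OF i] by (intro frac_le) (auto simp: r_def)
  then have "s \<le> sqrt (2 * nu_p P i) * (1 / sqrt (nu_f P i))"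
    unfolding s_eq using pos[OF i] by (intro mult_left_mono) auto
  then show "s \<le> \<rho>" by (simp add: \<rho>_def real_sqrt_divide)
  show "0 < \<gamma>0" "\<gamma>0 \<le> \<gamma> i" using \<gamma>0 i by auto
  show "1 \<le> L" by (rule L_ge_1)
  let ?x = "sqrt (nu_p P i / nu_f P i)"
  have "\<rho> = sqrt 2 * ?x" by (simp add: \<rho>_def real_sqrt_mult[symmetric])
  moreover have "1 * \<gamma> i \<le> sqrt 2 * \<gamma> i" using \<gamma>0(1) \<gamma>0(2)[OF i] by (intro mult_right_mono) auto
  ultimately have "\<gamma> i + \<rho> \<le> sqrt 2 * (\<gamma> i + ?x)" by (simp add: distrib_left)
  also have "\<dots> \<le> sqrt 2 * (1 / sqrt (4 * exp 1))" using \<gamma>_up[OF i] by (intro mult_left_mono) auto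
  finally have "(\<gamma> i + \<rho>)\<^sup>2 \<le> (sqrt 2 * (1 / sqrt (4 * exp 1)))\<^sup>2"
    using \<gamma>0(1) \<gamma>0(2)[OF i] pos[OF i] by (intro power_mono) (auto simp: \<rho>_def)
  also have "\<dots> = 1 / (2 * exp 1)" by (simp add: power_mult_distrib power_divide)
  finally show "(\<gamma> i + \<rho>)\<^sup>2 \<le> 1 / (2 * exp 1)" .
qed

lemma predictor_eq: "predictor P \<eta> (ennreal \<tau>) x i - t = r * \<omega> + \<alpha> * (x i - t)"
proof -
  have c: "r * c_coef P i \<tau> = sqrt (nu_f P i + \<alpha> * nu_p P i) * inv Phi \<beta>"
    using r_pos by (simp add: c_coef_def r_def real_sqrt_divide Let_def)
  have d': "r * (d_coef P i \<tau> * (t - \<eta>)) = - ((1 - \<alpha>) * (t - \<eta>))"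
    using r_pos by (simp add: d_coef_eq)
  show ?thesis
    unfolding \<omega>_def distrib_left c d' by (simp add: predictor_def algebra_simps)
qed

definition "loss_fun x = coord_loss P i t (t + r * \<omega> + \<alpha> * (x - t))"

lemma loss_fun_eq: "coord_loss P i t (predictor P \<eta> (ennreal \<tau>) x i) = loss_fun (x i)"
proof -
  have "predictor P \<eta> (ennreal \<tau>) x i = t + r * \<omega> + \<alpha> * (x i - t)" using predictor_eq[of x] by linarith
  then show ?thesis by (simp only: loss_fun_def)
qed

lemma loss_fun_measurable [measurable]: "loss_fun \<in> borel_measurable borel"
  unfolding loss_fun_def[abs_def] by measurable

lemma loss_fun_close: "\<bar>loss_fun x - loss_fun t\<bar> \<le> B * \<bar>x - t\<bar>"
proof -
  have "\<bar>loss_fun x - loss_fun t\<bar> \<le> B * \<bar>\<alpha> * (x - t)\<bar>"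
    unfolding loss_fun_def using coord_loss_lipschitz[OF i, of t "t + r * \<omega> + \<alpha> * (x - t)" "t + r * \<omega> + \<alpha> * (t - t)"]
    by simp
  also have "\<dots> \<le> B * \<bar>x - t\<bar>"
    using \<alpha> B_pos mult_right_mono[of \<alpha> 1 "\<bar>x - t\<bar>"] by (simp add: abs_mult)
  finally show ?thesis .
qed

text \<open>The prediction error is r * \<omega> plus \<alpha> times the noise of the observation,
  so convolving the loss with that noise enlarges the variance from nu_f to r^2 = nu_f + \<alpha>^2
  * nu_p. This is what the normalisation of \<open>c_coef\<close> and \<open>d_coef\<close> is made
  for.\<close>

lemma loss_fun_mean:
  "integrable \<N> (\<lambda>z. loss_fun (t + \<sigma> * z))"
  "(\<integral>z. loss_fun (t + \<sigma> * z) \<partial>\<N>) = A * G \<omega> \<beta>"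
proof -
  let ?f = "sqrt (nu_f P i)" and ?c = "bcost P i + hcost P i"
  have f: "?f > 0" using pos[OF i] by simp
  have eq: "loss_fun (t + \<sigma> * z) = ?c * (?f * gplus ((r * \<omega> + (\<alpha> * \<sigma>) * z) / ?f)) - ?c * \<beta> * (r * \<omega> + \<alpha> * \<sigma> * z)" for z
    using f by (simp add: loss_fun_def coord_loss_def G_gplus field_simps)
  have int: "integrable \<N> (\<lambda>z. gplus ((r * \<omega> + (\<alpha> * \<sigma>) * z) / ?f))"
    using integrable_gplus_affine[of "r * \<omega> / ?f" "\<alpha> * \<sigma> / ?f"] by (simp add: add_divide_distrib)
  show "integrable \<N> (\<lambda>z. loss_fun (t + \<sigma> * z))"
    unfolding eq using int by (intro Bochner_Integration.integrable_diff integrable_mult_right) auto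
  have "(\<integral>z. loss_fun (t + \<sigma> * z) \<partial>\<N>)
      = ?c * (\<integral>z. ?f * gplus ((r * \<omega> + (\<alpha> * \<sigma>) * z) / ?f) \<partial>\<N>) - ?c * \<beta> * (r * \<omega>)"
    unfolding eq using int std_normal.prob_space by simp
  also have "\<dots> = A * G \<omega> \<beta>"
  proof -
    have r: "r = sqrt (nu_f P i + (\<alpha> * \<sigma>)\<^sup>2)" using pos[OF i] by (simp add: r_def power_mult_distrib)
    show ?thesis
      unfolding gplus_convolution[OF pos(2)[OF i]] r[symmetric] using r_pos by (simp add: G_gplus algebra_simps)
  qed
  finally show "(\<integral>z. loss_fun (t + \<sigma> * z) \<partial>\<N>) = A * G \<omega> \<beta>" .
qed

abbreviation "Tf p \<equiv> T_fun \<beta> C.lam C.S (\<omega> + s * fst p) (\<omega> + s * snd p)"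

lemma S_clipped_eq: "S_clipped P \<gamma> n i \<tau> = C.S"
proof -
  have K: "K_trunc P \<gamma> n i - 1 = C.M" unfolding K_trunc_def C.M_def by (simp add: \<rho>_def)
  have D: "deriv (\<lambda>w. G w \<beta>) 0 = 1/2 - \<beta>"
    using DERIV_imp_deriv[OF G_has_derivative[of \<beta> 0]] by (simp add: Phi_0)
  have "S_series P \<gamma> n i \<tau> u = hermite_series \<beta> s C.M u" for u
    unfolding S_series_def K D hermite_series_def s_def ..
  then show ?thesis by (simp add: fun_eq_iff S_clipped_def C.S_def clip_def exp_L)
qed

lemma T_rand_eq: "T_rand P \<gamma> n i (t + \<sigma> * z - \<eta>) z' \<tau> = Tf (rot (z, z'))"
proof -
  have s: "s * (- 1 / sqrt 2) = d_coef P i \<tau> * \<sigma>"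
    by (simp add: s_eq d_coef_eq real_sqrt_mult)
  have "s * fst (rot (z, z')) = (s * (- 1 / sqrt 2)) * z + (s * (- 1 / sqrt 2)) * z'"
    "s * snd (rot (z, z')) = (s * (- 1 / sqrt 2)) * z - (s * (- 1 / sqrt 2)) * z'"
    by (simp_all add: rot_def algebra_simps)
  then have UV: "\<omega> + s * fst (rot (z, z')) = c_coef P i \<tau> + d_coef P i \<tau> * (t + \<sigma> * z - \<eta> + \<sigma> * z')"
    "\<omega> + s * snd (rot (z, z')) = c_coef P i \<tau> + d_coef P i \<tau> * (t + \<sigma> * z - \<eta> - \<sigma> * z')"
    unfolding s \<omega>_def by (simp_all add: algebra_simps)
  have "threshold \<gamma> n i = C.lam" by (simp add: threshold_def C.lam_def)
  then show ?thesis
    unfolding T_rand_def Let_def T_fun_def S_clipped_eq UV by simp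
qed

text \<open>Linear growth gives integrability over the auxiliary variable for every value of the
  observation, not just almost every one.\<close>

lemma Tf_bound: "\<bar>T_fun \<beta> C.lam C.S u v\<bar> \<le> \<bar>u\<bar> + real n"
proof -
  have "\<beta> * \<bar>u\<bar> \<le> 1 * \<bar>u\<bar>" "(1 - \<beta>) * \<bar>u\<bar> \<le> 1 * \<bar>u\<bar>"
    using btilde_bounds[OF i] by (intro mult_right_mono; simp)+
  then show ?thesis
    using C.S_bound[of u] btilde_bounds[OF i] unfolding exp_L T_fun_def by (auto simp: abs_mult)
qed

definition "T_est z = T_hat P \<gamma> n i (t + \<sigma> * z - \<eta>) \<tau>"
definition "mT = max (- \<beta> * \<omega>) ((1 - \<beta>) * \<omega>)"

lemma T_est_eq: "T_est z = (\<integral>z'. Tf (rot (z, z')) \<partial>\<N>)"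
  by (simp only: T_est_def T_hat_def T_rand_eq)

lemma T_est_mean:
  "integrable \<N> T_est"
  "(\<integral>z. T_est z \<partial>\<N>) = (\<integral>p. Tf p \<partial>std_normal2)"
proof -
  have int: "integrable std_normal2 (\<lambda>p. Tf (rot p))"
    using C.T_mean[of \<omega>] by (intro rot_integral) (auto simp: has_bochner_integral_iff)
  have e: "T_est = (\<lambda>z. \<integral>z'. Tf (rot (z, z')) \<partial>\<N>)"
    by (simp only: fun_eq_iff T_est_eq) simp
  show "integrable \<N> T_est"
    unfolding e by (rule std_normal2.integrable_fst'[OF int])
  have "(\<integral>z. T_est z \<partial>\<N>) = (\<integral>p. Tf (rot p) \<partial>std_normal2)"
    unfolding e by (rule std_normal2.integral_fst'[OF int])
  also have "\<dots> = (\<integral>p. Tf p \<partial>std_normal2)"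
    using C.T_mean[of \<omega>] by (intro rot_integral) (auto simp: has_bochner_integral_iff)
  finally show "(\<integral>z. T_est z \<partial>\<N>) = (\<integral>p. Tf p \<partial>std_normal2)" .
qed

text \<open>Averaging over the auxiliary variable is a conditional expectation, so by Jensen's
  inequality it does not increase the mean square around \<open>mT\<close>.\<close>

lemma T_est_mean_square:
  "integrable \<N> (\<lambda>z. (T_est z - mT)\<^sup>2)"
  "(\<integral>z. (T_est z - mT)\<^sup>2 \<partial>\<N>) \<le> msq_bound L"
proof -
  have int: "integrable std_normal2 (\<lambda>p. (Tf (rot p) - mT)\<^sup>2)"
    using rot_integral(1)[OF C.T_mean_square(1)[of \<omega>]] by (simp only: mT_def)
  have le: "(T_est z - mT)\<^sup>2 \<le> (\<integral>z'. (Tf (rot (z, z')) - mT)\<^sup>2 \<partial>\<N>)" for z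
  proof -
    have [measurable]: "(\<lambda>z'. rot (z, z')) \<in> measurable borel (borel \<Otimes>\<^sub>M borel)"
      by measurable
    have [measurable]: "(\<lambda>z'. Tf (rot (z, z'))) \<in> borel_measurable borel"
      by (rule C.T_measurable) measurable
    define a where "a = \<bar>\<omega>\<bar> + \<bar>s * (1 / sqrt 2)\<bar> * \<bar>z\<bar> + real n"
    define c where "c = \<bar>s * (1 / sqrt 2)\<bar>"
    have bd: "\<bar>Tf (rot (z, z'))\<bar> \<le> a + c * \<bar>z'\<bar>" for z'
    proof -
      have "\<bar>s * fst (rot (z, z'))\<bar> = \<bar>s * (1 / sqrt 2) * z + s * (1 / sqrt 2) * z'\<bar>"
        unfolding abs_eq_iff by (simp add: rot_def algebra_simps)
      also have "\<dots> \<le> \<bar>s * (1 / sqrt 2)\<bar> * \<bar>z\<bar> + c * \<bar>z'\<bar>"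
        unfolding c_def abs_mult[symmetric] by (rule abs_triangle_ineq)
      finally show ?thesis
        using Tf_bound[of "\<omega> + s * fst (rot (z, z'))" "\<omega> + s * snd (rot (z, z'))"]
          abs_triangle_ineq[of \<omega> "s * fst (rot (z, z'))"] unfolding a_def by linarith
    qed
    have ac: "a \<ge> 0" "c \<ge> 0" by (simp_all add: a_def c_def)
    have i1: "integrable \<N> (\<lambda>z'. Tf (rot (z, z')))"
    proof (rule Bochner_Integration.integrable_bound[where f="\<lambda>z'. a + c * \<bar>z'\<bar>"])
      show "AE z' in std_normal_distribution. norm (Tf (rot (z, z'))) \<le> norm (a + c * \<bar>z'\<bar>)"
        using ac by (intro always_eventually allI order_trans[OF bd[unfolded real_norm_def[symmetric]]]) auto
    qed auto
    have i2: "integrable \<N> (\<lambda>z'. (Tf (rot (z, z')) - mT)\<^sup>2)"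
    proof (rule Bochner_Integration.integrable_bound[where f="\<lambda>z'. 2 * (a + \<bar>mT\<bar>)\<^sup>2 + 2 * c\<^sup>2 * z'\<^sup>2"])
      have "(Tf (rot (z, z')) - mT)\<^sup>2 \<le> 2 * (a + \<bar>mT\<bar>)\<^sup>2 + 2 * c\<^sup>2 * z'\<^sup>2" for z'
      proof -
        have "\<bar>Tf (rot (z, z')) - mT\<bar> \<le> (a + \<bar>mT\<bar>) + c * \<bar>z'\<bar>" using bd[of z'] by linarith
        then have "(Tf (rot (z, z')) - mT)\<^sup>2 \<le> ((a + \<bar>mT\<bar>) + c * \<bar>z'\<bar>)\<^sup>2"
          using ac by (simp add: abs_le_square_iff[symmetric])
        also have "\<dots> \<le> 2 * (a + \<bar>mT\<bar>)\<^sup>2 + 2 * (c * \<bar>z'\<bar>)\<^sup>2" by (rule power2_sum_le)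
        finally show ?thesis by (simp add: power_mult_distrib)
      qed
      then show "AE z' in std_normal_distribution. norm ((Tf (rot (z, z')) - mT)\<^sup>2) \<le> norm (2 * (a + \<bar>mT\<bar>)\<^sup>2 + 2 * c\<^sup>2 * z'\<^sup>2)"
        by (intro always_eventually allI) simp
    qed auto
    show ?thesis
      unfolding T_est_eq by (rule std_normal.integral_shift_square_le(1)[OF i1 i2])
  qed
  have int': "integrable \<N> (\<lambda>z. \<integral>z'. (Tf (rot (z, z')) - mT)\<^sup>2 \<partial>\<N>)"
    by (rule std_normal2.integrable_fst'[OF int])
  show *: "integrable \<N> (\<lambda>z. (T_est z - mT)\<^sup>2)"
  proof (rule Bochner_Integration.integrable_bound[OF int'])
    show "(\<lambda>z. (T_est z - mT)\<^sup>2) \<in> borel_measurable \<N>"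
      using borel_measurable_integrable[OF T_est_mean(1)] by measurable
    show "AE z in std_normal_distribution. norm ((T_est z - mT)\<^sup>2)
        \<le> norm (\<integral>z'. (Tf (rot (z, z')) - mT)\<^sup>2 \<partial>\<N>)"
      by (intro always_eventually allI) (simp only: real_norm_def abs_of_nonneg zero_le_power2
           order_trans[OF le abs_ge_self])
  qed
  have "(\<integral>z. (T_est z - mT)\<^sup>2 \<partial>\<N>)
      \<le> (\<integral>z. \<integral>z'. (Tf (rot (z, z')) - mT)\<^sup>2 \<partial>\<N> \<partial>\<N>)"
    by (rule integral_mono[OF * int' le])
  also have "\<dots> = (\<integral>p. (Tf (rot p) - mT)\<^sup>2 \<partial>std_normal2)"
    by (rule std_normal2.integral_fst'[OF int])
  also have "\<dots> = (\<integral>p. (Tf p - mT)\<^sup>2 \<partial>std_normal2)"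
    using rot_integral(2)[OF C.T_mean_square(1)[of \<omega>]] by (simp only: mT_def)
  also have "\<dots> \<le> msq_bound L"
    using C.T_mean_square(2)[of \<omega>] by (simp only: mT_def)
  finally show "(\<integral>z. (T_est z - mT)\<^sup>2 \<partial>\<N>) \<le> msq_bound L" .
qed

lemma T_hat_measurable: "(\<lambda>x. T_hat P \<gamma> n i (x - \<eta>) \<tau>) \<in> borel_measurable borel"
proof -
  have lam: "threshold \<gamma> n i = C.lam" by (simp add: threshold_def C.lam_def)
  have eq: "T_rand P \<gamma> n i x z \<tau> = T_fun \<beta> C.lam C.S (c_coef P i \<tau> + d_coef P i \<tau> * (x + \<sigma> * z))
       (c_coef P i \<tau> + d_coef P i \<tau> * (x - \<sigma> * z))" for x z
    unfolding T_rand_def Let_def T_fun_def S_clipped_eq lam ..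
  have "(\<lambda>p. T_rand P \<gamma> n i (fst p - \<eta>) (snd p) \<tau>) \<in> borel_measurable (borel \<Otimes>\<^sub>M \<N>)"
    unfolding eq by (rule C.T_measurable) measurable
  then show ?thesis
    unfolding T_hat_def
    by (intro std_normal.borel_measurable_lebesgue_integral) (simp add: case_prod_beta')
qed

definition "Y x = loss_fun x - A * T_hat P \<gamma> n i (x - \<eta>) \<tau>"
definition "mY = loss_fun t - A * mT"

lemma A_bounds: "0 \<le> A" "A \<le> B * sqrt (2 * F)"
proof -
  show "0 \<le> A" using pos[OF i] r_pos by simp
  have "\<alpha>\<^sup>2 \<le> 1" using \<alpha> by (simp add: power_le_one)
  then have "\<alpha>\<^sup>2 * nu_p P i \<le> 1 * nu_p P i" using pos[OF i] by (intro mult_right_mono) auto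
  then have "r \<le> sqrt (2 * F)" using ratio[OF i] F[OF i] by (simp add: r_def)
  then show "A \<le> B * sqrt (2 * F)" using pos[OF i] B[OF i] r_pos by (intro mult_mono) auto
qed

lemma Y_measurable [measurable]: "Y \<in> borel_measurable borel"
  using T_hat_measurable unfolding Y_def[abs_def] by measurable

lemma Y_normal: "Y (t + \<sigma> * z) = loss_fun (t + \<sigma> * z) - A * T_est z"
  by (simp add: Y_def T_est_def)

lemma Y_mean:
  "integrable (density lborel (normal_density t \<sigma>)) Y"
  "\<bar>\<integral>x. Y x \<partial>density lborel (normal_density t \<sigma>)\<bar> \<le> B * sqrt (2 * F) * bias_bound \<gamma>0 L"
proof -
  have \<sigma>: "\<sigma> > 0" using pos[OF i] by simp
  show "integrable (density lborel (normal_density t \<sigma>)) Y"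
    unfolding normal_law_integral(1)[OF \<sigma> Y_measurable] Y_normal
    using loss_fun_mean(1) T_est_mean(1) by simp
  have eq: "(\<integral>x. Y x \<partial>density lborel (normal_density t \<sigma>)) = A * G \<omega> \<beta> - A * (\<integral>p. Tf p \<partial>std_normal2)"
    unfolding normal_law_integral(2)[OF \<sigma> Y_measurable] Y_normal
    using loss_fun_mean T_est_mean by simp
  have "\<bar>\<integral>x. Y x \<partial>density lborel (normal_density t \<sigma>)\<bar> = A * \<bar>(\<integral>p. Tf p \<partial>std_normal2) - G \<omega> \<beta>\<bar>"
  proof -
    have "\<bar>a * x - a * y\<bar> = a * \<bar>y - x\<bar>" if "a \<ge> 0" for a x y :: real
      using that by (simp add: right_diff_distrib[symmetric] abs_mult abs_minus_commute)
    from this[OF A_bounds(1)] show ?thesis unfolding eq .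
  qed
  also have "\<dots> \<le> B * sqrt (2 * F) * bias_bound \<gamma>0 L"
    by (rule mult_mono[OF A_bounds(2) C.T_bias]) (use B_pos F_pos in auto)
  finally show "\<bar>\<integral>x. Y x \<partial>density lborel (normal_density t \<sigma>)\<bar> \<le> B * sqrt (2 * F) * bias_bound \<gamma>0 L" .
qed

text \<open>The loss deviates from its value at x = t by at most B * \<bar>x - t\<bar>, and the
  estimate is controlled around \<open>mT\<close>. Neither bound involves \<omega>, so \<theta> i
  may be arbitrarily large.\<close>

lemma Y_mean_square:
  "integrable (density lborel (normal_density t \<sigma>)) (\<lambda>x. (Y x - mY)\<^sup>2)"
  "(\<integral>x. (Y x - mY)\<^sup>2 \<partial>density lborel (normal_density t \<sigma>)) \<le> 2 * B\<^sup>2 * F + 4 * B\<^sup>2 * F * msq_bound L"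
proof -
  have \<sigma>: "\<sigma> > 0" using pos[OF i] by simp
  have m: "(\<lambda>x. (Y x - mY)\<^sup>2) \<in> borel_measurable borel" by measurable
  let ?D = "\<lambda>z. 2 * B\<^sup>2 * F * z\<^sup>2 + 2 * (B * sqrt (2 * F))\<^sup>2 * (T_est z - mT)\<^sup>2"
  have intD: "integrable \<N> ?D"
    by (intro Bochner_Integration.integrable_add integrable_mult_right T_est_mean_square) simp
  have le: "(Y (t + \<sigma> * z) - mY)\<^sup>2 \<le> ?D z" for z
  proof -
    have "Y (t + \<sigma> * z) - mY = (loss_fun (t + \<sigma> * z) - loss_fun t) - A * (T_est z - mT)"
      by (simp add: Y_normal mY_def right_diff_distrib)
    then have "(Y (t + \<sigma> * z) - mY)\<^sup>2 \<le> 2 * (loss_fun (t + \<sigma> * z) - loss_fun t)\<^sup>2 + 2 * (A * (T_est z - mT))\<^sup>2"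
      by (simp only: power2_diff_le)
    moreover have "(loss_fun (t + \<sigma> * z) - loss_fun t)\<^sup>2 \<le> B\<^sup>2 * F * z\<^sup>2"
    proof -
      have "\<bar>loss_fun (t + \<sigma> * z) - loss_fun t\<bar> \<le> B * \<bar>\<sigma> * z\<bar>"
        using loss_fun_close[of "t + \<sigma> * z"] by simp
      then have "(loss_fun (t + \<sigma> * z) - loss_fun t)\<^sup>2 \<le> (B * \<bar>\<sigma> * z\<bar>)\<^sup>2"
        using B_pos by (simp add: abs_le_square_iff[symmetric] abs_mult)
      also have "\<dots> = B\<^sup>2 * nu_p P i * z\<^sup>2"
        using pos[OF i] by (simp add: power_mult_distrib)
      also have "\<dots> \<le> B\<^sup>2 * F * z\<^sup>2"
        using ratio[OF i] F[OF i] by (intro mult_right_mono mult_left_mono) auto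
      finally show ?thesis .
    qed
    moreover have "(A * (T_est z - mT))\<^sup>2 \<le> (B * sqrt (2 * F))\<^sup>2 * (T_est z - mT)\<^sup>2"
      unfolding power_mult_distrib[of A] using A_bounds by (intro mult_right_mono power_mono) auto
    ultimately show ?thesis by linarith
  qed
  have int: "integrable \<N> (\<lambda>z. (Y (t + \<sigma> * z) - mY)\<^sup>2)"
    by (rule Bochner_Integration.integrable_bound[OF intD]) (auto intro!: always_eventually order_trans[OF le])
  then show "integrable (density lborel (normal_density t \<sigma>)) (\<lambda>x. (Y x - mY)\<^sup>2)"
    by (simp only: normal_law_integral(1)[OF \<sigma> m])
  have "(\<integral>x. (Y x - mY)\<^sup>2 \<partial>density lborel (normal_density t \<sigma>))
      = (\<integral>z. (Y (t + \<sigma> * z) - mY)\<^sup>2 \<partial>\<N>)"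
    by (rule normal_law_integral(2)[OF \<sigma> m])
  also have "\<dots> \<le> (\<integral>z. ?D z \<partial>\<N>)"
    by (rule integral_mono[OF int intD le])
  also have "\<dots> = 2 * B\<^sup>2 * F + 2 * (B * sqrt (2 * F))\<^sup>2 * (\<integral>z. (T_est z - mT)\<^sup>2 \<partial>\<N>)"
    using T_est_mean_square(1) by simp
  also have "\<dots> \<le> 2 * B\<^sup>2 * F + 2 * (B * sqrt (2 * F))\<^sup>2 * msq_bound L"
    by (intro add_left_mono mult_left_mono T_est_mean_square) auto
  also have "\<dots> = 2 * B\<^sup>2 * F + 4 * B\<^sup>2 * F * msq_bound L"
    using F_pos by (simp add: power_mult_distrib)
  finally show "(\<integral>x. (Y x - mY)\<^sup>2 \<partial>density lborel (normal_density t \<sigma>)) \<le> 2 * B\<^sup>2 * F + 4 * B\<^sup>2 * F * msq_bound L" .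
qed

end

context regular_model
begin

text \<open>The bias of one summand plus the standard deviation of an average of n of them. It
  depends neither on the grid point nor on \<theta>.\<close>

definition err :: "nat \<Rightarrow> real" where
  "err n = B * sqrt (2 * F) * bias_bound \<gamma>0 (ln (real n))
     + sqrt ((2 * B\<^sup>2 * F + 4 * B\<^sup>2 * F * msq_bound (ln (real n))) / real n)"

lemma prob_space_coord: "i \<in> {1..n} \<Longrightarrow> prob_space (density lborel (normal_density (\<theta> i) (sqrt (nu_p P i))))"
  using pos(1)[of i] by (intro prob_space_normal_density) simp

lemma prob_space_X_law: "prob_space (X_law P n \<theta>)"
  unfolding X_law_def by (intro prob_space_PiM prob_space_coord)

lemma sets_X_law [measurable_cong]: "sets (X_law P n \<theta>) = sets (sample_space n)"
  unfolding X_law_def by (intro sets_PiM_cong) auto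

lemma space_X_law: "space (X_law P n \<theta>) = space (sample_space n)"
  using sets_X_law by (rule sets_eq_imp_space_eq)

lemma grid_point_error:
  assumes n: "n \<ge> 3" and \<tau>: "\<tau> \<ge> 0"
  shows "integrable (X_law P n \<theta>) (\<lambda>x. loss P n \<theta> (predictor P \<eta> (ennreal \<tau>) x) - ARE_D P \<gamma> n x \<eta> \<tau>)" (is ?g1)
    and "(\<integral>x. \<bar>loss P n \<theta> (predictor P \<eta> (ennreal \<tau>) x) - ARE_D P \<gamma> n x \<eta> \<tau>\<bar> \<partial>X_law P n \<theta>) \<le> err n" (is ?g2)
proof -
  define Y where "Y i = coordinate.Y P \<gamma> n i \<eta> \<tau> (\<theta> i)" for i
  define m where "m i = coordinate.mY P i \<eta> \<tau> (\<theta> i)" for i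
  let ?M = "\<lambda>i. density lborel (normal_density (\<theta> i) (sqrt (nu_p P i)))"
  let ?b = "B * sqrt (2 * F) * bias_bound \<gamma>0 (ln (real n))"
  let ?v = "2 * B\<^sup>2 * F + 4 * B\<^sup>2 * F * msq_bound (ln (real n))"
  have C: "coordinate P \<gamma> blo bhi B v0 F \<gamma>0 Q n i \<tau>" if "i \<in> {1..n}" for i
    by (unfold_locales) (use that n \<tau> in auto)
  have Mp: "prob_space (?M i)" if "i \<in> {1..n}" for i
    using that by (rule prob_space_coord)
  have Y: "integrable (?M i) (Y i)" "\<bar>\<integral>x. Y i x \<partial>?M i\<bar> \<le> ?b"
    "integrable (?M i) (\<lambda>x. (Y i x - m i)\<^sup>2)" "(\<integral>x. (Y i x - m i)\<^sup>2 \<partial>?M i) \<le> ?v" if "i \<in> {1..n}" for i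
    using coordinate.Y_mean[OF C[OF that]] coordinate.Y_mean_square[OF C[OF that]]
    unfolding Y_def m_def by blast+
  have I: "integrable (X_law P n \<theta>) (\<lambda>x. \<Sum>i\<in>{1..n}. Y i (x i))"
    "(\<integral>x. \<bar>\<Sum>i\<in>{1..n}. Y i (x i)\<bar> \<partial>X_law P n \<theta>) \<le> real (card {1..n}) * ?b + sqrt (real (card {1..n}) * ?v)"
    unfolding X_law_def
    by (rule PiM_abs_sum_le[where m=m and M="?M" and I="{1..n}" and Y=Y and b="?b" and v="?v"];
        (fact Mp Y finite_atLeastAtMost))+
  have eq: "loss P n \<theta> (predictor P \<eta> (ennreal \<tau>) x) - ARE_D P \<gamma> n x \<eta> \<tau> = (\<Sum>i\<in>{1..n}. Y i (x i)) / real n" for x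
  proof -
    have "Y i (x i) = coord_loss P i (\<theta> i) (predictor P \<eta> (ennreal \<tau>) x i)
       - (bcost P i + hcost P i) * sqrt (nu_f P i + nu_p P i * (alpha P i (ennreal \<tau>))\<^sup>2) * T_hat P \<gamma> n i (x i - \<eta>) \<tau>"
      if "i \<in> {1..n}" for i
      by (simp only: Y_def coordinate.Y_def[OF C[OF that]] coordinate.loss_fun_eq[OF C[OF that]]
          coordinate.r_def[OF C[OF that]] mult.commute[of "nu_p P i"])
    then show ?thesis
      unfolding loss_def ARE_D_def diff_divide_distrib[symmetric] sum_subtractf[symmetric]
      by (intro arg_cong2[where f="(/)"] sum.cong refl) simp
  qed
  show ?g1
    unfolding eq using I(1) by simp
  have "(\<integral>x. \<bar>loss P n \<theta> (predictor P \<eta> (ennreal \<tau>) x) - ARE_D P \<gamma> n x \<eta> \<tau>\<bar> \<partial>X_law P n \<theta>)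
     = (\<integral>x. \<bar>\<Sum>i\<in>{1..n}. Y i (x i)\<bar> \<partial>X_law P n \<theta>) / real n"
    unfolding eq by simp
  also have "\<dots> \<le> (real n * ?b + sqrt (real n * ?v)) / real n"
    using I(2) by (intro divide_right_mono) auto
  also have "\<dots> = ?b + sqrt (real n * ?v) / sqrt ((real n)\<^sup>2)"
    using n by (simp add: add_divide_distrib)
  also have "sqrt (real n * ?v) / sqrt ((real n)\<^sup>2) = sqrt (?v / real n)"
    using n unfolding real_sqrt_divide[symmetric] by (simp add: power2_eq_square)
  finally show ?g2
    unfolding err_def .
qed

end

section \<open>Grids and empirical quantiles\<close>

lemma lattice_below:
  assumes "(\<delta>::real) > 0"
  obtains k :: int where "p + of_int k * \<delta> \<le> y" "y < p + of_int k * \<delta> + \<delta>"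
proof
  let ?k = "\<lfloor>(y - p) / \<delta>\<rfloor>"
  have "of_int ?k \<le> (y - p) / \<delta>" "(y - p) / \<delta> < of_int ?k + 1" by linarith+
  then show "p + of_int ?k * \<delta> \<le> y" "y < p + of_int ?k * \<delta> + \<delta>"
    using assms unfolding pos_le_divide_eq[OF assms] pos_divide_less_eq[OF assms] distrib_right by linarith+
qed

lemma finite_card_lattice:
  fixes \<delta> a s :: real
  assumes \<delta>: "\<delta> > 0" and a: "a \<ge> 0"
  defines "L \<equiv> {s + of_int k * \<delta> | k :: int. True} \<inter> {- a .. a}"
  shows "finite L" "real (card L) \<le> 2 * a / \<delta> + 1"
proof -
  let ?I = "{\<lceil>(- a - s) / \<delta>\<rceil> .. \<lfloor>(a - s) / \<delta>\<rfloor>}"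
  have sub: "L \<subseteq> (\<lambda>k. s + of_int k * \<delta>) ` ?I"
  proof
    fix y assume "y \<in> L"
    then obtain k :: int where k: "y = s + of_int k * \<delta>" "- a \<le> y" "y \<le> a" by (auto simp: L_def)
    then have "(- a - s) / \<delta> \<le> of_int k" "of_int k \<le> (a - s) / \<delta>" using \<delta> by (simp_all add: field_simps)
    then have "k \<in> ?I" by (simp add: ceiling_le_iff le_floor_iff)
    then show "y \<in> (\<lambda>k. s + of_int k * \<delta>) ` ?I" using k(1) by blast
  qed
  then show "finite L" by (rule finite_subset) simp
  have "card L \<le> card ?I"
    using card_mono[OF _ sub] card_image_le[of ?I "\<lambda>k. s + of_int k * \<delta>"] by simp
  moreover have "real (card ?I) \<le> 2 * a / \<delta> + 1"
  proof -
    have "(a - s) / \<delta> - (- a - s) / \<delta> = 2 * a / \<delta>" by (simp add: diff_divide_distrib)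
    moreover have "2 * a / \<delta> \<ge> 0" using \<delta> a by simp
    ultimately show ?thesis by (simp; linarith)
  qed
  ultimately show "real (card L) \<le> 2 * a / \<delta> + 1" by linarith
qed

text \<open>If the interval contains a lattice point, every \<eta> in it has one within
  \<open>\<delta>\<close> that is also in the interval. If it contains none, it is shorter than
  \<open>\<delta>\<close>, and the nearest lattice points are at distance at most
  \<open>\<delta>\<close> from it, which adds up to 2 * \<delta>.\<close>

lemma eta_candidates_dense:
  fixes \<delta> a s :: real
  assumes \<delta>: "\<delta> > 0" "\<delta> \<le> 2 * a"
  defines "L \<equiv> {s + of_int k * \<delta> | k :: int. True} \<inter> {- a .. a}"
  assumes M: "{m1..m2} \<subseteq> {- a .. a}" and \<eta>: "\<eta> \<in> {m1..m2}"
  shows "\<exists>\<eta>'\<in>eta_candidates L {m1..m2}. \<bar>\<eta> - \<eta>'\<bar> \<le> 2 * \<delta>"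
proof (cases "L \<inter> {m1..m2} = {}")
  case False
  then obtain y where yL: "y \<in> L" "m1 \<le> y" "y \<le> m2" by auto
  from yL(1) obtain k0 :: int where "y = s + of_int k0 * \<delta>" by (auto simp: L_def)
  note y = this yL(2,3)
  have shift: "y + of_int k * \<delta> \<in> L \<inter> {m1..m2}" if "m1 \<le> y + of_int k * \<delta>" "y + of_int k * \<delta> \<le> m2" for k :: int
  proof -
    have "y + of_int k * \<delta> = s + of_int (k0 + k) * \<delta>" using y(1) by (simp add: algebra_simps)
    then have "y + of_int k * \<delta> \<in> {s + of_int k * \<delta> | k :: int. True}" by blast
    moreover have "y + of_int k * \<delta> \<in> {m1..m2}" using that by simp
    ultimately show ?thesis using M unfolding L_def by blast
  qed
  obtain k :: int where k: "y + of_int k * \<delta> \<le> \<eta>" "\<eta> < y + of_int k * \<delta> + \<delta>"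
    by (rule lattice_below[OF \<delta>(1)])
  have "\<exists>\<eta>'\<in>L \<inter> {m1..m2}. \<bar>\<eta> - \<eta>'\<bar> \<le> 2 * \<delta>"
  \<comment> \<open>The rounding goes towards the lattice point y, so that the result stays between
    y and \<eta>, hence inside the interval.\<close>
  proof (cases "k \<ge> 0")
    case True
    then have "0 \<le> of_int k * \<delta>" using \<delta> by simp
    then show ?thesis using shift[of k] k y \<eta> \<delta> by (intro bexI[of _ "y + of_int k * \<delta>"]) auto
  next
    case False
    then have "of_int (k + 1) * \<delta> \<le> 0" using \<delta> by (intro mult_nonpos_nonneg) auto
    then have "y + of_int (k + 1) * \<delta> \<in> L \<inter> {m1..m2}"
      using k y \<eta> by (intro shift) (auto simp: algebra_simps)
    moreover have "\<bar>\<eta> - (y + of_int (k + 1) * \<delta>)\<bar> \<le> 2 * \<delta>"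
      using k \<delta> by (simp add: algebra_simps)
    ultimately show ?thesis by blast
  qed
  then show ?thesis using False by (simp add: eta_candidates_def)
next
  case True
  have a: "a > 0" using \<delta> by linarith
  have near: "\<exists>p\<in>L. \<bar>\<eta> - p\<bar> \<le> \<delta>"
  proof -
    obtain k :: int where k: "s + of_int k * \<delta> \<le> \<eta>" "\<eta> < s + of_int k * \<delta> + \<delta>"
      by (rule lattice_below[OF \<delta>(1)])
    have e: "- a \<le> \<eta>" "\<eta> \<le> a" using M \<eta> by auto
    show ?thesis
    proof (cases "- a \<le> s + of_int k * \<delta>")
      case True
      then have "s + of_int k * \<delta> \<in> L" using k e by (auto simp: L_def)
      then show ?thesis using k by (intro bexI[of _ "s + of_int k * \<delta>"]) auto
    next
      case False
      have "s + of_int k * \<delta> + \<delta> = s + of_int (k + 1) * \<delta>" by (simp add: algebra_simps)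
      then have "s + of_int k * \<delta> + \<delta> \<in> {s + of_int k * \<delta> | k :: int. True}" by blast
      moreover have "s + of_int k * \<delta> + \<delta> \<in> {- a .. a}" using False k e \<delta> by auto
      ultimately have "s + of_int k * \<delta> + \<delta> \<in> L" unfolding L_def by blast
      then show ?thesis using k by (intro bexI[of _ "s + of_int k * \<delta> + \<delta>"]) auto
    qed
  qed
  have "finite L" unfolding L_def using a by (intro finite_card_lattice \<delta>) simp
  moreover have "L \<noteq> {}" using near by auto
  ultimately obtain \<eta>' where \<eta>': "\<eta>' \<in> L" "\<And>y. y \<in> L \<Longrightarrow> infdist \<eta>' {m1..m2} \<le> infdist y {m1..m2}"
    using arg_min_if_finite(1)[of L "\<lambda>y. infdist y {m1..m2}"] arg_min_least[of L _ "\<lambda>y. infdist y {m1..m2}"]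
    by blast
  have ne: "{m1..m2} \<noteq> {}" using \<eta> by auto
  obtain p where p: "p \<in> L" "\<bar>\<eta> - p\<bar> \<le> \<delta>" using near by auto
  have "infdist \<eta>' {m1..m2} \<le> infdist p {m1..m2}" by (rule \<eta>'(2)[OF p(1)])
  also have "\<dots> \<le> dist p \<eta>" by (rule infdist_le[OF \<eta>])
  also have "\<dots> \<le> \<delta>" using p(2) by (simp add: dist_real_def)
  finally have d: "infdist \<eta>' {m1..m2} \<le> \<delta>" .
  obtain m where m: "m \<in> {m1..m2}" "infdist \<eta>' {m1..m2} = dist \<eta>' m"
    using infdist_attains_inf[OF closed_atLeastAtMost ne] by metis
  \<comment> \<open>A longer interval would contain the largest lattice point below m2, and since it
    lies in the range [-a, a] this point would belong to L.\<close>
  have "m2 - m1 < \<delta>"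
  proof (rule ccontr)
    assume *: "\<not> m2 - m1 < \<delta>"
    obtain k :: int where k: "s + of_int k * \<delta> \<le> m2" "m2 < s + of_int k * \<delta> + \<delta>"
      by (rule lattice_below[OF \<delta>(1)])
    have "s + of_int k * \<delta> \<in> {m1..m2}" using k * by auto
    moreover from this have "s + of_int k * \<delta> \<in> L" using M by (auto simp: L_def)
    ultimately show False using True by blast
  qed
  then have "\<bar>\<eta> - m\<bar> \<le> \<delta>" using m(1) \<eta> by auto
  moreover have "\<bar>\<eta>' - m\<bar> \<le> \<delta>" using d m(2) by (simp add: dist_real_def)
  ultimately have "\<bar>\<eta> - \<eta>'\<bar> \<le> 2 * \<delta>" by linarith
  moreover have "\<eta>' \<in> eta_candidates L {m1..m2}"
    using True \<eta>' by (auto simp: eta_candidates_def)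
  ultimately show ?thesis by blast
qed

lemma grid1_eq: "grid1 C1 s n = {s + of_int k * (1 / (2 * C1 * a_seq n)) | k :: int. True} \<inter> {- a_seq n .. a_seq n}"
  by (simp add: grid1_def)

text \<open>The parametrisation of \<open>[0, \<infinity>]\<close> by \<open>[0, 1]\<close> in which the second grid is equispaced.\<close>

definition tcoord :: "ennreal \<Rightarrow> real" where
  "tcoord \<tau> = (if \<tau> = \<infinity> then 1 else enn2real \<tau> / (enn2real \<tau> + 1))"

lemma tcoord_bounds: "0 \<le> tcoord \<tau>" "tcoord \<tau> \<le> 1"
  using enn2real_nonneg[of \<tau>] by (auto simp: tcoord_def divide_le_eq_1_pos add_nonneg_pos)

lemma tcoord_ennreal: "\<tau> \<ge> 0 \<Longrightarrow> tcoord (ennreal \<tau>) = \<tau> / (\<tau> + 1)"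
  by (simp add: tcoord_def)

lemma grid2_dense:
  assumes \<delta>: "delta2 C1 C2 C3 C4 n > 0" and t: "0 \<le> t" "t \<le> 1"
  shows "\<exists>\<tau>\<in>grid2 C1 C2 C3 C4 n. \<bar>t - tcoord (ennreal \<tau>)\<bar> \<le> delta2 C1 C2 C3 C4 n"
proof -
  let ?\<delta> = "delta2 C1 C2 C3 C4 n"
  define J where "J = nat \<lceil>1 / ?\<delta>\<rceil>"
  have J: "J \<ge> 1" "1 / ?\<delta> \<le> real J" "real J < 1 / ?\<delta> + 1"
  proof -
    have pos: "0 < 1 / ?\<delta>" using \<delta> by simp
    then have c: "real J = of_int \<lceil>1 / ?\<delta>\<rceil>" unfolding J_def by (simp del: zero_less_divide_1_iff)
    show le: "1 / ?\<delta> \<le> real J" "real J < 1 / ?\<delta> + 1" unfolding c by linarith+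
    have "0 < real J" using pos le(1) by (rule less_le_trans)
    then show "J \<ge> 1" by simp
  qed
  \<comment> \<open>The grid uses the multiples 0, ..., J - 1 of the spacing, all below 1. The
    minimum matters near t = 1, in particular for \<tau> = \<infinity>, which is approximated by the
    last, finite grid point.\<close>
  define k where "k = min (nat \<lfloor>t / ?\<delta>\<rfloor>) (J - 1)"
  define t' where "t' = real k * ?\<delta>"
  have td: "0 \<le> t / ?\<delta>" using t \<delta> by simp
  have "real k \<le> real J - 1" using J by (simp add: k_def of_nat_diff)
  then have "real k < 1 / ?\<delta>" using J by linarith
  then have t'1: "t' < 1" using \<delta> by (simp add: t'_def field_simps)
  have t'0: "0 \<le> t'" using \<delta> by (simp add: t'_def)
  have kt: "real k \<le> t / ?\<delta>"
  proof -
    have "real k \<le> real (nat \<lfloor>t / ?\<delta>\<rfloor>)" by (simp add: k_def)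
    also have "\<dots> \<le> t / ?\<delta>" using td by simp
    finally show ?thesis .
  qed
  then have le: "t' \<le> t" using \<delta> by (simp add: t'_def field_simps)
  have ge: "t - t' \<le> ?\<delta>"
  proof (cases "nat \<lfloor>t / ?\<delta>\<rfloor> \<le> J - 1")
    case True
    then have "t / ?\<delta> < real k + 1" using td unfolding k_def by (simp add: min_absorb1)
    then show ?thesis using \<delta> by (simp add: t'_def field_simps)
  next
    case False
    then have "real k = real J - 1" using J by (simp add: k_def of_nat_diff)
    then have "1 / ?\<delta> \<le> real k + 1" using J by linarith
    then have "1 \<le> t' + ?\<delta>" using \<delta> by (simp add: t'_def field_simps)
    then show ?thesis using t by linarith
  qed
  define \<tau> where "\<tau> = t' / (1 - t')"
  have \<tau>0: "\<tau> \<ge> 0" using t'0 t'1 by (simp add: \<tau>_def)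
  have \<tau>t: "\<tau> / (\<tau> + 1) = t'" using t'1 by (simp add: \<tau>_def field_simps)
  have "\<tau> \<in> grid2 C1 C2 C3 C4 n"
    unfolding grid2_def J_def[symmetric] using \<tau>0 J(1)
    by (auto intro!: bexI[of _ "k + 1"] simp: \<tau>t t'_def k_def)
  moreover have "\<bar>t - tcoord (ennreal \<tau>)\<bar> \<le> ?\<delta>"
    using le ge by (simp add: tcoord_ennreal[OF \<tau>0] \<tau>t)
  ultimately show ?thesis by blast
qed

lemma finite_card_grid2:
  "finite (grid2 C1 C2 C3 C4 n)" "card (grid2 C1 C2 C3 C4 n) \<le> nat \<lceil>1 / delta2 C1 C2 C3 C4 n\<rceil>"
proof -
  let ?\<delta> = "delta2 C1 C2 C3 C4 n" and ?J = "{1..nat \<lceil>1 / delta2 C1 C2 C3 C4 n\<rceil>}"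
  have sub: "grid2 C1 C2 C3 C4 n \<subseteq> (\<lambda>j. ((real j - 1) * ?\<delta>) / (1 - (real j - 1) * ?\<delta>)) ` ?J"
  proof
    fix \<tau> assume "\<tau> \<in> grid2 C1 C2 C3 C4 n"
    then obtain j where j: "\<tau> \<ge> 0" "j \<in> ?J" "\<tau> / (\<tau> + 1) = (real j - 1) * ?\<delta>" by (auto simp: grid2_def)
    have "\<tau> = (\<tau> / (\<tau> + 1)) / (1 - \<tau> / (\<tau> + 1))" using j(1) by (simp add: field_simps)
    then show "\<tau> \<in> (\<lambda>j. ((real j - 1) * ?\<delta>) / (1 - (real j - 1) * ?\<delta>)) ` ?J"
      unfolding j(3) using j(2) by (rule image_eqI)
  qed
  then show "finite (grid2 C1 C2 C3 C4 n)" by (rule finite_subset) simp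
  show "card (grid2 C1 C2 C3 C4 n) \<le> nat \<lceil>1 / delta2 C1 C2 C3 C4 n\<rceil>"
    using card_mono[OF _ sub] card_image_le[of ?J "\<lambda>j. ((real j - 1) * ?\<delta>) / (1 - (real j - 1) * ?\<delta>)"] by simp
qed

lemma grid2_nonneg: "\<tau> \<in> grid2 C1 C2 C3 C4 n \<Longrightarrow> \<tau> \<ge> 0"
  by (simp add: grid2_def)

lemma eta_candidates_subset: "eta_candidates L M \<subseteq> L"
  by (auto simp: eta_candidates_def split: if_splits)

section \<open>Empirical quantiles are bounded by the average of the absolute values\<close>

definition avg :: "nat \<Rightarrow> (nat \<Rightarrow> real) \<Rightarrow> real" where
  "avg n x = (\<Sum>i=1..n. \<bar>x i\<bar>) / real n"

lemma avg_nonneg: "avg n x \<ge> 0" by (simp add: avg_def sum_nonneg)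

text \<open>Markov's inequality for the empirical measure. A level t < 0 below which a fraction
  \<open>\<beta>\<close> of the values lies satisfies \<beta> * \<bar>t\<bar> \<le> avg, and at most
  a fraction 1 / \<kappa> \<le> 1 - \<beta> of the values exceeds \<kappa> * avg.\<close>

lemma emp_quantile_bound:
  assumes n: "n \<ge> 1" and \<kappa>: "\<kappa> * \<beta> \<ge> 1" "\<kappa> * (1 - \<beta>) \<ge> 1" and \<beta>: "0 < \<beta>" "\<beta> < 1"
  shows "\<bar>emp_quantile n x \<beta>\<bar> \<le> \<kappa> * avg n x"
proof -
  let ?T = "{t. real (card {i\<in>{1..n}. x i \<le> t}) / real n \<ge> \<beta>}"
  let ?u = "\<kappa> * avg n x"
  have \<kappa>0: "\<kappa> > 0" using \<kappa>(1) \<beta>(1) by (smt (verit) mult_nonpos_nonneg)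
  have n0: "real n > 0" using n by simp
  have S: "(\<Sum>i=1..n. \<bar>x i\<bar>) = real n * avg n x" using n by (simp add: avg_def)
  have count: "real (card {i\<in>{1..n}. R i}) * c \<le> real n * avg n x"
    if "\<And>i. i \<in> {1..n} \<Longrightarrow> R i \<Longrightarrow> c \<le> \<bar>x i\<bar>" for R c
  proof -
    have "real (card {i\<in>{1..n}. R i}) * c = (\<Sum>i\<in>{i\<in>{1..n}. R i}. c)" by simp
    also have "\<dots> \<le> (\<Sum>i\<in>{i\<in>{1..n}. R i}. \<bar>x i\<bar>)" by (rule sum_mono) (use that in auto)
    also have "\<dots> \<le> (\<Sum>i=1..n. \<bar>x i\<bar>)" by (rule sum_mono2) auto
    finally show ?thesis by (simp only: S)
  qed
  have lower: "- ?u \<le> t" if "t \<in> ?T" for t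
  proof (cases "t \<ge> 0")
    case True
    moreover have "0 \<le> ?u" using \<kappa>0 avg_nonneg[of n x] by (intro mult_nonneg_nonneg) auto
    ultimately show ?thesis by linarith
  next
    case False
    have "real n * \<beta> \<le> real (card {i\<in>{1..n}. x i \<le> t})" using that n0 by (simp add: field_simps)
    then have "real n * \<beta> * (- t) \<le> real (card {i\<in>{1..n}. x i \<le> t}) * (- t)"
      using False by (intro mult_right_mono) auto
    also have "\<dots> \<le> real n * avg n x" by (rule count) (use False in auto)
    finally have "real n * (\<beta> * (- t)) \<le> real n * avg n x" by (simp only: mult.assoc)
    then have "\<beta> * (- t) \<le> avg n x" using n0 by (rule mult_left_le_imp_le)
    then have "\<kappa> * (\<beta> * (- t)) \<le> ?u" using \<kappa>0 by (intro mult_left_mono) auto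
    moreover have "1 * (- t) \<le> (\<kappa> * \<beta>) * (- t)" using \<kappa>(1) False by (intro mult_right_mono) auto
    ultimately show ?thesis by (simp add: mult.assoc)
  qed
  have upper: "?u \<in> ?T"
  proof -
    let ?c = "real (card {i\<in>{1..n}. ?u < x i})"
    have part: "real (card {i\<in>{1..n}. x i \<le> ?u}) = real n - ?c"
    proof -
      have "card ({i\<in>{1..n}. x i \<le> ?u} \<union> {i\<in>{1..n}. ?u < x i}) = card {i\<in>{1..n}. x i \<le> ?u} + card {i\<in>{1..n}. ?u < x i}"
        by (rule card_Un_disjoint) auto
      moreover have "{i\<in>{1..n}. x i \<le> ?u} \<union> {i\<in>{1..n}. ?u < x i} = {1..n}" by auto
      ultimately show ?thesis by simp
    qed
    have c: "?c \<le> real n * (1 - \<beta>)"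
    \<comment> \<open>The count is bounded after division by the average. If that is zero, all
      coordinates vanish and nothing exceeds the level 0.\<close>
    proof (cases "avg n x = 0")
      case True
      then have "(\<Sum>i=1..n. \<bar>x i\<bar>) = 0" by (simp only: S mult_zero_right)
      then have "\<forall>i\<in>{1..n}. x i = 0" by (simp add: sum_nonneg_eq_0_iff)
      then have "{i\<in>{1..n}. ?u < x i} = {}" using True by auto
      then have "?c = 0" by (simp only: card.empty of_nat_0)
      moreover have "0 \<le> real n * (1 - \<beta>)" using \<beta> by simp
      ultimately show ?thesis by linarith
    next
      case False
      then have av: "avg n x > 0" using avg_nonneg[of n x] by linarith
      have "?c * ?u \<le> real n * avg n x" by (rule count) auto
      then have "?c * \<kappa> \<le> real n" using av by simp
      also have "\<dots> \<le> real n * (\<kappa> * (1 - \<beta>))" using \<kappa>(2) n0 by simp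
      finally have "\<kappa> * ?c \<le> \<kappa> * (real n * (1 - \<beta>))" by (simp add: mult_ac)
      then show ?thesis using \<kappa>0 by simp
    qed
    have "real n * \<beta> \<le> real n - ?c" using c by (simp add: algebra_simps)
    then have "\<beta> \<le> (real n - ?c) / real n" unfolding pos_le_divide_eq[OF n0] by (simp only: mult.commute)
    then show ?thesis unfolding mem_Collect_eq part .
  qed
  have "Inf ?T \<le> ?u" by (rule cInf_lower[OF upper bdd_belowI[OF lower]])
  moreover have "- ?u \<le> Inf ?T" by (rule cInf_greatest) (use upper in blast, rule lower)
  ultimately show ?thesis by (simp add: emp_quantile_def)
qed

context regular_model
begin

definition "\<kappa> = 1 / min blo (1 - bhi)"

lemma \<kappa>_pos: "\<kappa> > 0" using blo(1) bhi(1) by (simp add: \<kappa>_def)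

lemma M_hat_bound:
  assumes n: "n \<ge> 1" and \<eta>: "\<eta> \<in> M_hat P n x"
  shows "\<bar>\<eta>\<bar> \<le> \<kappa> * avg n x" (is ?g1) "M_hat P n x \<subseteq> {- (\<kappa> * avg n x) .. \<kappa> * avg n x}" (is ?g2)
proof -
  have q: "\<bar>emp_quantile n x \<beta>\<bar> \<le> \<kappa> * avg n x" if "blo \<le> \<beta>" "\<beta> \<le> bhi" for \<beta>
  proof (rule emp_quantile_bound[OF n])
    have m: "0 < min blo (1 - bhi)" using blo(1) bhi(1) by simp
    show "1 \<le> \<kappa> * \<beta>" using m that(1) by (simp add: \<kappa>_def min_le_iff_disj)
    show "1 \<le> \<kappa> * (1 - \<beta>)" using m that(2) by (simp add: \<kappa>_def min_le_iff_disj)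
  qed (use that blo(1) bhi(1) in auto)
  have fin: "finite ((\<lambda>i. btilde P i) ` {1..n})" "(\<lambda>i. btilde P i) ` {1..n} \<noteq> {}" using n by auto
  have "(MIN i\<in>{1..n}. btilde P i) \<in> btilde P ` {1..n}" "(MAX i\<in>{1..n}. btilde P i) \<in> btilde P ` {1..n}"
    using Min_in[OF fin] Max_in[OF fin] by auto
  then have "blo \<le> (MIN i\<in>{1..n}. btilde P i)" "(MIN i\<in>{1..n}. btilde P i) \<le> bhi"
    "blo \<le> (MAX i\<in>{1..n}. btilde P i)" "(MAX i\<in>{1..n}. btilde P i) \<le> bhi"
    using blo(2) bhi(2) by auto
  note b = q[OF this(1,2)] q[OF this(3,4)]
  then show ?g2 by (auto simp: M_hat_def)
  then have "\<eta> \<in> {- (\<kappa> * avg n x) .. \<kappa> * avg n x}" using \<eta> by blast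
  then show ?g1 by (simp add: abs_le_iff)
qed

section \<open>Lipschitz dependence of the shrinkage weights on the compactified \<tau>\<close>

definition "c\<alpha> = F / (min 1 v0)\<^sup>2"

lemma c\<alpha>_nonneg: "c\<alpha> \<ge> 0" using F_pos by (simp add: c\<alpha>_def)

lemma alpha_tcoord:
  assumes "i \<ge> 1"
  shows "alpha P i \<tau> = tcoord \<tau> / (tcoord \<tau> + nu_p P i * (1 - tcoord \<tau>))"
proof (cases "\<tau> = \<infinity>")
  case False
  define e where "e = enn2real \<tau>"
  have e: "e \<ge> 0" "e + 1 > 0" "e + nu_p P i > 0" using pos(1)[OF assms] by (auto simp: e_def add_nonneg_pos)
  have t: "tcoord \<tau> = e / (e + 1)" using False by (simp add: tcoord_def e_def)
  have "1 - tcoord \<tau> = 1 / (e + 1)" using e by (simp add: t field_simps)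
  then have "tcoord \<tau> + nu_p P i * (1 - tcoord \<tau>) = (e + nu_p P i) / (e + 1)" using e by (simp add: t add_divide_distrib)
  then have "tcoord \<tau> / (tcoord \<tau> + nu_p P i * (1 - tcoord \<tau>)) = e / (e + nu_p P i)" using e by (simp add: t)
  then show ?thesis using False by (simp add: alpha_def e_def)
qed (simp add: alpha_def tcoord_def)

text \<open>In the coordinate t the weight is t / (t + \<nu> * (1 - t)), including \<tau> =
  \<infinity> at t = 1. The denominator is a convex combination of 1 and \<nu>, hence at least min 1
  v0, and the difference of two such fractions has numerator \<nu> * (t - t').\<close>

lemma alpha_lipschitz:
  assumes i: "i \<ge> 1"
  shows "\<bar>alpha P i \<tau> - alpha P i \<tau>'\<bar> \<le> c\<alpha> * \<bar>tcoord \<tau> - tcoord \<tau>'\<bar>"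
proof -
  let ?t = "tcoord \<tau>" and ?t' = "tcoord \<tau>'" and ?\<nu> = "nu_p P i" and ?w = "min 1 v0"
  let ?D = "\<lambda>t. t + ?\<nu> * (1 - t)"
  have w: "?w > 0" using v0(1) by simp
  have D: "?D t \<ge> ?w" if "0 \<le> t" "t \<le> 1" for t
  proof -
    have "?w * t \<le> 1 * t" using that by (intro mult_right_mono) auto
    moreover have "?w * (1 - t) \<le> ?\<nu> * (1 - t)" using that v0(2)[OF i] by (intro mult_right_mono) auto
    moreover have "?w * t + ?w * (1 - t) = ?w" by (simp add: algebra_simps)
    ultimately show ?thesis by linarith
  qed
  note Dt = D[OF tcoord_bounds[of \<tau>]] D[OF tcoord_bounds[of \<tau>']]
  have "alpha P i \<tau> - alpha P i \<tau>' = ?\<nu> * (?t - ?t') / (?D ?t * ?D ?t')"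
    unfolding alpha_tcoord[OF i] using Dt w by (simp add: diff_frac_eq algebra_simps)
  also have "\<bar>\<dots>\<bar> = ?\<nu> * \<bar>?t - ?t'\<bar> / (?D ?t * ?D ?t')"
    using Dt w pos(1)[OF i] by (simp add: abs_mult)
  also have "\<dots> \<le> F * \<bar>?t - ?t'\<bar> / (?w * ?w)"
    using Dt w pos(1)[OF i] ratio[OF i] F[OF i] by (intro frac_le mult_mono) auto
  finally show ?thesis by (simp add: c\<alpha>_def power2_eq_square)
qed

text \<open>Multiplying by the sum of the two roots, which is at least sqrt nu_f, reduces the claim
  to the difference of the radicands.\<close>

lemma sqrt_lipschitz:
  assumes i: "i \<ge> 1"
  shows "\<bar>sqrt (nu_f P i + alpha P i \<tau> * nu_p P i) - sqrt (nu_f P i + alpha P i \<tau>' * nu_p P i)\<bar>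
       \<le> sqrt F * \<bar>alpha P i \<tau> - alpha P i \<tau>'\<bar>"
proof -
  let ?a = "alpha P i \<tau>" and ?b = "alpha P i \<tau>'"
  let ?x = "nu_f P i + ?a * nu_p P i" and ?y = "nu_f P i + ?b * nu_p P i"
  have f: "nu_f P i > 0" and p: "nu_p P i > 0" using pos[OF i] by auto
  have x: "nu_f P i \<le> ?x" "nu_f P i \<le> ?y" using alpha_bounds(1)[OF i] p by simp_all
  have sx: "sqrt (nu_f P i) \<le> sqrt ?x + sqrt ?y"
    using x f by (intro add_increasing2) auto
  have "sqrt ?x * sqrt ?x = ?x" "sqrt ?y * sqrt ?y = ?y" using x f by simp_all
  then have "(sqrt ?x - sqrt ?y) * (sqrt ?x + sqrt ?y) = ?x - ?y"
  proof -
    have "(a - b) * (a + b) = a * a - b * b" for a b :: real by (simp add: algebra_simps)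
    then show ?thesis
      using \<open>sqrt ?x * sqrt ?x = ?x\<close> \<open>sqrt ?y * sqrt ?y = ?y\<close> by (simp only:)
  qed
  then have "\<bar>sqrt ?x - sqrt ?y\<bar> * \<bar>sqrt ?x + sqrt ?y\<bar> = \<bar>?x - ?y\<bar>"
    by (simp only: abs_mult[symmetric])
  also have "?x - ?y = nu_p P i * (?a - ?b)" by (simp add: algebra_simps)
  also have "\<bar>\<dots>\<bar> = nu_p P i * \<bar>?a - ?b\<bar>" using p by (simp add: abs_mult)
  also have "\<dots> \<le> nu_f P i * \<bar>?a - ?b\<bar>" using ratio[OF i] by (intro mult_right_mono) auto
  finally have *: "\<bar>sqrt ?x - sqrt ?y\<bar> * \<bar>sqrt ?x + sqrt ?y\<bar> \<le> nu_f P i * \<bar>?a - ?b\<bar>" .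
  have "\<bar>sqrt ?x - sqrt ?y\<bar> * sqrt (nu_f P i) \<le> \<bar>sqrt ?x - sqrt ?y\<bar> * \<bar>sqrt ?x + sqrt ?y\<bar>"
    using sx by (intro mult_left_mono) auto
  also note *
  also have "nu_f P i * \<bar>?a - ?b\<bar> = (sqrt (nu_f P i) * \<bar>?a - ?b\<bar>) * sqrt (nu_f P i)"
    using f by simp
  finally have "\<bar>sqrt ?x - sqrt ?y\<bar> \<le> sqrt (nu_f P i) * \<bar>?a - ?b\<bar>"
    using f by (simp add: mult.commute)
  also have "\<dots> \<le> sqrt F * \<bar>?a - ?b\<bar>" using F[OF i] by (intro mult_right_mono) auto
  finally show ?thesis .
qed

section \<open>A pointwise bound for the regret\<close>

lemma predictor_diff:
  assumes i: "i \<ge> 1"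
  shows "\<bar>predictor P \<eta> \<tau> x i - predictor P \<eta>' \<tau>' x i\<bar>
     \<le> c\<alpha> * \<bar>tcoord \<tau> - tcoord \<tau>'\<bar> * (\<bar>x i\<bar> + \<bar>\<eta>\<bar> + sqrt F * Q) + \<bar>\<eta> - \<eta>'\<bar>"
proof -
  let ?a = "alpha P i \<tau>" and ?b = "alpha P i \<tau>'" and ?q = "inv Phi (btilde P i)"
  let ?u = "sqrt (nu_f P i + ?a * nu_p P i)" and ?v = "sqrt (nu_f P i + ?b * nu_p P i)"
  have "predictor P \<eta> \<tau> x i - predictor P \<eta>' \<tau>' x i = (?a - ?b) * (x i - \<eta>) + (1 - ?b) * (\<eta> - \<eta>') + (?u - ?v) * ?q"
    by (simp add: predictor_def algebra_simps)
  also have "\<bar>\<dots>\<bar> \<le> \<bar>?a - ?b\<bar> * (\<bar>x i\<bar> + \<bar>\<eta>\<bar>) + 1 * \<bar>\<eta> - \<eta>'\<bar> + (sqrt F * \<bar>?a - ?b\<bar>) * Q"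
  proof (intro order_trans[OF abs_triangle_ineq] add_mono)
    show "\<bar>(?a - ?b) * (x i - \<eta>)\<bar> \<le> \<bar>?a - ?b\<bar> * (\<bar>x i\<bar> + \<bar>\<eta>\<bar>)"
      unfolding abs_mult by (intro mult_left_mono) auto
    show "\<bar>(1 - ?b) * (\<eta> - \<eta>')\<bar> \<le> 1 * \<bar>\<eta> - \<eta>'\<bar>"
      unfolding abs_mult using alpha_bounds[OF i, of \<tau>'] by (intro mult_right_mono) auto
    show "\<bar>(?u - ?v) * ?q\<bar> \<le> (sqrt F * \<bar>?a - ?b\<bar>) * Q"
      unfolding abs_mult[of "?u - ?v"] using Q[OF i] F_pos by (intro mult_mono sqrt_lipschitz[OF i]) auto
  qed
  also have "\<dots> = \<bar>?a - ?b\<bar> * (\<bar>x i\<bar> + \<bar>\<eta>\<bar> + sqrt F * Q) + \<bar>\<eta> - \<eta>'\<bar>"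
    by (simp add: algebra_simps)
  also have "\<dots> \<le> c\<alpha> * \<bar>tcoord \<tau> - tcoord \<tau>'\<bar> * (\<bar>x i\<bar> + \<bar>\<eta>\<bar> + sqrt F * Q) + \<bar>\<eta> - \<eta>'\<bar>"
    using Q_nonneg F_pos by (intro add_right_mono mult_right_mono alpha_lipschitz[OF i]) auto
  finally show ?thesis .
qed

lemma sum_avg: "n \<ge> 1 \<Longrightarrow> (\<Sum>i=1..n. a * \<bar>x i\<bar> + b) / real n = a * avg n x + b"
  by (simp add: avg_def sum.distrib sum_distrib_left[symmetric] add_divide_distrib)

lemma loss_diff:
  assumes n: "n \<ge> 1"
  shows "loss P n \<theta> (predictor P \<eta> \<tau> x) - loss P n \<theta> (predictor P \<eta>' \<tau>' x)
     \<le> B * (c\<alpha> * \<bar>tcoord \<tau> - tcoord \<tau>'\<bar> * (avg n x + \<bar>\<eta>\<bar> + sqrt F * Q) + \<bar>\<eta> - \<eta>'\<bar>)"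
proof -
  let ?c = "c\<alpha> * \<bar>tcoord \<tau> - tcoord \<tau>'\<bar>"
  have "loss P n \<theta> (predictor P \<eta> \<tau> x) - loss P n \<theta> (predictor P \<eta>' \<tau>' x)
     = (\<Sum>i=1..n. coord_loss P i (\<theta> i) (predictor P \<eta> \<tau> x i) - coord_loss P i (\<theta> i) (predictor P \<eta>' \<tau>' x i)) / real n"
    by (simp add: loss_def diff_divide_distrib sum_subtractf)
  also have "\<dots> \<le> (\<Sum>i=1..n. B * ?c * \<bar>x i\<bar> + B * (?c * (\<bar>\<eta>\<bar> + sqrt F * Q) + \<bar>\<eta> - \<eta>'\<bar>)) / real n"
  proof (intro divide_right_mono sum_mono)
    fix i assume "i \<in> {1..n}"
    then have i: "i \<ge> 1" by simp
    have "coord_loss P i (\<theta> i) (predictor P \<eta> \<tau> x i) - coord_loss P i (\<theta> i) (predictor P \<eta>' \<tau>' x i)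
       \<le> B * \<bar>predictor P \<eta> \<tau> x i - predictor P \<eta>' \<tau>' x i\<bar>"
      using coord_loss_lipschitz[OF i, of "\<theta> i" "predictor P \<eta> \<tau> x i" "predictor P \<eta>' \<tau>' x i"] by linarith
    also have "\<dots> \<le> B * (?c * (\<bar>x i\<bar> + \<bar>\<eta>\<bar> + sqrt F * Q) + \<bar>\<eta> - \<eta>'\<bar>)"
      using B_pos by (intro mult_left_mono predictor_diff[OF i]) auto
    also have "\<dots> = B * ?c * \<bar>x i\<bar> + B * (?c * (\<bar>\<eta>\<bar> + sqrt F * Q) + \<bar>\<eta> - \<eta>'\<bar>)"
      by (simp add: algebra_simps)
    finally show "coord_loss P i (\<theta> i) (predictor P \<eta> \<tau> x i) - coord_loss P i (\<theta> i) (predictor P \<eta>' \<tau>' x i)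
       \<le> B * ?c * \<bar>x i\<bar> + B * (?c * (\<bar>\<eta>\<bar> + sqrt F * Q) + \<bar>\<eta> - \<eta>'\<bar>)" .
  qed simp
  also have "\<dots> = B * (?c * (avg n x + \<bar>\<eta>\<bar> + sqrt F * Q) + \<bar>\<eta> - \<eta>'\<bar>)"
    unfolding sum_avg[OF n] by (simp add: algebra_simps)
  finally show ?thesis .
qed

definition "c0 = sqrt F + sqrt (2 * F) * Q"

lemma c0_nonneg: "c0 \<ge> 0" using F_pos Q_nonneg by (simp add: c0_def)

text \<open>Comparison with the prediction q = \<theta>, whose loss is at most B * sqrt F, by the
  Lipschitz property of the coordinate losses.\<close>

lemma loss_le:
  assumes n: "n \<ge> 1"
  shows "loss P n \<theta> (predictor P \<eta> \<tau> x) \<le> B * (c0 + avg n x + avg n \<theta> + \<bar>\<eta>\<bar>)"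
proof -
  have "loss P n \<theta> (predictor P \<eta> \<tau> x)
      \<le> (\<Sum>i=1..n. (B * \<bar>x i\<bar> + B * (c0 + \<bar>\<eta>\<bar>)) + (B * \<bar>\<theta> i\<bar> + 0)) / real n"
    unfolding loss_def
  proof (intro divide_right_mono sum_mono)
    fix i assume "i \<in> {1..n}"
    then have i: "i \<ge> 1" by simp
    let ?a = "alpha P i \<tau>" and ?q = "inv Phi (btilde P i)"
    let ?u = "sqrt (nu_f P i + ?a * nu_p P i)"
    have a: "0 \<le> ?a" "?a \<le> 1" using alpha_bounds[OF i] .
    have "?a * nu_p P i \<le> 1 * nu_p P i" using a pos[OF i] by (intro mult_right_mono) auto
    then have u: "?u \<le> sqrt (2 * F)" using ratio[OF i] F[OF i] by simp
    have "\<bar>predictor P \<eta> \<tau> x i - \<theta> i\<bar> \<le> \<bar>?a * x i\<bar> + \<bar>(1 - ?a) * \<eta>\<bar> + \<bar>?u * ?q\<bar> + \<bar>\<theta> i\<bar>"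
      unfolding predictor_def by linarith
    also have "\<dots> \<le> 1 * \<bar>x i\<bar> + 1 * \<bar>\<eta>\<bar> + sqrt (2 * F) * Q + \<bar>\<theta> i\<bar>"
      unfolding abs_mult using a u Q[OF i] F_pos pos[OF i]
      by (intro add_mono mult_mono mult_right_mono order_refl) auto
    finally have d: "\<bar>predictor P \<eta> \<tau> x i - \<theta> i\<bar> \<le> \<bar>x i\<bar> + \<bar>\<eta>\<bar> + sqrt (2 * F) * Q + \<bar>\<theta> i\<bar>" by simp
    have "coord_loss P i (\<theta> i) (predictor P \<eta> \<tau> x i)
        \<le> coord_loss P i (\<theta> i) (\<theta> i) + B * \<bar>predictor P \<eta> \<tau> x i - \<theta> i\<bar>"
      using coord_loss_lipschitz[OF i, of "\<theta> i" "predictor P \<eta> \<tau> x i" "\<theta> i"] by linarith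
    also have "\<dots> \<le> B * sqrt F + B * (\<bar>x i\<bar> + \<bar>\<eta>\<bar> + sqrt (2 * F) * Q + \<bar>\<theta> i\<bar>)"
      using d B_pos by (intro add_mono mult_left_mono coord_loss_self[OF i]) auto
    also have "\<dots> = (B * \<bar>x i\<bar> + B * (c0 + \<bar>\<eta>\<bar>)) + (B * \<bar>\<theta> i\<bar> + 0)"
      by (simp add: c0_def algebra_simps)
    finally show "coord_loss P i (\<theta> i) (predictor P \<eta> \<tau> x i) \<le> (B * \<bar>x i\<bar> + B * (c0 + \<bar>\<eta>\<bar>)) + (B * \<bar>\<theta> i\<bar> + 0)" .
  qed simp
  also have "\<dots> = (B * avg n x + B * (c0 + \<bar>\<eta>\<bar>)) + (B * avg n \<theta> + 0)"
    unfolding sum.distrib[of "\<lambda>i. B * \<bar>x i\<bar> + B * (c0 + \<bar>\<eta>\<bar>)"] add_divide_distrib sum_avg[OF n] ..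
  also have "\<dots> = B * (c0 + avg n x + avg n \<theta> + \<bar>\<eta>\<bar>)" by (simp add: algebra_simps)
  finally show ?thesis .
qed

lemma loss_nonneg: "loss P n \<theta> q \<ge> 0"
  unfolding loss_def by (intro divide_nonneg_nonneg sum_nonneg coord_loss_nonneg) auto

text \<open>The two constants come from the two cases of the comparison: either all of \<open>M_hat\<close> lies in
  the range of the grid, or \<open>avg n x\<close> exceeds a multiple of \<open>a_seq n\<close>.\<close>

definition "K1 k1 k2 = B * (c\<alpha> * k2 * (2 + sqrt F * Q) + 2 * k1)"
definition "K2 \<Theta>0 = B * (c0 + 1 + \<Theta>0 + \<kappa>) * \<kappa>"

text \<open>When the range covers \<open>M_hat\<close>, the chosen pair is compared with a grid
  candidate near the competitor: passing from the loss to its estimate and back costs the error at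
  two grid points, and the Lipschitz bound covers the rest. Otherwise \<open>a\<close> is below
  \<kappa> * avg n x, and the whole loss of the chosen pair, linear in the average, is an acceptable
  error.\<close>

lemma regret_bound:
  fixes C1 C2 C3 C4 \<Theta>0 k1 k2 :: real and s :: real and n :: nat and x :: "nat \<Rightarrow> real"
  defines "a \<equiv> a_seq n"
  defines "L \<equiv> grid1 C1 s n" and "\<Lambda> \<equiv> grid2 C1 C2 C3 C4 n"
  assumes n: "n \<ge> 1" and a: "a \<ge> 1" and \<Theta>: "avg n \<theta> \<le> \<Theta>0"
    and C1: "C1 > 0" "1 / (2 * C1 * a) \<le> 2 * a" "1 / (2 * C1 * a) \<le> k1 / a"
    and d2: "delta2 C1 C2 C3 C4 n > 0" "delta2 C1 C2 C3 C4 n \<le> k2 / a\<^sup>2"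
    and D: "is_arg_min (\<lambda>(\<eta>, \<tau>). ARE_D P \<gamma> n x \<eta> \<tau>)
        (\<lambda>p. p \<in> eta_candidates L (M_hat P n x) \<times> \<Lambda>) (\<eta>D, \<tau>D)"
    and h: "\<eta>h \<in> M_hat P n x"
  shows "loss P n \<theta> (predictor P \<eta>D (ennreal \<tau>D) x) - loss P n \<theta> (predictor P \<eta>h \<tau>h x)
     \<le> 2 * (\<Sum>p\<in>L \<times> \<Lambda>. \<bar>loss P n \<theta> (predictor P (fst p) (ennreal (snd p)) x) - ARE_D P \<gamma> n x (fst p) (snd p)\<bar>)
       + (K1 k1 k2 + K2 \<Theta>0) * (1 + avg n x)\<^sup>2 / a"
proof -
  let ?l = "\<lambda>\<eta> \<tau>. loss P n \<theta> (predictor P \<eta> \<tau> x)"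
  define S where "S = (\<Sum>p\<in>L \<times> \<Lambda>. \<bar>?l (fst p) (ennreal (snd p)) - ARE_D P \<gamma> n x (fst p) (snd p)\<bar>)"
  have \<delta>: "1 / (2 * C1 * a) > 0" using C1 a by simp
  have fin: "finite (L \<times> \<Lambda>)"
    unfolding L_def \<Lambda>_def grid1_eq using \<delta> a
    by (intro finite_cartesian_product finite_card_lattice finite_card_grid2) (auto simp: a_def)
  have ptS: "\<bar>?l \<eta> (ennreal \<tau>) - ARE_D P \<gamma> n x \<eta> \<tau>\<bar> \<le> S" if "\<eta> \<in> L" "\<tau> \<in> \<Lambda>" for \<eta> \<tau>
  proof -
    have "(\<Sum>p\<in>{(\<eta>, \<tau>)}. \<bar>?l (fst p) (ennreal (snd p)) - ARE_D P \<gamma> n x (fst p) (snd p)\<bar>) \<le> S"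
      unfolding S_def using that fin by (intro sum_mono2) auto
    then show ?thesis by simp
  qed
  have S0: "S \<ge> 0" unfolding S_def by (intro sum_nonneg) simp
  have Dm: "\<eta>D \<in> eta_candidates L (M_hat P n x)" "\<tau>D \<in> \<Lambda>" "\<eta>D \<in> L"
    and Dmin: "\<And>\<eta> \<tau>. \<eta> \<in> eta_candidates L (M_hat P n x) \<Longrightarrow> \<tau> \<in> \<Lambda> \<Longrightarrow> ARE_D P \<gamma> n x \<eta>D \<tau>D \<le> ARE_D P \<gamma> n x \<eta> \<tau>"
    using D eta_candidates_subset[of L "M_hat P n x"] by (auto simp: is_arg_min_def not_less)
  have av: "avg n x \<ge> 0" by (rule avg_nonneg)
  have \<Theta>0: "\<Theta>0 \<ge> 0" using \<Theta> avg_nonneg[of n \<theta>] by linarith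
  have k2: "k2 \<ge> 0"
  proof -
    have "0 < k2 / a\<^sup>2" using d2 by linarith
    then show ?thesis using a by (simp add: zero_less_divide_iff)
  qed
  have k1: "k1 \<ge> 0"
  proof -
    have "0 < k1 / a" using \<delta> C1 by linarith
    then show ?thesis using a by (simp add: zero_less_divide_iff)
  qed
  have K: "K1 k1 k2 \<ge> 0" "K2 \<Theta>0 \<ge> 0"
    using B_pos c\<alpha>_nonneg k1 k2 F_pos Q_nonneg c0_nonneg \<Theta>0 \<kappa>_pos by (simp_all add: K1_def K2_def)
  have sq: "1 + avg n x \<le> (1 + avg n x)\<^sup>2"
    using av by (simp add: power2_eq_square algebra_simps)
  have "?l \<eta>D (ennreal \<tau>D) - ?l \<eta>h \<tau>h \<le> 2 * S + (K1 k1 k2 + K2 \<Theta>0) * (1 + avg n x)\<^sup>2 / a"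
  proof (cases "\<kappa> * avg n x \<le> a")
    case True
    have Msub: "M_hat P n x \<subseteq> {- a .. a}" using M_hat_bound(2)[OF n h] True by auto
    obtain m1 m2 where M: "M_hat P n x = {m1..m2}" by (rule that[OF M_hat_def])
    have "\<exists>\<eta>'\<in>eta_candidates L {m1..m2}. \<bar>\<eta>h - \<eta>'\<bar> \<le> 2 * (1 / (2 * C1 * a))"
      unfolding L_def grid1_eq a_def[symmetric]
      using Msub h unfolding M by (intro eta_candidates_dense \<delta> C1(2)) auto
    then obtain \<eta>' where \<eta>': "\<eta>' \<in> eta_candidates L (M_hat P n x)" "\<bar>\<eta>h - \<eta>'\<bar> \<le> 2 * (1 / (2 * C1 * a))"
      unfolding M by blast
    obtain \<tau>' where \<tau>': "\<tau>' \<in> \<Lambda>" "\<bar>tcoord \<tau>h - tcoord (ennreal \<tau>')\<bar> \<le> delta2 C1 C2 C3 C4 n"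
      using grid2_dense[OF d2(1) tcoord_bounds[of \<tau>h]] unfolding \<Lambda>_def by blast
    have \<eta>'L: "\<eta>' \<in> L" using \<eta>'(1) eta_candidates_subset by blast
    then have \<eta>'a: "\<bar>\<eta>'\<bar> \<le> a" by (auto simp: L_def grid1_def a_def)
    have "?l \<eta>D (ennreal \<tau>D) \<le> ?l \<eta>' (ennreal \<tau>') + 2 * S"
      using ptS[OF Dm(3,2)] ptS[OF \<eta>'L \<tau>'(1)] Dmin[OF \<eta>'(1) \<tau>'(1)] by linarith
    moreover have "?l \<eta>' (ennreal \<tau>') - ?l \<eta>h \<tau>h \<le> K1 k1 k2 * (1 + avg n x) / a"
    proof -
      have "?l \<eta>' (ennreal \<tau>') - ?l \<eta>h \<tau>h
          \<le> B * (c\<alpha> * \<bar>tcoord (ennreal \<tau>') - tcoord \<tau>h\<bar> * (avg n x + \<bar>\<eta>'\<bar> + sqrt F * Q) + \<bar>\<eta>' - \<eta>h\<bar>)"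
        by (rule loss_diff[OF n])
      \<comment> \<open>The bracket can be as large as a multiple of a, because \<eta>' ranges over
        [-a, a]. The spacing of order 1 / a^2 in the second grid still leaves 1 / a.\<close>
      also have "\<dots> \<le> B * (c\<alpha> * (k2 / a\<^sup>2) * (((1 + avg n x) * (2 + sqrt F * Q)) * a) + 2 * (k1 / a) * (1 + avg n x))"
      proof (intro mult_left_mono add_mono mult_mono)
        show "\<bar>tcoord (ennreal \<tau>') - tcoord \<tau>h\<bar> \<le> k2 / a\<^sup>2"
          using \<tau>'(2) d2(2) by (simp add: abs_minus_commute)
        have f: "0 \<le> sqrt F * Q" using F_pos Q_nonneg by simp
        have "avg n x + \<bar>\<eta>'\<bar> + sqrt F * Q \<le> avg n x * a + a + sqrt F * Q * a"
          using \<eta>'a mult_left_mono[OF a av] mult_left_mono[OF a f] by linarith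
        also have "\<dots> = (avg n x + 1 + sqrt F * Q) * a" by (simp add: algebra_simps)
        also have "\<dots> \<le> ((1 + avg n x) * (2 + sqrt F * Q)) * a"
          using a av f mult_nonneg_nonneg[OF av f] by (intro mult_right_mono) (auto simp: algebra_simps)
        finally show "avg n x + \<bar>\<eta>'\<bar> + sqrt F * Q \<le> ((1 + avg n x) * (2 + sqrt F * Q)) * a" .
        have "\<bar>\<eta>' - \<eta>h\<bar> \<le> 2 * (k1 / a)" using \<eta>'(2) C1(3) by linarith
        also have "\<dots> \<le> 2 * (k1 / a) * (1 + avg n x)"
          using k1 a av by (simp add: mult_left_mono distrib_left)
        finally show "\<bar>\<eta>' - \<eta>h\<bar> \<le> 2 * (k1 / a) * (1 + avg n x)" .
      qed (use B_pos c\<alpha>_nonneg k2 a av F_pos Q_nonneg in auto)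
      also have "\<dots> = K1 k1 k2 * (1 + avg n x) / a"
        using a by (simp add: K1_def power2_eq_square field_simps)
      finally show ?thesis .
    qed
    moreover have "K1 k1 k2 * (1 + avg n x) / a \<le> (K1 k1 k2 + K2 \<Theta>0) * (1 + avg n x)\<^sup>2 / a"
      using K sq a av by (intro divide_right_mono mult_mono) auto
    ultimately show ?thesis by linarith
  next
    case False
    have \<eta>a: "\<bar>\<eta>D\<bar> \<le> \<kappa> * avg n x" using Dm(3) False by (auto simp: L_def grid1_def a_def)
    have "?l \<eta>D (ennreal \<tau>D) \<le> B * (c0 + avg n x + avg n \<theta> + \<bar>\<eta>D\<bar>)" by (rule loss_le[OF n])
    also have "\<dots> \<le> B * (c0 + avg n x + \<Theta>0 + \<kappa> * avg n x)"
      using B_pos \<Theta> \<eta>a by (intro mult_left_mono add_mono) auto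
    also have "\<dots> \<le> B * ((c0 + 1 + \<Theta>0 + \<kappa>) * (1 + avg n x))"
      using B_pos c0_nonneg \<Theta>0 av \<kappa>_pos by (intro mult_left_mono) (auto simp: algebra_simps)
    also have "\<dots> = B * ((c0 + 1 + \<Theta>0 + \<kappa>) * (1 + avg n x)) * 1" by simp
    \<comment> \<open>In this case the inserted factor is at least 1. It trades linear growth in the
      average for quadratic growth with a gain of 1 / a.\<close>
    also have "\<dots> \<le> B * ((c0 + 1 + \<Theta>0 + \<kappa>) * (1 + avg n x)) * (\<kappa> * (1 + avg n x) / a)"
    proof (rule mult_left_mono)
      have "a \<le> \<kappa> * (1 + avg n x)" using False \<kappa>_pos by (simp add: distrib_left)
      then show "1 \<le> \<kappa> * (1 + avg n x) / a" using a by simp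
    qed (use B_pos c0_nonneg \<Theta>0 av \<kappa>_pos in auto)
    also have "\<dots> = K2 \<Theta>0 * (1 + avg n x)\<^sup>2 / a"
      by (simp add: K2_def power2_eq_square)
    also have "\<dots> \<le> (K1 k1 k2 + K2 \<Theta>0) * (1 + avg n x)\<^sup>2 / a"
      using K a by (intro divide_right_mono mult_right_mono) auto
    finally show ?thesis using loss_nonneg[of n \<theta> "predictor P \<eta>h \<tau>h x"] S0 by linarith
  qed
  then show ?thesis by (simp only: S_def)
qed

section \<open>Integrability of the average and of the losses\<close>

lemma avg_integrable:
  assumes n: "n \<ge> 1" and \<Theta>: "avg n \<theta> \<le> \<Theta>0"
  shows "integrable (X_law P n \<theta>) (avg n)" "integrable (X_law P n \<theta>) (\<lambda>x. (1 + avg n x)\<^sup>2)"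
    "(\<integral>x. (1 + avg n x)\<^sup>2 \<partial>X_law P n \<theta>) \<le> 2 * (1 + \<Theta>0)\<^sup>2 + 2 * F" (is ?g1)
proof -
  interpret prob_space "X_law P n \<theta>" by (rule prob_space_X_law)
  let ?M = "\<lambda>i. density lborel (normal_density (\<theta> i) (sqrt (nu_p P i)))"
  have [measurable]: "avg n \<in> borel_measurable (X_law P n \<theta>)"
    unfolding avg_def[abs_def] by measurable
  define W where "W x = (\<Sum>i\<in>{1..n}. (x i - \<theta> i)\<^sup>2) / real n" for x
  have sq: "integrable (?M i) (\<lambda>x. (x - \<theta> i)\<^sup>2)" "(\<integral>x. (x - \<theta> i)\<^sup>2 \<partial>?M i) = nu_p P i" if "i \<in> {1..n}" for i
  proof -
    have \<sigma>: "sqrt (nu_p P i) > 0" "nu_p P i > 0" using that pos(1)[of i] by auto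
    have m: "(\<lambda>x. (x - \<theta> i)\<^sup>2) \<in> borel_measurable borel" by measurable
    show "integrable (?M i) (\<lambda>x. (x - \<theta> i)\<^sup>2)"
      unfolding normal_law_integral(1)[OF \<sigma>(1) m] by (simp add: power_mult_distrib)
    show "(\<integral>x. (x - \<theta> i)\<^sup>2 \<partial>?M i) = nu_p P i"
      unfolding normal_law_integral(2)[OF \<sigma>(1) m] using \<sigma>(2) by (simp add: power_mult_distrib)
  qed
  have comp: "integrable (X_law P n \<theta>) (\<lambda>x. (x i - \<theta> i)\<^sup>2)"
    "(\<integral>x. (x i - \<theta> i)\<^sup>2 \<partial>X_law P n \<theta>) = nu_p P i" if i: "i \<in> {1..n}" for i
    using PiM_component_integral[where M="?M" and I="{1..n}" and f="\<lambda>x. (x - \<theta> i)\<^sup>2", OF _ i sq(1)[OF i]]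
      prob_space_coord sq(2)[OF i]
    unfolding X_law_def by auto
  have intW: "integrable (X_law P n \<theta>) W"
    unfolding W_def[abs_def] by (intro integrable_divide Bochner_Integration.integrable_sum comp)
  have "(\<integral>x. W x \<partial>X_law P n \<theta>) = (\<Sum>i\<in>{1..n}. nu_p P i) / real n"
    unfolding W_def using comp by simp
  also have "\<dots> \<le> (\<Sum>i\<in>{1..n}. F) / real n"
    using ratio F by (intro divide_right_mono sum_mono) (auto intro: order_trans)
  also have "\<dots> = F" using n by simp
  finally have EW: "(\<integral>x. W x \<partial>X_law P n \<theta>) \<le> F" .
  \<comment> \<open>Only the average of the \<bar>\<theta> i\<bar> enters, not their squares:
    Cauchy-Schwarz is applied to the deviations x i - \<theta> i alone.\<close>
  have le: "(1 + avg n x)\<^sup>2 \<le> 2 * (1 + \<Theta>0)\<^sup>2 + 2 * W x" for x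
  proof -
    define w where "w = avg n (\<lambda>i. x i - \<theta> i)"
    have "avg n x \<le> avg n \<theta> + w"
      unfolding w_def avg_def add_divide_distrib[symmetric] sum.distrib[symmetric]
      by (intro divide_right_mono sum_mono) auto
    then have "1 + avg n x \<le> (1 + \<Theta>0) + w" using \<Theta> by linarith
    then have "(1 + avg n x)\<^sup>2 \<le> ((1 + \<Theta>0) + w)\<^sup>2"
      using avg_nonneg[of n x] by (intro power_mono) auto
    also have "\<dots> \<le> 2 * (1 + \<Theta>0)\<^sup>2 + 2 * w\<^sup>2" by (rule power2_sum_le)
    also have "w\<^sup>2 \<le> W x"
    proof -
      have "w\<^sup>2 = (\<Sum>i\<in>{1..n}. \<bar>x i - \<theta> i\<bar>)\<^sup>2 / (real n)\<^sup>2" by (simp add: w_def avg_def power_divide)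
      also have "\<dots> \<le> ((\<Sum>i\<in>{1..n}. \<bar>x i - \<theta> i\<bar>\<^sup>2) * real (card {1..n})) / (real n)\<^sup>2"
        by (intro divide_right_mono sum_squared_le_sum_of_squares) simp
      also have "\<dots> = W x" using n by (simp add: W_def power2_eq_square)
      finally show ?thesis .
    qed
    finally show ?thesis by simp
  qed
  have intR: "integrable (X_law P n \<theta>) (\<lambda>x. 2 * (1 + \<Theta>0)\<^sup>2 + 2 * W x)" using intW by simp
  show int2: "integrable (X_law P n \<theta>) (\<lambda>x. (1 + avg n x)\<^sup>2)"
    by (rule Bochner_Integration.integrable_bound[OF intR])
       (auto intro!: always_eventually order_trans[OF le])
  show "integrable (X_law P n \<theta>) (avg n)"
  proof (rule Bochner_Integration.integrable_bound[OF int2])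
    have "avg n x \<le> (1 + avg n x)\<^sup>2" for x
      using avg_nonneg[of n x] zero_le_power2[of "avg n x"] unfolding power2_sum by (simp; linarith)
    then show "AE x in X_law P n \<theta>. norm (avg n x) \<le> norm ((1 + avg n x)\<^sup>2)"
      using avg_nonneg by (intro always_eventually) simp
  qed measurable
  have "(\<integral>x. (1 + avg n x)\<^sup>2 \<partial>X_law P n \<theta>) \<le> (\<integral>x. 2 * (1 + \<Theta>0)\<^sup>2 + 2 * W x \<partial>X_law P n \<theta>)"
    by (rule integral_mono[OF int2 intR le])
  also have "\<dots> \<le> 2 * (1 + \<Theta>0)\<^sup>2 + 2 * F" using EW intW by (simp add: prob_space)
  finally show ?g1 .
qed

lemma borel_measurable_alpha [measurable]: "alpha P i \<in> borel_measurable borel"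
  unfolding alpha_def[abs_def] by measurable

lemma loss_measurable:
  assumes [measurable]: "\<eta> \<in> borel_measurable (sample_space n)" "\<tau> \<in> borel_measurable (sample_space n)"
  shows "(\<lambda>x. loss P n \<theta> (predictor P (\<eta> x) (\<tau> x) x)) \<in> borel_measurable (X_law P n \<theta>)"
proof -
  have m: "(\<lambda>x. coord_loss P i (\<theta> i) (predictor P (\<eta> x) (\<tau> x) x i)) \<in> borel_measurable (sample_space n)"
    if "i \<in> {1..n}" for i
    using that unfolding predictor_def by measurable
  have "(\<lambda>x. loss P n \<theta> (predictor P (\<eta> x) (\<tau> x) x)) \<in> borel_measurable (sample_space n)"
    unfolding loss_def by (intro borel_measurable_divide borel_measurable_sum m borel_measurable_const)
  then show ?thesis by (simp cong: measurable_cong_sets add: sets_X_law)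
qed

lemma loss_integrable:
  assumes n: "n \<ge> 1" and m: "\<eta> \<in> borel_measurable (sample_space n)" "\<tau> \<in> borel_measurable (sample_space n)"
    and \<eta>: "\<And>x. x \<in> space (sample_space n) \<Longrightarrow> \<bar>\<eta> x\<bar> \<le> c + k * avg n x" and c: "c \<ge> 0" "k \<ge> 0"
  shows "integrable (X_law P n \<theta>) (\<lambda>x. loss P n \<theta> (predictor P (\<eta> x) (\<tau> x) x))"
proof (rule Bochner_Integration.integrable_bound)
  interpret prob_space "X_law P n \<theta>" by (rule prob_space_X_law)
  show "integrable (X_law P n \<theta>) (\<lambda>x. B * (c0 + avg n x + avg n \<theta> + (c + k * avg n x)))"
    using avg_integrable(1)[OF n order_refl] by simp
  show "(\<lambda>x. loss P n \<theta> (predictor P (\<eta> x) (\<tau> x) x)) \<in> borel_measurable (X_law P n \<theta>)"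
    by (rule loss_measurable[OF m])
  show "AE x in X_law P n \<theta>. norm (loss P n \<theta> (predictor P (\<eta> x) (\<tau> x) x))
     \<le> norm (B * (c0 + avg n x + avg n \<theta> + (c + k * avg n x)))"
  proof (rule AE_I2)
    fix x assume "x \<in> space (X_law P n \<theta>)"
    then have e: "\<bar>\<eta> x\<bar> \<le> c + k * avg n x" by (intro \<eta>) (simp add: space_X_law)
    have "loss P n \<theta> (predictor P (\<eta> x) (\<tau> x) x) \<le> B * (c0 + avg n x + avg n \<theta> + \<bar>\<eta> x\<bar>)"
      by (rule loss_le[OF n])
    also have "\<dots> \<le> B * (c0 + avg n x + avg n \<theta> + (c + k * avg n x))"
      using e B_pos by (intro mult_left_mono add_left_mono) auto
    finally show "norm (loss P n \<theta> (predictor P (\<eta> x) (\<tau> x) x))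
        \<le> norm (B * (c0 + avg n x + avg n \<theta> + (c + k * avg n x)))"
      using loss_nonneg[of n \<theta>] by simp
  qed
qed

end

section \<open>Asymptotics\<close>

lemma INF_ereal_pos_bound:
  fixes f :: "nat \<Rightarrow> real"
  assumes "0 < (INF i\<in>{1..}. ereal (f i))"
  shows "\<exists>c>0. \<forall>i\<ge>1. c \<le> f i"
proof -
  obtain c where c: "0 < ereal c" "ereal c < (INF i\<in>{1..}. ereal (f i))"
    using ereal_dense2[OF assms] by auto
  have "c \<le> f i" if "i \<ge> 1" for i
  proof -
    have "ereal c < ereal (f i)"
      by (rule less_le_trans[OF c(2) INF_lower]) (use that in simp)
    then show ?thesis by simp
  qed
  then show ?thesis using c(1) by auto
qed

lemma SUP_ereal_less_bound:
  fixes f :: "nat \<Rightarrow> real"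
  assumes "(SUP i\<in>{1..}. ereal (f i)) < u"
  shows "\<exists>c. ereal c < u \<and> (\<forall>i\<ge>1. f i \<le> c)"
proof -
  obtain c where c: "(SUP i\<in>{1..}. ereal (f i)) < ereal c" "ereal c < u"
    using ereal_dense2[OF assms] by auto
  have "f i \<le> c" if "i \<ge> 1" for i
  proof -
    have "ereal (f i) < ereal c"
      by (rule le_less_trans[OF SUP_upper c(1)]) (use that in simp)
    then show ?thesis by simp
  qed
  then show ?thesis using c(2) by auto
qed

text \<open>\<open>inv\<close> is an inverse by choice. The intermediate value theorem shows that
  \<beta> has a preimage, so \<open>inv Phi \<beta>\<close> is one, and monotonicity confines it
  between two fixed quantiles.\<close>

lemma inv_Phi_bounded:
  assumes "0 < blo" "bhi < 1"
  shows "\<exists>Q. \<forall>\<beta>. blo \<le> \<beta> \<and> \<beta> \<le> bhi \<longrightarrow> \<bar>inv Phi \<beta>\<bar> \<le> Q"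
proof -
  interpret real_distribution \<N> by (rule real_dist_normal_dist)
  have Phi: "Phi = cdf \<N>" by (simp add: fun_eq_iff Phi_def)
  have "(Phi \<longlongrightarrow> 0) at_bot" "(Phi \<longlongrightarrow> 1) at_top"
    unfolding Phi by (rule cdf_lim_at_bot, rule cdf_lim_at_top_prob)
  then have "\<forall>\<^sub>F w in at_bot. Phi w < blo" "\<forall>\<^sub>F w in at_top. bhi < Phi w"
    using assms by (auto intro: order_tendstoD)
  then obtain l h where l: "Phi l < blo" and h: "bhi < Phi h"
    by (meson eventually_at_bot_linorder eventually_at_top_linorder order_refl)
  have mono: "u \<le> v \<Longrightarrow> Phi u \<le> Phi v" for u v
    unfolding Phi by (rule cdf_nondecreasing)
  have "\<bar>inv Phi \<beta>\<bar> \<le> \<bar>l\<bar> + \<bar>h\<bar>" if \<beta>: "blo \<le> \<beta>" "\<beta> \<le> bhi" for \<beta>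
  proof -
    have lh: "l \<le> h" using mono[of h l] l h \<beta> by linarith
    have "\<exists>y\<ge>l. y \<le> h \<and> Phi y = \<beta>"
    proof (rule IVT)
      show "\<forall>y. l \<le> y \<and> y \<le> h \<longrightarrow> isCont Phi y"
        using Phi_has_derivative DERIV_isCont by blast
    qed (use l h \<beta> lh in auto)
    then have inv: "Phi (inv Phi \<beta>) = \<beta>" by (auto intro: f_inv_into_f)
    have "l \<le> inv Phi \<beta>" using mono[of "inv Phi \<beta>" l] l \<beta> inv by linarith
    moreover have "inv Phi \<beta> \<le> h" using mono[of h "inv Phi \<beta>"] h \<beta> inv by linarith
    ultimately show ?thesis by linarith
  qed
  then show ?thesis by blast
qed

lemma regular_model_exists:
  assumes P: "positive_model P" "A1 P" "A3 P" and \<gamma>: "admissible_gamma P \<gamma>"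
  obtains blo bhi B v0 F \<gamma>0 Q where "regular_model P \<gamma> blo bhi B v0 F \<gamma>0 Q"
proof -
  have pos: "nu_p P i > 0 \<and> nu_f P i > 0 \<and> bcost P i > 0 \<and> hcost P i > 0" if "i \<ge> 1" for i
    using P(1) that by (simp add: positive_model_def)
  obtain blo where blo: "blo > 0" "\<And>i. i \<ge> 1 \<Longrightarrow> blo \<le> btilde P i"
    using P(2) INF_ereal_pos_bound[of "\<lambda>i. btilde P i"] unfolding A1_def by blast
  obtain bhi where bhi: "ereal bhi < 1" "\<And>i. i \<ge> 1 \<Longrightarrow> btilde P i \<le> bhi"
    using P(2) SUP_ereal_less_bound[of "\<lambda>i. btilde P i"] unfolding A1_def by blast
  obtain B where B: "\<And>i. i \<ge> 1 \<Longrightarrow> bcost P i + hcost P i \<le> B"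
    using P(2) SUP_ereal_less_bound[of "\<lambda>i. bcost P i + hcost P i"] unfolding A1_def by blast
  obtain v0 where v0: "v0 > 0" "\<And>i. i \<ge> 1 \<Longrightarrow> v0 \<le> nu_p P i"
    using P(3) INF_ereal_pos_bound[of "\<lambda>i. nu_p P i"] unfolding A3_def by blast
  obtain F where F: "\<And>i. i \<ge> 1 \<Longrightarrow> nu_f P i \<le> F"
    using P(3) SUP_ereal_less_bound[of "\<lambda>i. nu_f P i"] unfolding A3_def by blast
  obtain c where c: "ereal c < ereal (1 / (4 * exp 1))" "\<And>i. i \<ge> 1 \<Longrightarrow> nu_p P i / nu_f P i \<le> c"
    using P(3) SUP_ereal_less_bound[of "\<lambda>i. nu_p P i / nu_f P i"] unfolding A3_def by blast
  obtain \<gamma>0 where \<gamma>0: "\<gamma>0 > 0" "\<And>i. i \<ge> 1 \<Longrightarrow> \<gamma>0 \<le> \<gamma> i"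
    using \<gamma> INF_ereal_pos_bound[of "\<lambda>i. \<gamma> i"] unfolding admissible_gamma_def by blast
  have bhi1: "bhi < 1" using bhi(1) by (simp add: one_ereal_def)
  obtain Q where Q: "\<And>\<beta>. blo \<le> \<beta> \<Longrightarrow> \<beta> \<le> bhi \<Longrightarrow> \<bar>inv Phi \<beta>\<bar> \<le> Q"
    using inv_Phi_bounded[OF blo(1) bhi1] by blast
  have "1 / (4 * exp 1) \<le> (1 :: real)" proof -
    have "(1::real) \<le> 4 * exp 1" using exp_ge_add_one_self[of "1::real"] by linarith
    then show ?thesis by (simp only: divide_le_eq_1_pos mult_pos_pos zero_less_numeral exp_gt_zero)
  qed
  moreover have "c < 1 / (4 * exp 1)" using c(1) by simp
  ultimately have c1: "c \<le> 1" by (rule less_imp_le[OF less_le_trans, rotated])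
  have ratio: "nu_p P i \<le> nu_f P i" if "i \<ge> 1" for i
  proof -
    have "nu_p P i / nu_f P i \<le> 1" using c(2)[OF that] c1 by linarith
    then show ?thesis using pos[OF that] by (simp add: field_simps)
  qed
  have "regular_model P \<gamma> blo bhi B v0 F \<gamma>0 Q"
    by (unfold_locales) (use pos blo bhi bhi1 B v0 F \<gamma>0 Q ratio \<gamma> in \<open>auto simp: admissible_gamma_def\<close>)
  then show ?thesis by (rule that)
qed

lemma A2_avg_bound:
  assumes "A2 \<theta>"
  obtains \<Theta>0 where "\<forall>\<^sub>F n in sequentially. avg n \<theta> \<le> \<Theta>0"
proof -
  obtain c where "limsup (\<lambda>n. ereal (avg n \<theta>)) < ereal c"
    using ereal_dense2[of "limsup (\<lambda>n. ereal (avg n \<theta>))" \<infinity>] assms unfolding A2_def avg_def by auto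
  then have "\<forall>\<^sub>F n in sequentially. ereal (avg n \<theta>) < ereal c" by (rule Limsup_lessD)
  then have "\<forall>\<^sub>F n in sequentially. avg n \<theta> \<le> c" by (rule eventually_mono) simp
  then show ?thesis by (rule that)
qed

lemma a_seq_at_top: "filterlim a_seq at_top sequentially"
  unfolding a_seq_def[abs_def] by real_asymp

lemma grid_size_asymp:
  fixes C1 C2 :: real
  assumes "C1 > 0" "C2 > 0"
  shows "(\<lambda>n. (4 * C1 * (a_seq n)\<^sup>2 + 1) * (4 * C1 * C2 * (a_seq n)\<^sup>2 + 1) / ln (real n)) \<longlonglongrightarrow> 0"
  using assms unfolding a_seq_def by real_asymp

lemma bias_asymp:
  fixes g :: real
  assumes "g > 0"
  shows "(\<lambda>n. ln (real n) * bias_bound g (ln (real n))) \<longlonglongrightarrow> 0"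
proof -
  have g: "g\<^sup>2 / 4 > 0" using assms by simp
  have exp0: "((\<lambda>l. l ^ k * exp (- (h * l))) \<longlongrightarrow> 0) at_top" if h: "h > 0" for h :: real and k
  proof -
    have "((\<lambda>l. (h * l) ^ k / exp (h * l)) \<longlongrightarrow> 0) at_top"
      by (rule filterlim_compose[OF tendsto_power_div_exp_0])
         (use h in \<open>auto intro!: filterlim_tendsto_pos_mult_at_top[OF tendsto_const] filterlim_ident\<close>)
    then have "((\<lambda>l. (h * l) ^ k / exp (h * l) / h ^ k) \<longlongrightarrow> 0 / h ^ k) at_top"
      by (intro tendsto_intros) (use h in auto)
    moreover have "(\<lambda>l. (h * l) ^ k / exp (h * l) / h ^ k) = (\<lambda>l. l ^ k * exp (- (h * l)))"
      using h by (auto simp: fun_eq_iff exp_minus power_mult_distrib field_simps)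
    ultimately show ?thesis by simp
  qed
  have "((\<lambda>l. 4 * (l ^ 1 * exp (- (g\<^sup>2 / 4 * l))) + l ^ 2 * exp (- (g\<^sup>2 / 4 * l))
      + (12 * (l ^ 1 * exp (- (1/6 * l))) + 18 * (l ^ 2 * exp (- (1/6 * l))) + 9 * (l ^ 3 * exp (- (1/6 * l)))))
      \<longlongrightarrow> 4 * 0 + 0 + (12 * 0 + 18 * 0 + 9 * 0)) at_top"
    by (intro tendsto_intros exp0 g) simp_all
  moreover have "l * bias_bound g l = 4 * (l ^ 1 * exp (- (g\<^sup>2 / 4 * l))) + l ^ 2 * exp (- (g\<^sup>2 / 4 * l))
      + (12 * (l ^ 1 * exp (- (1/6 * l))) + 18 * (l ^ 2 * exp (- (1/6 * l))) + 9 * (l ^ 3 * exp (- (1/6 * l))))" for l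
    by (simp add: bias_bound_def power2_eq_square power3_eq_cube algebra_simps)
  ultimately have "((\<lambda>l. l * bias_bound g l) \<longlongrightarrow> 0) at_top" by simp
  then show ?thesis by (rule filterlim_compose) real_asymp
qed

lemma msq_asymp:
  fixes c d :: real
  assumes "d > 0"
  shows "(\<lambda>n. ln (real n) * sqrt ((c + d * msq_bound (ln (real n))) / real n)) \<longlonglongrightarrow> 0"
proof -
  have "(\<lambda>n. (ln (real n))\<^sup>2 * ((c + d * msq_bound (ln (real n))) / real n)) \<longlonglongrightarrow> 0"
    unfolding msq_bound_def using assms by real_asymp
  then have "(\<lambda>n. sqrt ((ln (real n))\<^sup>2 * ((c + d * msq_bound (ln (real n))) / real n))) \<longlonglongrightarrow> sqrt 0"
    by (rule tendsto_real_sqrt)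
  moreover have "\<forall>\<^sub>F n in sequentially. sqrt ((ln (real n))\<^sup>2 * ((c + d * msq_bound (ln (real n))) / real n))
      = ln (real n) * sqrt ((c + d * msq_bound (ln (real n))) / real n)"
    using eventually_ge_at_top[of 1] by eventually_elim (simp only: real_sqrt_mult real_sqrt_abs abs_of_nonneg ln_ge_zero real_of_nat_ge_one_iff)
  ultimately show ?thesis by (auto elim: Lim_transform_eventually)
qed

section \<open>Convergence of the regret bound to zero\<close>

context regular_model
begin

text \<open>The weight ln n is chosen because it dominates the size of the grid
  (\<open>grid_size_asymp\<close>).\<close>

lemma err_asymp: "(\<lambda>n. ln (real n) * err n) \<longlonglongrightarrow> 0"
proof -
  have "(\<lambda>n. B * sqrt (2 * F) * (ln (real n) * bias_bound \<gamma>0 (ln (real n)))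
      + ln (real n) * sqrt ((2 * B\<^sup>2 * F + 4 * B\<^sup>2 * F * msq_bound (ln (real n))) / real n))
      \<longlonglongrightarrow> B * sqrt (2 * F) * 0 + 0"
    using \<gamma>0(1) B_pos F_pos by (intro tendsto_intros bias_asymp msq_asymp) auto
  then show ?thesis by (simp add: err_def algebra_simps)
qed

lemma err_nonneg: "n \<ge> 3 \<Longrightarrow> err n \<ge> 0"
  using grid_point_error(2)[of n 0 "\<lambda>_. 0" 0]
  by (rule order_trans[OF Bochner_Integration.integral_nonneg, rotated]) auto

text \<open>The mean of the right-hand side of \<open>regret_bound\<close>: the two factors in front
  of \<open>err n\<close> bound the numbers of points of the two grids, and the last term contains
  the second moment from \<open>avg_integrable\<close>.\<close>

definition "regret_rate C1 C2 \<Theta>0 n =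
   2 * ((4 * C1 * (a_seq n)\<^sup>2 + 1) * (4 * C1 * C2 * (a_seq n)\<^sup>2 + 1) * err n)
     + (K1 (1 / (2 * C1)) (1 / (C1 * C2)) + K2 \<Theta>0) * (2 * (1 + \<Theta>0)\<^sup>2 + 2 * F) / a_seq n"

lemma regret_rate_tendsto:
  assumes "C1 > 0" "C2 > 0"
  shows "regret_rate C1 C2 \<Theta>0 \<longlonglongrightarrow> 0"
proof -
  have "(\<lambda>n. (4 * C1 * (a_seq n)\<^sup>2 + 1) * (4 * C1 * C2 * (a_seq n)\<^sup>2 + 1) / ln (real n) * (ln (real n) * err n)) \<longlonglongrightarrow> 0 * 0"
    by (intro tendsto_mult grid_size_asymp[OF assms] err_asymp)
  moreover have "\<forall>\<^sub>F n in sequentially. (4 * C1 * (a_seq n)\<^sup>2 + 1) * (4 * C1 * C2 * (a_seq n)\<^sup>2 + 1) / ln (real n) * (ln (real n) * err n)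
      = (4 * C1 * (a_seq n)\<^sup>2 + 1) * (4 * C1 * C2 * (a_seq n)\<^sup>2 + 1) * err n"
    using eventually_ge_at_top[of 2] by eventually_elim simp
  ultimately have 1: "(\<lambda>n. (4 * C1 * (a_seq n)\<^sup>2 + 1) * (4 * C1 * C2 * (a_seq n)\<^sup>2 + 1) * err n) \<longlonglongrightarrow> 0"
    by (auto elim: Lim_transform_eventually)
  have 2: "(\<lambda>n. c / a_seq n) \<longlonglongrightarrow> 0" for c :: real
    by (intro tendsto_divide_0[OF tendsto_const] filterlim_at_top_imp_at_infinity a_seq_at_top)
  have "(\<lambda>n. 2 * ((4 * C1 * (a_seq n)\<^sup>2 + 1) * (4 * C1 * C2 * (a_seq n)\<^sup>2 + 1) * err n)
     + (K1 (1 / (2 * C1)) (1 / (C1 * C2)) + K2 \<Theta>0) * (2 * (1 + \<Theta>0)\<^sup>2 + 2 * F) / a_seq n) \<longlonglongrightarrow> 2 * 0 + 0"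
    by (intro tendsto_add tendsto_mult_left 1 2)
  then show ?thesis by (simp add: regret_rate_def[abs_def])
qed

text \<open>In the denominator of \<open>delta2\<close> the term a^2 dominates as a tends to
  infinity, so the bracket lies between a^2 / 2 and 2 * a^2. This holds for any C3 and C4; for small
  n the spacing need not be positive.\<close>

lemma eventually_grid_scale:
  fixes C1 C2 C3 C4 :: real
  assumes C: "C1 > 0" "C2 > 0"
  shows "\<forall>\<^sub>F n in sequentially. n \<ge> 3 \<and> a_seq n \<ge> 1 \<and> 1 / (2 * C1 * a_seq n) \<le> 2 * a_seq n
     \<and> delta2 C1 C2 C3 C4 n > 0 \<and> delta2 C1 C2 C3 C4 n \<le> (1 / (C1 * C2)) / (a_seq n)\<^sup>2
     \<and> 1 / delta2 C1 C2 C3 C4 n \<le> 4 * C1 * C2 * (a_seq n)\<^sup>2"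
proof -
  define p where "p a = 2 * \<phi> 0 + C3 + sqrt a * C4 + a + a\<^sup>2" for a
  have "((\<lambda>a::real. (c + sqrt a * d + a + a\<^sup>2) / a\<^sup>2) \<longlongrightarrow> 1) at_top" for c d :: real
    by real_asymp
  from this[of "2 * \<phi> 0 + C3" C4]
  have "((\<lambda>a. p a / a\<^sup>2) \<longlongrightarrow> 1) at_top" by (simp add: p_def)
  then have "\<forall>\<^sub>F a in at_top. 1/2 < p a / a\<^sup>2" "\<forall>\<^sub>F a in at_top. p a / a\<^sup>2 < 2"
    by (rule order_tendstoD; simp)+
  then have *: "\<forall>\<^sub>F a in at_top. 1 \<le> a \<and> 1 / (4 * C1) \<le> a \<and> 1/2 < p a / a\<^sup>2 \<and> p a / a\<^sup>2 < 2"
    using eventually_ge_at_top[of "1::real"] eventually_ge_at_top[of "1 / (4 * C1)"] by eventually_elim auto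
  have "\<forall>\<^sub>F n in sequentially. 1 \<le> a_seq n \<and> 1 / (4 * C1) \<le> a_seq n
      \<and> 1/2 < p (a_seq n) / (a_seq n)\<^sup>2 \<and> p (a_seq n) / (a_seq n)\<^sup>2 < 2"
    using eventually_compose_filterlim[OF * a_seq_at_top] .
  then show ?thesis using eventually_ge_at_top[of "3::nat"]
  proof eventually_elim
    case (elim n)
    let ?a = "a_seq n"
    have a: "?a \<ge> 1" "?a\<^sup>2 > 0" using elim by auto
    have p: "?a\<^sup>2 / 2 < p ?a" "p ?a < 2 * ?a\<^sup>2" using elim a by (auto simp: field_simps)
    have p0: "p ?a > 0" using p a by linarith
    have d: "delta2 C1 C2 C3 C4 n = 1 / (2 * C1 * C2 * p ?a)" by (simp add: delta2_def p_def)
    have "1 / (2 * C1 * ?a) \<le> 1 / (2 * C1)"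
      using C a by (intro divide_left_mono) auto
    also have "\<dots> \<le> 2 * ?a" using elim by simp
    finally have 1: "1 / (2 * C1 * ?a) \<le> 2 * ?a" .
    have 2: "delta2 C1 C2 C3 C4 n > 0" using C p0 by (simp add: d)
    have "delta2 C1 C2 C3 C4 n \<le> 1 / (2 * C1 * C2 * (?a\<^sup>2 / 2))"
      unfolding d using C p a p0 by (intro divide_left_mono mult_left_mono) auto
    also have "\<dots> = (1 / (C1 * C2)) / ?a\<^sup>2" by simp
    finally have 3: "delta2 C1 C2 C3 C4 n \<le> (1 / (C1 * C2)) / ?a\<^sup>2" .
    have "1 / delta2 C1 C2 C3 C4 n = 2 * C1 * C2 * p ?a" by (simp add: d)
    also have "\<dots> \<le> 2 * C1 * C2 * (2 * ?a\<^sup>2)" using C p by (intro mult_left_mono) auto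
    finally have 4: "1 / delta2 C1 C2 C3 C4 n \<le> 4 * C1 * C2 * ?a\<^sup>2" by simp
    show ?case using elim 1 2 3 4 by blast
  qed
qed

text \<open>One dominating variable Y serves both claims: being nonnegative it admits Markov's
  inequality for the probability, and together with the integrability of the two losses it bounds
  the difference of the risks.\<close>

lemma regret_expectation:
  fixes \<eta>D \<tau>D \<eta>h :: "(nat \<Rightarrow> real) \<Rightarrow> real" and \<tau>h :: "(nat \<Rightarrow> real) \<Rightarrow> ennreal" and C1 C2 C3 C4 s \<Theta>0 :: real
  assumes C: "C1 > 0" "C2 > 0" and \<Theta>: "avg n \<theta> \<le> \<Theta>0"
    and scale: "n \<ge> 3 \<and> a_seq n \<ge> 1 \<and> 1 / (2 * C1 * a_seq n) \<le> 2 * a_seq n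
     \<and> delta2 C1 C2 C3 C4 n > 0 \<and> delta2 C1 C2 C3 C4 n \<le> (1 / (C1 * C2)) / (a_seq n)\<^sup>2
     \<and> 1 / delta2 C1 C2 C3 C4 n \<le> 4 * C1 * C2 * (a_seq n)\<^sup>2"
    and D: "\<eta>D \<in> borel_measurable (sample_space n) \<and> \<tau>D \<in> borel_measurable (sample_space n) \<and>
           (\<forall>x\<in>space (sample_space n).
              is_arg_min (\<lambda>(\<eta>, \<tau>). ARE_D P \<gamma> n x \<eta> \<tau>)
                (\<lambda>p. p \<in> eta_candidates (grid1 C1 s n) (M_hat P n x) \<times> grid2 C1 C2 C3 C4 n)
                (\<eta>D x, \<tau>D x))"
    and h: "\<eta>h \<in> borel_measurable (sample_space n) \<and> \<tau>h \<in> borel_measurable (sample_space n) \<and>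
           (\<forall>x\<in>space (sample_space n). \<eta>h x \<in> M_hat P n x)"
  defines "lD \<equiv> \<lambda>x. loss P n \<theta> (predictor P (\<eta>D x) (ennreal (\<tau>D x)) x)"
    and "lh \<equiv> \<lambda>x. loss P n \<theta> (predictor P (\<eta>h x) (\<tau>h x) x)"
  shows "integrable (X_law P n \<theta>) lD" "integrable (X_law P n \<theta>) lh"
    and "\<exists>Y. integrable (X_law P n \<theta>) Y \<and> (\<forall>x\<in>space (X_law P n \<theta>). lD x - lh x \<le> Y x \<and> 0 \<le> Y x)
           \<and> (\<integral>x. Y x \<partial>X_law P n \<theta>) \<le> regret_rate C1 C2 \<Theta>0 n" (is ?g1)
proof -
  interpret prob_space "X_law P n \<theta>" by (rule prob_space_X_law)
  let ?a = "a_seq n"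
  let ?L = "grid1 C1 s n" and ?\<Lambda> = "grid2 C1 C2 C3 C4 n"
  let ?K = "K1 (1 / (2 * C1)) (1 / (C1 * C2)) + K2 \<Theta>0"
  have n: "n \<ge> 1" "n \<ge> 3" and a: "?a \<ge> 1" using scale by auto
  have \<delta>: "1 / (2 * C1 * ?a) > 0" using C a by simp
  have fin: "finite ?L" "finite ?\<Lambda>"
    unfolding grid1_eq using a by (simp_all only: finite_card_lattice[OF \<delta>] finite_card_grid2)
  have card1: "real (card ?L) \<le> 4 * C1 * ?a\<^sup>2 + 1"
  proof -
    have "real (card ?L) \<le> 2 * ?a / (1 / (2 * C1 * ?a)) + 1"
      unfolding grid1_eq using \<delta> a by (intro finite_card_lattice) auto
    then show ?thesis by (simp add: power2_eq_square mult_ac)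
  qed
  have card2: "real (card ?\<Lambda>) \<le> 4 * C1 * C2 * ?a\<^sup>2 + 1"
  proof -
    have "real (card ?\<Lambda>) \<le> real (nat \<lceil>1 / delta2 C1 C2 C3 C4 n\<rceil>)" using finite_card_grid2(2) by simp
    also have "\<dots> \<le> 1 / delta2 C1 C2 C3 C4 n + 1" using scale by simp
    finally show ?thesis using scale by linarith
  qed
  define E where "E p x = \<bar>loss P n \<theta> (predictor P (fst p) (ennreal (snd p)) x) - ARE_D P \<gamma> n x (fst p) (snd p)\<bar>" for p x
  have E: "integrable (X_law P n \<theta>) (E p)" "(\<integral>x. E p x \<partial>X_law P n \<theta>) \<le> err n" if "p \<in> ?L \<times> ?\<Lambda>" for p
  proof -
    have \<tau>: "snd p \<ge> 0" using that grid2_nonneg by auto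
    show "integrable (X_law P n \<theta>) (E p)"
      unfolding E_def using grid_point_error(1)[OF n(2) \<tau>] by (rule integrable_abs)
    show "(\<integral>x. E p x \<partial>X_law P n \<theta>) \<le> err n"
      unfolding E_def by (rule grid_point_error(2)[OF n(2) \<tau>])
  qed
  have K: "?K \<ge> 0"
  proof -
    have "\<Theta>0 \<ge> 0" using \<Theta> avg_nonneg[of n \<theta>] by linarith
    then show ?thesis
      using B_pos c\<alpha>_nonneg C F_pos Q_nonneg c0_nonneg \<kappa>_pos by (simp add: K1_def K2_def)
  qed
  define Y where "Y x = 2 * (\<Sum>p\<in>?L \<times> ?\<Lambda>. E p x) + ?K * (1 + avg n x)\<^sup>2 / ?a" for x
  have intE: "integrable (X_law P n \<theta>) (\<lambda>x. \<Sum>p\<in>?L \<times> ?\<Lambda>. E p x)"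
    by (intro Bochner_Integration.integrable_sum E)
  have intA: "integrable (X_law P n \<theta>) (\<lambda>x. ?K * (1 + avg n x)\<^sup>2 / ?a)"
    by (intro integrable_divide integrable_mult_right avg_integrable(2)[OF n(1) \<Theta>])
  have intY: "integrable (X_law P n \<theta>) Y"
    unfolding Y_def[abs_def] using intE intA by simp
  have "(\<integral>x. Y x \<partial>X_law P n \<theta>) = 2 * (\<Sum>p\<in>?L \<times> ?\<Lambda>. \<integral>x. E p x \<partial>X_law P n \<theta>)
      + ?K * (\<integral>x. (1 + avg n x)\<^sup>2 \<partial>X_law P n \<theta>) / ?a"
    unfolding Y_def using intE intA E(1) by simp
  also have "\<dots> \<le> 2 * (\<Sum>p\<in>?L \<times> ?\<Lambda>. err n) + ?K * (2 * (1 + \<Theta>0)\<^sup>2 + 2 * F) / ?a"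
    using K a by (intro add_mono mult_left_mono sum_mono divide_right_mono E avg_integrable(3)[OF n(1) \<Theta>]) auto
  also have "(\<Sum>p\<in>?L \<times> ?\<Lambda>. err n) = real (card ?L) * real (card ?\<Lambda>) * err n"
    by (simp add: card_cartesian_product)
  also have "2 * (real (card ?L) * real (card ?\<Lambda>) * err n) + ?K * (2 * (1 + \<Theta>0)\<^sup>2 + 2 * F) / ?a
      \<le> 2 * ((4 * C1 * ?a\<^sup>2 + 1) * (4 * C1 * C2 * ?a\<^sup>2 + 1) * err n) + ?K * (2 * (1 + \<Theta>0)\<^sup>2 + 2 * F) / ?a"
    using card1 card2 C by (intro add_right_mono mult_left_mono mult_right_mono mult_mono err_nonneg[OF n(2)]) auto
  finally have EY: "(\<integral>x. Y x \<partial>X_law P n \<theta>) \<le> regret_rate C1 C2 \<Theta>0 n"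
    unfolding regret_rate_def .
  have "lD x - lh x \<le> Y x \<and> 0 \<le> Y x" if "x \<in> space (X_law P n \<theta>)" for x
  proof
    have x: "x \<in> space (sample_space n)" using that by (simp add: space_X_law)
    show "lD x - lh x \<le> Y x"
      unfolding lD_def lh_def Y_def E_def
    proof (rule regret_bound)
      show "1 / (2 * C1 * a_seq n) \<le> 1 / (2 * C1) / a_seq n" by simp
      show "is_arg_min (\<lambda>(\<eta>, \<tau>). ARE_D P \<gamma> n x \<eta> \<tau>)
                (\<lambda>p. p \<in> eta_candidates (grid1 C1 s n) (M_hat P n x) \<times> grid2 C1 C2 C3 C4 n)
                (\<eta>D x, \<tau>D x)" using D x by blast
      show "\<eta>h x \<in> M_hat P n x" using h x by blast
    qed (use n a \<Theta> C scale in auto)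
    have "0 \<le> ?K * (1 + avg n x)\<^sup>2 / ?a"
      by (rule divide_nonneg_nonneg[OF mult_nonneg_nonneg[OF K]]) (use a in auto)
    then show "0 \<le> Y x" unfolding Y_def E_def by (simp add: sum_nonneg)
  qed
  with intY EY show ?g1 by blast
  show "integrable (X_law P n \<theta>) lD"
    unfolding lD_def
  proof (rule loss_integrable[where c="?a" and k=0, OF n(1)])
    fix x assume "x \<in> space (sample_space n)"
    then have "\<eta>D x \<in> eta_candidates (grid1 C1 s n) (M_hat P n x)"
      using D by (auto simp: is_arg_min_def)
    then have "\<eta>D x \<in> grid1 C1 s n" using eta_candidates_subset by blast
    then show "\<bar>\<eta>D x\<bar> \<le> ?a + 0 * avg n x" by (auto simp: grid1_def)
  qed (use D a in \<open>auto intro: measurable_compose\<close>)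
  show "integrable (X_law P n \<theta>) lh"
    unfolding lh_def
  proof (rule loss_integrable[where c=0 and k=\<kappa>, OF n(1)])
    fix x assume "x \<in> space (sample_space n)"
    then have "\<eta>h x \<in> M_hat P n x" using h by blast
    then show "\<bar>\<eta>h x\<bar> \<le> 0 + \<kappa> * avg n x" using M_hat_bound(1)[OF n(1)] by simp
  qed (use h \<kappa>_pos in auto)
qed

end

lemma constants_ok_pos:
  assumes P: "positive_model P" and "constants_ok P \<Theta> C1 C2 C3 C4"
  shows "C1 > 0" "C2 > 0"
proof -
  have "\<forall>\<^sub>F n in sequentially. n \<ge> 1 \<and> (MAX i\<in>{1..n}. bcost P i + hcost P i) \<le> C1 \<and> (MAX i\<in>{1..n}. nu_p P i) \<le> C2"
    using assms(2) eventually_ge_at_top[of "1::nat"] unfolding constants_ok_def by eventually_elim auto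
  then obtain n where n: "n \<ge> 1" "(MAX i\<in>{1..n}. bcost P i + hcost P i) \<le> C1" "(MAX i\<in>{1..n}. nu_p P i) \<le> C2"
    using eventually_happens trivial_limit_sequentially by blast
  have pos: "bcost P 1 + hcost P 1 > 0" "nu_p P 1 > 0" using P by (auto simp: positive_model_def add_pos_pos)
  have "bcost P 1 + hcost P 1 \<le> (MAX i\<in>{1..n}. bcost P i + hcost P i)" using n(1) by (intro Max_ge) auto
  then show "C1 > 0" using pos n by linarith
  have "nu_p P 1 \<le> (MAX i\<in>{1..n}. nu_p P i)" using n(1) by (intro Max_ge) auto
  then show "C2 > 0" using pos n by linarith
qed

theorem corollary1p2:
  fixes P :: model and \<gamma> \<theta> :: "nat \<Rightarrow> real" and \<Theta> :: "nat \<Rightarrow> (nat \<Rightarrow> real) set"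
    and C1 C2 C3 C4 :: real and grid_offset :: "nat \<Rightarrow> real"
    and \<eta>D \<tau>D \<eta>h :: "nat \<Rightarrow> (nat \<Rightarrow> real) \<Rightarrow> real" and \<tau>h :: "nat \<Rightarrow> (nat \<Rightarrow> real) \<Rightarrow> ennreal"
  assumes "positive_model P" and "A1 P" and "A3 P" and "A2 \<theta>"
    and "admissible_gamma P \<gamma>"
    and "parameter_sets \<Theta>" and "constants_ok P \<Theta> C1 C2 C3 C4"
    and "\<forall>\<^sub>F n in sequentially.
           \<eta>D n \<in> borel_measurable (sample_space n) \<and> \<tau>D n \<in> borel_measurable (sample_space n) \<and>
           (\<forall>x\<in>space (sample_space n).
              is_arg_min (\<lambda>(\<eta>, \<tau>). ARE_D P \<gamma> n x \<eta> \<tau>)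
                (\<lambda>p. p \<in> eta_candidates (grid1 C1 (grid_offset n) n) (M_hat P n x)
                          \<times> grid2 C1 C2 C3 C4 n)
                (\<eta>D n x, \<tau>D n x))"
    and "\<forall>\<^sub>F n in sequentially.
           \<eta>h n \<in> borel_measurable (sample_space n) \<and> \<tau>h n \<in> borel_measurable (sample_space n) \<and>
           (\<forall>x\<in>space (sample_space n). \<eta>h n x \<in> M_hat P n x)"
  shows "(\<forall>\<epsilon>>0. (\<lambda>n. measure (X_law P n \<theta>)
            {x \<in> space (X_law P n \<theta>).
               loss P n \<theta> (predictor P (\<eta>D n x) (ennreal (\<tau>D n x)) x)
               \<ge> loss P n \<theta> (predictor P (\<eta>h n x) (\<tau>h n x) x) + \<epsilon>}) \<longlonglongrightarrow> 0)
    \<and> limsup (\<lambda>n. ereal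
          (risk P n \<theta> (\<lambda>x. predictor P (\<eta>D n x) (ennreal (\<tau>D n x)) x)
           - risk P n \<theta> (\<lambda>x. predictor P (\<eta>h n x) (\<tau>h n x) x))) \<le> 0"
proof -
  obtain blo bhi B v0 F \<gamma>0 Q where "regular_model P \<gamma> blo bhi B v0 F \<gamma>0 Q"
    by (rule regular_model_exists[OF assms(1-3,5)])
  then interpret regular_model P \<gamma> blo bhi B v0 F \<gamma>0 Q .
  obtain \<Theta>0 where \<Theta>0: "\<forall>\<^sub>F n in sequentially. avg n \<theta> \<le> \<Theta>0" by (rule A2_avg_bound[OF assms(4)])
  note C = constants_ok_pos[OF assms(1,7)]
  define lD where "lD n x = loss P n \<theta> (predictor P (\<eta>D n x) (ennreal (\<tau>D n x)) x)" for n x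
  define lh where "lh n x = loss P n \<theta> (predictor P (\<eta>h n x) (\<tau>h n x) x)" for n x
  let ?y = "regret_rate C1 C2 \<Theta>0"
  have y: "?y \<longlonglongrightarrow> 0" by (rule regret_rate_tendsto[OF C])
  have ev: "\<forall>\<^sub>F n in sequentially. integrable (X_law P n \<theta>) (lD n) \<and> integrable (X_law P n \<theta>) (lh n) \<and>
     (\<exists>Y. integrable (X_law P n \<theta>) Y \<and> (\<forall>x\<in>space (X_law P n \<theta>). lD n x - lh n x \<le> Y x \<and> 0 \<le> Y x)
           \<and> (\<integral>x. Y x \<partial>X_law P n \<theta>) \<le> ?y n)"
    using assms(8,9) \<Theta>0 eventually_grid_scale[OF C, of C3 C4]
  proof eventually_elim
    case (elim n)
    from regret_expectation[OF C elim(3,4,1,2)] show ?case unfolding lD_def lh_def by blast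
  qed
  have "(\<lambda>n. measure (X_law P n \<theta>) {x \<in> space (X_law P n \<theta>). lD n x \<ge> lh n x + \<epsilon>}) \<longlonglongrightarrow> 0" if \<epsilon>: "\<epsilon> > 0" for \<epsilon>
  proof (rule tendsto_sandwich[where f="\<lambda>_. 0"])
    show "\<forall>\<^sub>F n in sequentially. measure (X_law P n \<theta>) {x \<in> space (X_law P n \<theta>). lD n x \<ge> lh n x + \<epsilon>} \<le> ?y n / \<epsilon>"
      using ev
    proof eventually_elim
      case (elim n)
      then obtain Y where Y: "integrable (X_law P n \<theta>) Y"
        "\<And>x. x \<in> space (X_law P n \<theta>) \<Longrightarrow> lD n x - lh n x \<le> Y x \<and> 0 \<le> Y x" "(\<integral>x. Y x \<partial>X_law P n \<theta>) \<le> ?y n"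
        by blast
      interpret X: prob_space "X_law P n \<theta>" by (rule prob_space_X_law)
      have [measurable]: "Y \<in> borel_measurable (X_law P n \<theta>)" using Y(1) by simp
      have "measure (X_law P n \<theta>) {x \<in> space (X_law P n \<theta>). lD n x \<ge> lh n x + \<epsilon>}
          \<le> measure (X_law P n \<theta>) {x \<in> space (X_law P n \<theta>). \<epsilon> \<le> Y x}"
      proof (rule X.finite_measure_mono)
        show "{x \<in> space (X_law P n \<theta>). lD n x \<ge> lh n x + \<epsilon>} \<subseteq> {x \<in> space (X_law P n \<theta>). \<epsilon> \<le> Y x}"
        proof safe
          fix x assume "x \<in> space (X_law P n \<theta>)" "lD n x \<ge> lh n x + \<epsilon>"
          then show "\<epsilon> \<le> Y x" using Y(2)[of x] by linarith
        qed
      qed measurable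
      also have "\<dots> \<le> (\<integral>x. Y x \<partial>X_law P n \<theta>) / \<epsilon>"
        using Y(2) \<epsilon> by (intro integral_Markov_inequality_measure[where A="{}"] Y(1)) auto
      also have "\<dots> \<le> ?y n / \<epsilon>" using Y(3) \<epsilon> by (intro divide_right_mono) auto
      finally show ?case .
    qed
    show "(\<lambda>n. ?y n / \<epsilon>) \<longlonglongrightarrow> 0" using tendsto_divide[OF y tendsto_const[of \<epsilon>]] \<epsilon> by simp
  qed auto
  moreover have "limsup (\<lambda>n. ereal ((\<integral>x. lD n x \<partial>X_law P n \<theta>) - (\<integral>x. lh n x \<partial>X_law P n \<theta>))) \<le> 0"
  proof -
    have "\<forall>\<^sub>F n in sequentially. ereal ((\<integral>x. lD n x \<partial>X_law P n \<theta>) - (\<integral>x. lh n x \<partial>X_law P n \<theta>)) \<le> ereal (?y n)"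
      using ev
    proof eventually_elim
      case (elim n)
      then obtain Y where Y: "integrable (X_law P n \<theta>) Y"
        "\<And>x. x \<in> space (X_law P n \<theta>) \<Longrightarrow> lD n x - lh n x \<le> Y x \<and> 0 \<le> Y x" "(\<integral>x. Y x \<partial>X_law P n \<theta>) \<le> ?y n"
        by blast
      have "(\<integral>x. lD n x \<partial>X_law P n \<theta>) - (\<integral>x. lh n x \<partial>X_law P n \<theta>) = (\<integral>x. lD n x - lh n x \<partial>X_law P n \<theta>)"
        using elim by simp
      also have "\<dots> \<le> (\<integral>x. Y x \<partial>X_law P n \<theta>)"
        using elim Y by (intro integral_mono) auto
      finally show ?case using Y(3) by simp
    qed
    then have "limsup (\<lambda>n. ereal ((\<integral>x. lD n x \<partial>X_law P n \<theta>) - (\<integral>x. lh n x \<partial>X_law P n \<theta>))) \<le> limsup (\<lambda>n. ereal (?y n))"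
      by (rule Limsup_mono)
    also have "\<dots> = 0"
      using y by (intro lim_imp_Limsup) (auto simp: zero_ereal_def)
    finally show ?thesis .
  qed
  ultimately show ?thesis unfolding risk_def lD_def lh_def by blast
qed

end
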